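(* Let $S\in\mathbf B^0(\mathcal H)$. The following are equivalent: (i) $S$ is a compact operator; (ii) $\lim_{X\to\infty}\mathbf T_X(S)=0$; (iii) $\lim_{X\to\mathcal X}\mathbf T_X(S)=0$ for all $\mathcal X\in\delta(\Xi)$. Here the limits are taken in the $^*$-strong topology or, equivalently, in the strict topology defined by the essential ideal $\mathbf C_0(\mathcal H)$.
   Context: $\mathscr X$ is an $n$-dimensional real vector space (with Lebesgue measure), $\mathscr X^*$ its dual, $\Xi:=\mathscr X\times\mathscr X^*$, $\mathcal H:=L^2(\mathscr X)$, $\mathbf B(\mathcal H)$ the $C^*$-algebra of bounded linear operators in $\mathcal H$ and $\mathbf C_0(\mathcal H)$ its ideal of compact operators. For $X=(x,\xi)\in\Xi$ the unitary operator $W(X)$ is $[W(x,\xi)u](y):=e^{i(y-x/2)\cdot\xi}u(y-x)$, $y\in\mathscr X$, $u\in\mathcal H$, where $z\cdot\zeta:=\zeta(z)$. For $S\in\mathbf B(\mathcal H)$ set $\mathbf T_X(S):=W(X)SW(-X)$. Define the $C^*$-algebra $$\mathbf B^0(\mathcal H):=\{S\in\mathbf B(\mathcal H)\mid \Xi\ni X\mapsto\mathbf T_X(S)\in\mathbf B(\mathcal H)\ \text{is norm-continuous}\}.$$ The Fréchet filter on $\Xi$, denoted $\infty$, consists of the complements of all relatively compact subsets of $\Xi$ (so $X\to\infty$ means convergence along this filter); $\delta(\Xi)$ denotes the family of all ultrafilters on $\Xi$ that are finer than (i.e. contain) the Fréchet filter. The $\mathbf C_0(\mathcal H)$-strict topology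 is defined by the seminorms $S\mapsto\|KS\|+\|SK\|$, $K\in\mathbf C_0(\mathcal H)$. The $^*$-strong topology is defined by the seminorms $S\mapsto\|Su\|+\|S^*u\|$, $u\in\mathcal H$. *)

theory Defs
  imports "HOL-Analysis.Analysis"
begin

section \<open>The complex Hilbert space of square-integrable functions\<close>

definition square_integrable :: "('a::euclidean_space \<Rightarrow> complex) \<Rightarrow> bool" where
  "square_integrable f \<longleftrightarrow>
     f \<in> borel_measurable lborel \<and> integrable lborel (\<lambda>y. (cmod (f y))\<^sup>2)"

definition L2_rel :: "('a::euclidean_space \<Rightarrow> complex) \<Rightarrow> ('a \<Rightarrow> complex) \<Rightarrow> bool" where
  "L2_rel f g \<longleftrightarrow> square_integrable f \<and> square_integrable g \<and> (AE y in lborel. f y = g y)"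

lemma square_integrable_measurable:
  "square_integrable f \<Longrightarrow> f \<in> borel_measurable borel"
  by (simp add: square_integrable_def)

lemma square_integrable_zero: "square_integrable (\<lambda>_. 0)"
  by (simp add: square_integrable_def)

lemma square_integrable_mult_bounded:
  assumes f: "square_integrable f" and [measurable]: "g \<in> borel_measurable borel"
    and bd: "\<And>y. cmod (g y) \<le> c"
  shows "square_integrable (\<lambda>y. g y * f y)"
proof -
  have [measurable]: "f \<in> borel_measurable borel"
    using f by (rule square_integrable_measurable)
  have "integrable lborel (\<lambda>y. c\<^sup>2 * (cmod (f y))\<^sup>2)"
    using f by (simp add: square_integrable_def)
  then have "integrable lborel (\<lambda>y. (cmod (g y * f y))\<^sup>2)"
  proof (rule Bochner_Integration.integrable_bound)
    show "AE y in lborel. norm ((cmod (g y * f y))\<^sup>2) \<le> norm (c\<^sup>2 * (cmod (f y))\<^sup>2)"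
      using bd by (auto simp: norm_mult power_mult_distrib intro!: mult_right_mono power_mono)
  qed simp
  then show ?thesis by (simp add: square_integrable_def)
qed

lemma square_integrable_cmult:
  "square_integrable f \<Longrightarrow> square_integrable (\<lambda>y. c * f y)"
  by (rule square_integrable_mult_bounded[where c = "cmod c"]) auto

lemma square_integrable_add:
  assumes f: "square_integrable f" and g: "square_integrable g"
  shows "square_integrable (\<lambda>y. f y + g y)"
proof -
  have [measurable]: "f \<in> borel_measurable borel" "g \<in> borel_measurable borel"
    using f g by (auto intro: square_integrable_measurable)
  have "integrable lborel (\<lambda>y. 2 * (cmod (f y))\<^sup>2 + 2 * (cmod (g y))\<^sup>2)"
    using f g by (simp add: square_integrable_def)
  then have "integrable lborel (\<lambda>y. (cmod (f y + g y))\<^sup>2)"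
  proof (rule Bochner_Integration.integrable_bound)
    have "(cmod (a + b))\<^sup>2 \<le> 2 * (cmod a)\<^sup>2 + 2 * (cmod b)\<^sup>2" for a b
    proof -
      have "(cmod (a + b))\<^sup>2 \<le> (cmod a + cmod b)\<^sup>2"
        by (intro power_mono norm_triangle_ineq) auto
      moreover have "0 \<le> (cmod a - cmod b)\<^sup>2" by simp
      ultimately show ?thesis by (simp add: power2_sum power2_diff)
    qed
    then show "AE y in lborel. norm ((cmod (f y + g y))\<^sup>2)
        \<le> norm (2 * (cmod (f y))\<^sup>2 + 2 * (cmod (g y))\<^sup>2)"
      by simp
  qed simp
  then show ?thesis by (simp add: square_integrable_def)
qed

lemma square_integrable_prod:
  assumes f: "square_integrable f" and g: "square_integrable g"
  shows "integrable lborel (\<lambda>y. f y * cnj (g y))"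
proof -
  have [measurable]: "f \<in> borel_measurable borel" "g \<in> borel_measurable borel"
    using f g by (auto intro: square_integrable_measurable)
  have [measurable]: "(\<lambda>y. cnj (g y)) \<in> borel_measurable borel"
    by (rule borel_measurable_continuous_on[where f = cnj and g = g])
      (auto intro!: continuous_intros)
  have "integrable lborel (\<lambda>y. (cmod (f y))\<^sup>2 + (cmod (g y))\<^sup>2)"
    using f g by (simp add: square_integrable_def)
  then show ?thesis
  proof (rule Bochner_Integration.integrable_bound)
    have "cmod a * cmod b \<le> (cmod a)\<^sup>2 + (cmod b)\<^sup>2" for a b
    proof -
      have "0 \<le> (cmod a - cmod b)\<^sup>2" "0 \<le> cmod a * cmod b" by simp_all
      then have "2 * (cmod a * cmod b) \<le> (cmod a)\<^sup>2 + (cmod b)\<^sup>2"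
        by (simp add: power2_diff)
      with \<open>0 \<le> cmod a * cmod b\<close> show ?thesis by linarith
    qed
    then show "AE y in lborel. norm (f y * cnj (g y))
        \<le> norm ((cmod (f y))\<^sup>2 + (cmod (g y))\<^sup>2)"
      by (simp add: norm_mult)
  qed simp
qed

quotient_type (overloaded) 'a L2 = "'a::euclidean_space \<Rightarrow> complex" / partial: L2_rel
proof (rule part_equivpI)
  show "\<exists>f. L2_rel f f"
    by (rule exI[of _ "\<lambda>_. 0"]) (simp add: L2_rel_def square_integrable_zero)
  show "symp L2_rel" by (rule sympI) (auto simp: L2_rel_def)
  show "transp L2_rel" by (rule transpI) (auto simp: L2_rel_def elim!: AE_mp)
qed

lift_definition scaleC_L2 :: "complex \<Rightarrow> 'a::euclidean_space L2 \<Rightarrow> 'a L2" is "\<lambda>c f y. c * f y"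
  by (auto simp: L2_rel_def square_integrable_cmult)

lift_definition cinner_L2 :: "'a::euclidean_space L2 \<Rightarrow> 'a L2 \<Rightarrow> complex"
  is "\<lambda>f g. LINT y|lborel. f y * cnj (g y)"
proof -
  fix f f' g g' :: "'a \<Rightarrow> complex"
  assume "L2_rel f f'" "L2_rel g g'"
  then have "AE y in lborel. f y = f' y" "AE y in lborel. g y = g' y"
    and "integrable lborel (\<lambda>y. f y * cnj (g y))" "integrable lborel (\<lambda>y. f' y * cnj (g' y))"
    by (auto simp: L2_rel_def square_integrable_prod)
  then show "(LINT y|lborel. f y * cnj (g y)) = (LINT y|lborel. f' y * cnj (g' y))"
    by (intro integral_cong_AE borel_measurable_integrable) auto
qed

instantiation L2 :: (euclidean_space) real_vector
begin

lift_definition zero_L2 :: "'a L2" is "\<lambda>_. 0"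
  by (simp add: L2_rel_def square_integrable_zero)

lift_definition plus_L2 :: "'a L2 \<Rightarrow> 'a L2 \<Rightarrow> 'a L2" is "\<lambda>f g y. f y + g y"
  by (auto simp: L2_rel_def square_integrable_add elim!: AE_mp)

definition uminus_L2 :: "'a L2 \<Rightarrow> 'a L2" where
  "uminus_L2 u = scaleC_L2 (-1) u"

definition minus_L2 :: "'a L2 \<Rightarrow> 'a L2 \<Rightarrow> 'a L2" where
  "minus_L2 u v = u + (- v)"

definition scaleR_L2 :: "real \<Rightarrow> 'a L2 \<Rightarrow> 'a L2" where
  "scaleR_L2 r u = scaleC_L2 (complex_of_real r) u"

instance
proof
  fix u v w :: "'a L2" and a b :: real
  show "u + v + w = u + (v + w)"
    by transfer (auto simp: L2_rel_def square_integrable_add add.assoc)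
  show "u + v = v + u"
    by transfer (auto simp: L2_rel_def square_integrable_add add.commute)
  show "0 + u = u"
    by transfer (auto simp: L2_rel_def)
  show "- u + u = 0"
    unfolding uminus_L2_def
    by transfer (auto simp: L2_rel_def square_integrable_zero)
  show "u - v = u + - v"
    by (rule minus_L2_def)
  show "a *\<^sub>R (u + v) = a *\<^sub>R u + a *\<^sub>R v"
    unfolding scaleR_L2_def
    by transfer (simp add: L2_rel_def square_integrable_add square_integrable_cmult
        distrib_left)
  show "(a + b) *\<^sub>R u = a *\<^sub>R u + b *\<^sub>R u"
    unfolding scaleR_L2_def
    by transfer (simp add: L2_rel_def square_integrable_add square_integrable_cmult
        distrib_right)
  show "a *\<^sub>R b *\<^sub>R u = (a * b) *\<^sub>R u"
    unfolding scaleR_L2_def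
    by transfer (simp add: L2_rel_def square_integrable_cmult mult.assoc)
  show "1 *\<^sub>R u = u"
    unfolding scaleR_L2_def by transfer (simp add: L2_rel_def)
qed

end

instantiation L2 :: (euclidean_space) real_inner
begin

definition inner_L2 :: "'a L2 \<Rightarrow> 'a L2 \<Rightarrow> real" where
  "inner_L2 u v = Re (cinner_L2 u v)"

definition norm_L2 :: "'a L2 \<Rightarrow> real" where
  "norm_L2 u = sqrt (inner u u)"

definition dist_L2 :: "'a L2 \<Rightarrow> 'a L2 \<Rightarrow> real" where
  "dist_L2 u v = norm (u - v)"

definition sgn_L2 :: "'a L2 \<Rightarrow> 'a L2" where
  "sgn_L2 u = u /\<^sub>R norm u"

definition uniformity_L2 :: "('a L2 \<times> 'a L2) filter" where
  "uniformity_L2 = (INF e\<in>{0 <..}. principal {(x, y). dist x y < e})"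

definition open_L2 :: "'a L2 set \<Rightarrow> bool" where
  "open_L2 U = (\<forall>x\<in>U. \<forall>\<^sub>F (x', y) in uniformity. x' = x \<longrightarrow> y \<in> U)"

instance
proof
  fix u v w :: "'a L2" and a :: real
  show "inner u v = inner v u"
    unfolding inner_L2_def
  proof transfer
    fix f g :: "'a \<Rightarrow> complex"
    assume "L2_rel f f" "L2_rel g g"
    have "(LINT y|lborel. g y * cnj (f y)) = (LINT y|lborel. cnj (f y * cnj (g y)))"
      by (simp add: mult.commute)
    also have "\<dots> = cnj (LINT y|lborel. f y * cnj (g y))"
      by (rule Bochner_Integration.integral_cnj)
    finally show "Re (LINT y|lborel. f y * cnj (g y)) = Re (LINT y|lborel. g y * cnj (f y))"
      by simp
  qed
  show "inner (u + v) w = inner u w + inner v w"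
    unfolding inner_L2_def
    by transfer (simp add: L2_rel_def distrib_right square_integrable_prod)
  show "inner (a *\<^sub>R u) v = a * inner u v"
    unfolding inner_L2_def scaleR_L2_def
    by transfer (simp add: mult.assoc)
  have self: "(LINT y|lborel. f y * cnj (f y)) = of_real (LINT y|lborel. (cmod (f y))\<^sup>2)"
    for f :: "'a \<Rightarrow> complex"
    unfolding complex_norm_square[symmetric]
    using integral_complex_of_real[of lborel "\<lambda>y. (cmod (f y))\<^sup>2"] by simp
  show "0 \<le> inner u u"
    unfolding inner_L2_def
    by transfer (simp add: self)
  show "inner u u = 0 \<longleftrightarrow> u = 0"
    unfolding inner_L2_def
  proof transfer
    fix f :: "'a \<Rightarrow> complex"
    assume f: "L2_rel f f"
    then have "integrable lborel (\<lambda>y. (cmod (f y))\<^sup>2)"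
      by (simp add: L2_rel_def square_integrable_def)
    then have "(LINT y|lborel. (cmod (f y))\<^sup>2) = 0 \<longleftrightarrow> (AE y in lborel. (cmod (f y))\<^sup>2 = 0)"
      by (rule integral_nonneg_eq_0_iff_AE) simp
    then show "Re (LINT y|lborel. f y * cnj (f y)) = 0 \<longleftrightarrow> L2_rel f (\<lambda>_. 0)"
      using f by (simp add: self L2_rel_def square_integrable_zero)
  qed
  show "norm u = sqrt (inner u u)"
    by (rule norm_L2_def)
  show "dist u v = norm (u - v)"
    by (rule dist_L2_def)
  show "sgn u = u /\<^sub>R norm u"
    by (rule sgn_L2_def)
  show "uniformity = (INF e\<in>{0 <..}. principal {(x, y::'a L2). dist x y < e})"
    by (rule uniformity_L2_def)
  show "open U = (\<forall>x\<in>U. \<forall>\<^sub>F (x', y) in uniformity. x' = x \<longrightarrow> y \<in> U)" for U :: "'a L2 set"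
    by (rule open_L2_def)
qed

end

section \<open>Operators\<close>

text \<open>
  The library's type of bounded linear maps is real-linear; the operators of the complex Hilbert
  space are the complex-linear ones among them, with the same operator norm.
\<close>

definition bounded_operators :: "('a::euclidean_space L2 \<Rightarrow>\<^sub>L 'a L2) set" where
  "bounded_operators =
     {S. \<forall>c u. blinfun_apply S (scaleC_L2 c u) = scaleC_L2 c (blinfun_apply S u)}"

definition compact_operators :: "('a::euclidean_space L2 \<Rightarrow>\<^sub>L 'a L2) set" where
  "compact_operators = {S \<in> bounded_operators. compact (closure (blinfun_apply S ` cball 0 1))}"

definition adjoint_op :: "('a::euclidean_space L2 \<Rightarrow>\<^sub>L 'a L2) \<Rightarrow> ('a L2 \<Rightarrow>\<^sub>L 'a L2)" where
  "adjoint_op S =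
     (THE T. \<forall>u v. cinner_L2 (blinfun_apply S u) v = cinner_L2 u (blinfun_apply T v))"

section \<open>Weyl operators\<close>

text \<open>
  The dual of \<^typ>\<open>'a\<close> is the type \<^typ>\<open>'a \<Rightarrow>\<^sub>L real\<close>, and the phase space is the
  product of the two.
\<close>

lemma AE_lborel_translate:
  fixes x :: "'a::euclidean_space"
  assumes "AE y in lborel. P y"
  shows "AE y in lborel. P (y - x)"
proof (rule AE_distrD[where M = lborel and M' = borel and f = "\<lambda>y. y - x"])
  show "(\<lambda>y. y - x) \<in> borel_measurable lborel" by simp
  have eq: "distr lborel borel (\<lambda>y. y - x) = (lborel :: 'a measure)"
    using lborel_affine[of 1 "-x"] by (simp add: density_1 one_ennreal_def[symmetric])
  show "AE y in distr lborel borel (\<lambda>y. y - x). P y"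
    unfolding eq by (rule assms)
qed

lemma integral_lborel_translate:
  fixes x :: "'a::euclidean_space" and f :: "'a \<Rightarrow> 'b::{banach, second_countable_topology}"
  assumes [measurable]: "f \<in> borel_measurable borel"
  shows "integrable lborel (\<lambda>y. f (y - x)) \<longleftrightarrow> integrable lborel f"
    and "(LINT y|lborel. f (y - x)) = (LINT y|lborel. f y)"
proof -
  have eq: "distr lborel borel (\<lambda>y. y - x) = (lborel :: 'a measure)"
    using lborel_affine[of 1 "-x"] by (simp add: density_1 one_ennreal_def[symmetric])
  show "integrable lborel (\<lambda>y. f (y - x)) \<longleftrightarrow> integrable lborel f"
    using integrable_distr_eq[of "\<lambda>y. y - x" lborel borel f] by (simp add: eq)
  show "(LINT y|lborel. f (y - x)) = (LINT y|lborel. f y)"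
    using integral_distr[of "\<lambda>y. y - x" lborel borel f] by (simp add: eq)
qed

definition weyl_phase :: "'a::euclidean_space \<Rightarrow> ('a \<Rightarrow>\<^sub>L real) \<Rightarrow> 'a \<Rightarrow> complex" where
  "weyl_phase x \<xi> y = exp (\<i> * complex_of_real (blinfun_apply \<xi> (y - x /\<^sub>R 2)))"

lemma weyl_phase_measurable [measurable]: "weyl_phase x \<xi> \<in> borel_measurable borel"
  unfolding weyl_phase_def
  by (intro borel_measurable_continuous_onI continuous_intros)

lemma cmod_weyl_phase [simp]: "cmod (weyl_phase x \<xi> y) = 1"
  by (simp add: weyl_phase_def)

lemma square_integrable_weyl:
  assumes f: "square_integrable f"
  shows "square_integrable (\<lambda>y. weyl_phase x \<xi> y * f (y - x))"
proof (rule square_integrable_mult_bounded[where c = 1])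
  have [measurable]: "f \<in> borel_measurable borel"
    using f by (rule square_integrable_measurable)
  show "square_integrable (\<lambda>y. f (y - x))"
    using f integral_lborel_translate(1)[of "\<lambda>y. (cmod (f y))\<^sup>2" x]
    by (simp add: square_integrable_def)
qed simp_all

lift_definition weyl_fun :: "'a::euclidean_space \<Rightarrow> ('a \<Rightarrow>\<^sub>L real) \<Rightarrow> 'a L2 \<Rightarrow> 'a L2"
  is "\<lambda>x \<xi> u y. weyl_phase x \<xi> y * u (y - x)"
proof -
  fix x \<xi> and f g :: "'a \<Rightarrow> complex"
  assume fg: "L2_rel f g"
  then have "AE y in lborel. f (y - x) = g (y - x)"
    by (intro AE_lborel_translate) (simp add: L2_rel_def)
  with fg show "L2_rel (\<lambda>y. weyl_phase x \<xi> y * f (y - x)) (\<lambda>y. weyl_phase x \<xi> y * g (y - x))"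
    by (auto simp: L2_rel_def square_integrable_weyl)
qed

lemma cinner_weyl_fun: "cinner_L2 (weyl_fun x \<xi> u) (weyl_fun x \<xi> v) = cinner_L2 u v"
proof transfer
  fix x \<xi> and f g :: "'a \<Rightarrow> complex"
  assume "L2_rel f f" "L2_rel g g"
  then have "(\<lambda>y. f y * cnj (g y)) \<in> borel_measurable borel"
    using borel_measurable_integrable[OF square_integrable_prod[of f g]]
    by (simp add: L2_rel_def)
  then have "(LINT y|lborel. f (y - x) * cnj (g (y - x))) = (LINT y|lborel. f y * cnj (g y))"
    by (rule integral_lborel_translate(2))
  moreover have "weyl_phase x \<xi> y * a * cnj (weyl_phase x \<xi> y * b) = a * cnj b" for y a b
  proof -
    have "weyl_phase x \<xi> y * cnj (weyl_phase x \<xi> y) = 1"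
      by (simp flip: complex_norm_square)
    then show ?thesis by (simp add: algebra_simps)
  qed
  ultimately show "(LINT y|lborel. weyl_phase x \<xi> y * f (y - x) *
      cnj (weyl_phase x \<xi> y * g (y - x))) = (LINT y|lborel. f y * cnj (g y))"
    by (simp only:)
qed

lemma norm_weyl_fun: "norm (weyl_fun x \<xi> u) = norm u"
  by (simp add: norm_L2_def inner_L2_def cinner_weyl_fun)

lemma weyl_fun_scaleC: "weyl_fun x \<xi> (scaleC_L2 c u) = scaleC_L2 c (weyl_fun x \<xi> u)"
  by transfer (simp add: L2_rel_def square_integrable_weyl square_integrable_cmult mult.left_commute)

lemma bounded_linear_weyl_fun: "bounded_linear (weyl_fun x \<xi>)"
proof (rule bounded_linear_intro[where K = 1])
  show "weyl_fun x \<xi> (u + v) = weyl_fun x \<xi> u + weyl_fun x \<xi> v" for u v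
    by transfer (simp add: L2_rel_def square_integrable_weyl square_integrable_add distrib_left)
  show "weyl_fun x \<xi> (r *\<^sub>R u) = r *\<^sub>R weyl_fun x \<xi> u" for r u
    by (simp add: scaleR_L2_def weyl_fun_scaleC)
  show "norm (weyl_fun x \<xi> u) \<le> norm u * 1" for u
    by (simp add: norm_weyl_fun)
qed

lift_definition weyl :: "'a::euclidean_space \<times> ('a \<Rightarrow>\<^sub>L real) \<Rightarrow> 'a L2 \<Rightarrow>\<^sub>L 'a L2"
  is "\<lambda>(x, \<xi>). weyl_fun x \<xi>"
  by (simp add: case_prod_beta bounded_linear_weyl_fun)

definition translate_op ::
  "'a::euclidean_space \<times> ('a \<Rightarrow>\<^sub>L real) \<Rightarrow> ('a L2 \<Rightarrow>\<^sub>L 'a L2) \<Rightarrow> ('a L2 \<Rightarrow>\<^sub>L 'a L2)" where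
  "translate_op X S = weyl X o\<^sub>L S o\<^sub>L weyl (- X)"

lemma translate_op_bounded_operators:
  "S \<in> bounded_operators \<Longrightarrow> translate_op X S \<in> bounded_operators"
  by (cases X) (simp add: bounded_operators_def translate_op_def weyl.rep_eq weyl_fun_scaleC)

definition norm_continuous_operators :: "('a::euclidean_space L2 \<Rightarrow>\<^sub>L 'a L2) set" where
  "norm_continuous_operators =
     {S \<in> bounded_operators. continuous_on UNIV (\<lambda>X. translate_op X S)}"

section \<open>Filters\<close>

text \<open>
  Isabelle orders filters by reverse inclusion: \<open>F \<le> G\<close> means that \<open>F\<close> is finer
  than \<open>G\<close>.
\<close>

definition frechet_filter :: "'b::topological_space filter" where
  "frechet_filter = Abs_filter (\<lambda>P. compact (closure {x. \<not> P x}))"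

lemma eventually_frechet_filter:
  fixes P :: "'b::topological_space \<Rightarrow> bool"
  shows "eventually P frechet_filter \<longleftrightarrow> compact (closure {x. \<not> P x})"
  unfolding frechet_filter_def
proof (rule eventually_Abs_filter, rule is_filter.intro)
  show "compact (closure {x::'b. \<not> True})" by simp
  show "compact (closure {x. \<not> (P x \<and> Q x)})"
    if "compact (closure {x. \<not> P x})" "compact (closure {x. \<not> Q x})" for P Q :: "'b \<Rightarrow> bool"
  proof -
    have "{x. \<not> (P x \<and> Q x)} = {x. \<not> P x} \<union> {x. \<not> Q x}" by auto
    then show ?thesis using that by (simp add: compact_Un)
  qed
  show "compact (closure {x. \<not> Q x})"
    if PQ: "\<forall>x. P x \<longrightarrow> Q x" and P: "compact (closure {x. \<not> P x})"
    for P Q :: "'b \<Rightarrow> bool"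
  proof -
    have "closure {x. \<not> Q x} \<subseteq> closure {x. \<not> P x}"
      using PQ by (intro closure_mono) auto
    then have "closure {x. \<not> Q x} = closure {x. \<not> P x} \<inter> closure {x. \<not> Q x}" by auto
    then show ?thesis by (metis P compact_Int_closed closed_closure)
  qed
qed

definition ultrafilter :: "'b filter \<Rightarrow> bool" where
  "ultrafilter F \<longleftrightarrow> F \<noteq> bot \<and> (\<forall>P. eventually P F \<or> eventually (\<lambda>x. \<not> P x) F)"

definition frechet_ultrafilters :: "'b::topological_space filter set" where
  "frechet_ultrafilters = {F. ultrafilter F \<and> F \<le> frechet_filter}"

section \<open>Operator topologies\<close>

definition seminorm_topology :: "'b::real_vector set \<Rightarrow> ('b \<Rightarrow> real) set \<Rightarrow> 'b topology" where
  "seminorm_topology V \<N> =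
     topology_generated_by {{T \<in> V. p (T - S) < e} | p S e. p \<in> \<N> \<and> S \<in> V \<and> e > 0}"

definition star_strong_topology :: "('a::euclidean_space L2 \<Rightarrow>\<^sub>L 'a L2) topology" where
  "star_strong_topology =
     seminorm_topology bounded_operators
       (range (\<lambda>u S. norm (blinfun_apply S u) + norm (blinfun_apply (adjoint_op S) u)))"

definition strict_topology ::
  "('a::euclidean_space L2 \<Rightarrow>\<^sub>L 'a L2) set \<Rightarrow> ('a L2 \<Rightarrow>\<^sub>L 'a L2) topology" where
  "strict_topology \<J> =
     seminorm_topology bounded_operators
       ((\<lambda>K S. norm (K o\<^sub>L S) + norm (S o\<^sub>L K)) ` \<J>)"

end

theory Submission
  imports Defs "HOL-Probability.Probability"
begin

text \<open>
  If \<open>S\<close> is compact, \<open>S W(-X) u \<rightarrow> 0\<close> because \<open>W(X) u \<rightarrow> 0\<close> weakly: choose \<open>Y \<rightarrow> 0\<close> such that \<open>W(Y)\<close>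
  anticommutes with \<open>W(X)\<close>, and use strong continuity of \<open>W\<close> at \<open>0\<close>.
  Conversely, norm continuity makes \<open>S\<close> a norm limit of averages of \<open>W(X) S W(-X)\<close> against narrow
  Gaussians. The weight \<open>exp (- (s + 1/s) \<parallel>X\<parallel>\<^sup>2 / 4)\<close> is the product of the two functions
  \<open>X \<mapsto> \<langle>W(X) \<phi>, \<phi>\<rangle>\<close> and \<open>X \<mapsto> \<langle>W(X) \<psi>, \<psi>\<rangle>\<close> for the Gaussians \<open>\<phi>\<close>, \<open>\<psi>\<close> of variances \<open>s\<close> and
  \<open>1/s\<close>, and Fourier inversion turns such an average into a multiple of
  \<open>\<integral> \<langle>S \<phi>\<^sub>Z, \<psi>\<^sub>Z\<rangle> |\<psi>\<^sub>Z\<rangle>\<langle>\<phi>\<^sub>Z| dZ\<close>, where \<open>\<phi>\<^sub>Z\<close>, \<open>\<psi>\<^sub>Z\<close> are the Weyl translates. Its symbol tends to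
  \<open>0\<close> at infinity when \<open>S W(-X) \<phi> \<rightarrow> 0\<close>, so it is a norm limit of integrals over bounded sets of
  norm continuous rank-one families, which are compact.
\<close>

section \<open>The complex Hilbert space structure and Gaussian integrals\<close>

text \<open>The weight must be narrow around 0 in every direction of phase space, and
  \<open><W(X) phi, phi>\<close> for a single Gaussian never is: its decay rates in position and
  momentum are 1/(4s) and s/4, so one grows only as the other shrinks. Multiplying by the function
  for 1/s exchanges the rates, and both become (s + 1/s)/4, which is unbounded. This is why two
  families of vectors appear. No operator-valued integral is formed. Everything is an estimate of
  \<open><S u, v>\<close> that is uniform in unit vectors v, and it ends in an inequality: for each
  e, \<open>norm (S u)\<close> is at most a constant times a bound for \<open>|<u, phi_Z>|\<close>
  over a ball of points Z, plus e. A finite net in the compact set of these phi_Z then shows that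
  the image of the unit ball is totally bounded. The interchange of integrals in the Fourier
  inversion needs a damping factor exp (- c |Z|^2). All bounds are independent of c, so c can be
  sent to 0 at the end.\<close>

lemma integral_cmod_square:
  fixes f :: "'a::euclidean_space \<Rightarrow> complex"
  shows "(LINT y|lborel. f y * cnj (f y)) = of_real (LINT y|lborel. (cmod (f y))\<^sup>2)"
  unfolding complex_norm_square[symmetric]
  using integral_complex_of_real[of lborel "\<lambda>y. (cmod (f y))\<^sup>2"] by simp

lemma cinner_L2_add_left: "cinner_L2 (u + v) w = cinner_L2 u w + cinner_L2 v w"
  by transfer (simp add: L2_rel_def distrib_right square_integrable_prod)

lemma cinner_L2_scaleC_left: "cinner_L2 (scaleC_L2 c u) w = c * cinner_L2 u w"
  by transfer (simp add: L2_rel_def mult.assoc)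

lemma cnj_cinner_L2: "cnj (cinner_L2 u v) = cinner_L2 v u"
proof transfer
  fix f g :: "'a \<Rightarrow> complex"
  have "(LINT y|lborel. g y * cnj (f y)) = (LINT y|lborel. cnj (f y * cnj (g y)))"
    by (simp add: mult.commute)
  also have "\<dots> = cnj (LINT y|lborel. f y * cnj (g y))"
    by (rule Bochner_Integration.integral_cnj)
  finally show "cnj (LINT y|lborel. f y * cnj (g y)) = (LINT y|lborel. g y * cnj (f y))"
    by simp
qed

lemma cinner_L2_add_right: "cinner_L2 w (u + v) = cinner_L2 w u + cinner_L2 w v"
  using cinner_L2_add_left[of u v w] by (metis cnj_cinner_L2 complex_cnj_add)

lemma cinner_L2_scaleC_right: "cinner_L2 w (scaleC_L2 c u) = cnj c * cinner_L2 w u"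
  using cinner_L2_scaleC_left[of c u w] by (metis cnj_cinner_L2 complex_cnj_mult)

lemma scaleC_L2_of_real: "scaleC_L2 (of_real r) u = r *\<^sub>R u"
  by (simp add: scaleR_L2_def)

lemma scaleC_L2_scaleC: "scaleC_L2 a (scaleC_L2 b u) = scaleC_L2 (a * b) u"
  by transfer (simp add: L2_rel_def square_integrable_cmult mult.assoc)

lemma scaleC_L2_add: "scaleC_L2 c (u + v) = scaleC_L2 c u + scaleC_L2 c v"
  by transfer (simp add: L2_rel_def square_integrable_add square_integrable_cmult distrib_left)

lemma cinner_L2_uminus_left: "cinner_L2 (- u) w = - cinner_L2 u w"
  by (simp add: uminus_L2_def cinner_L2_scaleC_left)

lemma cinner_L2_uminus_right: "cinner_L2 w (- u) = - cinner_L2 w u"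
  by (simp add: uminus_L2_def cinner_L2_scaleC_right)

lemma cinner_L2_diff_left: "cinner_L2 (u - v) w = cinner_L2 u w - cinner_L2 v w"
  by (simp only: diff_conv_add_uminus cinner_L2_add_left cinner_L2_uminus_left)

lemma cinner_L2_diff_right: "cinner_L2 w (u - v) = cinner_L2 w u - cinner_L2 w v"
  by (simp only: diff_conv_add_uminus cinner_L2_add_right cinner_L2_uminus_right)

lemma cinner_L2_self: "cinner_L2 u u = of_real ((norm u)\<^sup>2)"
proof -
  have "Im (cinner_L2 u u) = 0"
    by transfer (simp add: integral_cmod_square)
  then show ?thesis
    by (simp add: complex_eq_iff power2_norm_eq_inner inner_L2_def)
qed

lemma norm_scaleC_L2: "norm (scaleC_L2 c u) = cmod c * norm u"
proof -
  have "cinner_L2 (scaleC_L2 c u) (scaleC_L2 c u) = (c * cnj c) * cinner_L2 u u"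
    by (simp add: cinner_L2_scaleC_left cinner_L2_scaleC_right)
  then have "complex_of_real ((norm (scaleC_L2 c u))\<^sup>2) = of_real ((cmod c * norm u)\<^sup>2)"
    unfolding cinner_L2_self complex_norm_square[symmetric] by (simp add: power_mult_distrib)
  then show ?thesis
    by (metis norm_ge_zero mult_nonneg_nonneg of_real_eq_iff power2_eq_imp_eq)
qed

text \<open>The real inner product is only the real part of \<open>cinner_L2\<close>. The unimodular
  \<open>c\<close> makes the product real and nonnegative, so the real Cauchy-Schwarz inequality
  bounds the full modulus.\<close>

lemma cmod_cinner_L2_le: "cmod (cinner_L2 u v) \<le> norm u * norm v"
proof (cases "cinner_L2 u v = 0")
  case False
  define c where "c = cnj (sgn (cinner_L2 u v))"
  have c: "cmod c = 1"
    using False by (simp add: c_def norm_sgn)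
  have "cinner_L2 (scaleC_L2 c u) v = of_real (cmod (cinner_L2 u v))"
    using False complex_norm_square[of "cinner_L2 u v"]
    by (simp add: cinner_L2_scaleC_left c_def sgn_eq field_simps power2_eq_square)
  then have "cmod (cinner_L2 u v) = inner (scaleC_L2 c u) v"
    by (simp add: inner_L2_def)
  also have "\<dots> \<le> norm (scaleC_L2 c u) * norm v"
    by (rule norm_cauchy_schwarz)
  finally show ?thesis
    by (simp add: norm_scaleC_L2 c)
qed simp

lemma bounded_linear_scaleC_L2: "bounded_linear (scaleC_L2 c)"
proof (rule bounded_linear_intro[where K = "cmod c"])
  show "scaleC_L2 c (r *\<^sub>R u) = r *\<^sub>R scaleC_L2 c u" for r u
    by (simp only: scaleR_L2_def scaleC_L2_scaleC mult.commute)
qed (simp_all add: scaleC_L2_add norm_scaleC_L2)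

lemma bounded_bilinear_cinner_L2: "bounded_bilinear cinner_L2"
proof
  fix a a' b b' :: "'a L2" and r :: real
  show "cinner_L2 (a + a') b = cinner_L2 a b + cinner_L2 a' b"
    by (rule cinner_L2_add_left)
  show "cinner_L2 a (b + b') = cinner_L2 a b + cinner_L2 a b'"
    by (rule cinner_L2_add_right)
  show "cinner_L2 (r *\<^sub>R a) b = r *\<^sub>R cinner_L2 a b"
    by (simp add: scaleR_L2_def cinner_L2_scaleC_left scaleR_conv_of_real)
  show "cinner_L2 a (r *\<^sub>R b) = r *\<^sub>R cinner_L2 a b"
    by (simp add: scaleR_L2_def cinner_L2_scaleC_right scaleR_conv_of_real)
  show "\<exists>K. \<forall>(a::'a L2) b. norm (cinner_L2 a b) \<le> norm a * norm b * K"
    by (rule exI[of _ 1]) (simp add: cmod_cinner_L2_le)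
qed

text \<open>The second slot is conjugate linear, so multiplying \<open>v\<close> by \<i> brings the
  imaginary part into the real one. This carries facts about the real product, such as Riesz
  representation, over to the complex one.\<close>

lemma cinner_L2_eq_inner:
  "cinner_L2 u v = Complex (inner u v) (inner u (scaleC_L2 \<i> v))"
  by (simp add: complex_eq_iff inner_L2_def cinner_L2_scaleC_right)

lemma L2_obtain_rep:
  fixes u :: "'a::euclidean_space L2"
  obtains f where "square_integrable f" "u = abs_L2 f"
proof (rule L2.abs_induct[of "\<lambda>v. u = v \<longrightarrow> thesis" u, rule_format])
  show thesis if "L2_rel f f" "u = abs_L2 f" for f
    using that by (intro \<open>\<And>f. square_integrable f \<Longrightarrow> u = abs_L2 f \<Longrightarrow> thesis\<close>) (auto simp: L2_rel_def)
qed (rule refl)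

lemma cinner_abs_L2:
  "square_integrable f \<Longrightarrow> square_integrable g \<Longrightarrow>
    cinner_L2 (abs_L2 f) (abs_L2 g) = (LINT y|lborel. f y * cnj (g y))"
  by (simp add: cinner_L2.abs_eq L2_rel_def)

lemma diff_abs_L2:
  "square_integrable f \<Longrightarrow> square_integrable g \<Longrightarrow> abs_L2 f - abs_L2 g = abs_L2 (\<lambda>y. f y - g y)"
  using square_integrable_cmult[of g "-1"]
  by (simp add: minus_L2_def uminus_L2_def scaleC_L2.abs_eq plus_L2.abs_eq L2_rel_def)

lemma norm_abs_L2:
  assumes "square_integrable f"
  shows "(norm (abs_L2 f))\<^sup>2 = (LINT y|lborel. (cmod (f y))\<^sup>2)"
  using cinner_L2_self[of "abs_L2 f"] cinner_abs_L2[OF assms assms] integral_cmod_square[of f]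
  by (simp del: of_real_power)

lemma square_integrable_diff:
  "square_integrable f \<Longrightarrow> square_integrable g \<Longrightarrow> square_integrable (\<lambda>y. f y - g y)"
  using square_integrable_add[of f "\<lambda>y. - g y"] square_integrable_cmult[of g "-1"] by simp

lemma nn_integral_L2:
  assumes "square_integrable f"
  shows "(\<integral>\<^sup>+y. (ennreal (cmod (f y)))\<^sup>2 \<partial>lborel) = ennreal ((norm (abs_L2 f))\<^sup>2)"
proof -
  have "(\<integral>\<^sup>+y. ennreal ((cmod (f y))\<^sup>2) \<partial>lborel) = ennreal (LINT y|lborel. (cmod (f y))\<^sup>2)"
    using assms by (intro nn_integral_eq_integral) (auto simp: square_integrable_def)
  then show ?thesis
    by (simp add: norm_abs_L2[OF assms] ennreal_power)
qed

text \<open>Cauchy-Schwarz for the moduli of \<open>f\<close> and \<open>g\<close>, which represent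
  vectors of the same norms. It turns L2 bounds into weighted L1 bounds in the completeness
  proof.\<close>

lemma integrable_cmod_prod:
  assumes "square_integrable f" "square_integrable g"
  shows "integrable lborel (\<lambda>y. cmod (f y) * cmod (g y))"
    and "(LINT y|lborel. cmod (f y) * cmod (g y)) \<le> norm (abs_L2 f) * norm (abs_L2 g)"
proof -
  show i: "integrable lborel (\<lambda>y. cmod (f y) * cmod (g y))"
    using integrable_norm[OF square_integrable_prod[OF assms]] by (simp add: norm_mult)
  have sq: "square_integrable (\<lambda>y. complex_of_real (cmod (h y)))"
    "norm (abs_L2 (\<lambda>y. complex_of_real (cmod (h y)))) = norm (abs_L2 h)"
    if h: "square_integrable h" for h :: "'a \<Rightarrow> complex"
  proof -
    show "square_integrable (\<lambda>y. complex_of_real (cmod (h y)))"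
      using h by (auto simp: square_integrable_def)
    from norm_abs_L2[OF this] norm_abs_L2[OF h]
    have "(norm (abs_L2 (\<lambda>y. complex_of_real (cmod (h y)))))\<^sup>2 = (norm (abs_L2 h))\<^sup>2"
      by simp
    then show "norm (abs_L2 (\<lambda>y. complex_of_real (cmod (h y)))) = norm (abs_L2 h)"
      by (rule power2_eq_imp_eq) auto
  qed
  have "(LINT y|lborel. cmod (f y) * cmod (g y)) =
      cmod (cinner_L2 (abs_L2 (\<lambda>y. complex_of_real (cmod (f y)))) (abs_L2 (\<lambda>y. complex_of_real (cmod (g y)))))"
    by (simp add: cinner_abs_L2 sq assms flip: of_real_mult)
  also have "\<dots> \<le> norm (abs_L2 f) * norm (abs_L2 g)"
    using cmod_cinner_L2_le by (metis sq(2) assms)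
  finally show "(LINT y|lborel. cmod (f y) * cmod (g y)) \<le> norm (abs_L2 f) * norm (abs_L2 g)" .
qed

section \<open>Gaussian integrals and Fourier transforms of Gaussians\<close>

lemma integrable_gaussian_real:
  assumes "c > 0" shows "integrable lborel (\<lambda>x::real. exp (- (c * x\<^sup>2)))"
proof -
  have "integrable lborel (\<lambda>x::real. sqrt (2 * pi) * std_normal_density x)"
    using integrable_normal_density[of 1 0] by (intro integrable_mult_right) auto
  then have "integrable lborel (\<lambda>x::real. exp (- x\<^sup>2 / 2))"
    by (simp add: std_normal_density_def)
  from lborel_integrable_real_affine[OF this, of "sqrt (2 * c)" 0] show ?thesis
    using assms by (simp add: power_mult_distrib)
qed

text \<open>\<open>lborel\<close> is the image of a product of real Lebesgue measures under the
  coordinate map, so Fubini for finite products applies.\<close>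

lemma lborel_integrable_prod:
  fixes f :: "'a::euclidean_space \<Rightarrow> real \<Rightarrow> complex"
  assumes "\<And>b. b \<in> Basis \<Longrightarrow> integrable lborel (f b)"
  shows "integrable lborel (\<lambda>x. \<Prod>b\<in>Basis. f b (x \<bullet> b))" (is ?A)
    and "(LINT x|lborel. (\<Prod>b\<in>Basis. f b (x \<bullet> b))) = (\<Prod>b\<in>Basis. (LINT x|lborel. f b x))" (is ?B)
proof -
  interpret product_sigma_finite "\<lambda>_::'a. lborel :: real measure" by standard
  have [measurable]: "\<And>b. b \<in> Basis \<Longrightarrow> f b \<in> borel_measurable borel"
    using assms by (auto dest: borel_measurable_integrable)
  have *: "(\<Prod>b\<in>Basis. f b ((\<Sum>i\<in>Basis. x i *\<^sub>R i) \<bullet> b)) = (\<Prod>b\<in>Basis. f b (x b))" for x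
    by simp
  have m: "(\<lambda>x::'a. \<Prod>b\<in>Basis. f b (x \<bullet> b)) \<in> borel_measurable borel"
    by measurable
  show ?A
    unfolding lborel_def
    by (subst integrable_distr_eq[OF _ m])
      (use product_integrable_prod[of "Basis::'a set" f] assms in \<open>simp_all add: * lborel_eq_real\<close>)
  show ?B
    apply (subst lborel_def)
    apply (subst integral_distr[OF _ m])
    using product_integral_prod[of "Basis::'a set" f] assms by (simp_all add: * lborel_eq_real)
qed

lemma norm_square_Basis: "(norm (x::'a::euclidean_space))\<^sup>2 = (\<Sum>b\<in>Basis. (x \<bullet> b)\<^sup>2)"
  unfolding power2_norm_eq_inner euclidean_inner[of x x] by (simp add: power2_eq_square)

text \<open>Up to the normalisation \<open>sqrt (2 * pi)\<close> this is the characteristic function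
  of the standard normal distribution.\<close>

lemma fourier_std_gaussian_real:
  "(LINT x|lborel. exp (\<i> * of_real (t * x)) * of_real (exp (- x\<^sup>2 / 2)))
    = of_real (sqrt (2 * pi) * exp (- t\<^sup>2 / 2))"
proof -
  have "char std_normal_distribution t = (LINT x|lborel. std_normal_density x *\<^sub>R exp (\<i> * of_real (t * x)))"
    unfolding char_def by (subst integral_density) (auto intro: normal_density_nonneg simp: cis_conv_exp)
  also have "\<dots> = (LINT x|lborel. of_real (1 / sqrt (2 * pi)) * (exp (\<i> * of_real (t * x)) * of_real (exp (- x\<^sup>2 / 2))))"
    by (intro Bochner_Integration.integral_cong) (auto simp: std_normal_density_def scaleR_conv_of_real)
  finally have "of_real (exp (- t\<^sup>2 / 2)) =
      of_real (1 / sqrt (2 * pi)) * (LINT x|lborel. exp (\<i> * of_real (t * x)) * of_real (exp (- x\<^sup>2 / 2)))"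
    unfolding char_std_normal_distribution by simp
  then show ?thesis
    by (simp add: field_simps)
qed

lemma fourier_gaussian_real:
  assumes "c > 0"
  shows "(LINT x|lborel. exp (\<i> * of_real (t * x)) * of_real (exp (- (c * x\<^sup>2))))
    = of_real (sqrt (pi / c) * exp (- t\<^sup>2 / (4 * c)))"
proof -
  \<comment> \<open>At this scale \<open>c * (r * x)\<^sup>2 = x\<^sup>2 / 2\<close>, which reduces
    to the standard Gaussian.\<close>
  define r where "r = 1 / sqrt (2 * c)"
  have r: "r > 0" "r\<^sup>2 = 1 / (2 * c)" using assms by (auto simp: r_def power_divide)
  have "(LINT x|lborel. exp (\<i> * of_real (t * x)) * of_real (exp (- (c * x\<^sup>2))))
    = r *\<^sub>R (LINT x|lborel. exp (\<i> * of_real (t * (0 + r * x))) * of_real (exp (- (c * (0 + r * x)\<^sup>2))))"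
    using r by (subst lborel_integral_real_affine[where c = r and t = 0]) auto
  also have "(\<lambda>x. exp (\<i> * of_real (t * (0 + r * x))) * of_real (exp (- (c * (0 + r * x)\<^sup>2))))
     = (\<lambda>x. exp (\<i> * of_real ((t * r) * x)) * of_real (exp (- x\<^sup>2 / 2)))"
    using r(2) assms by (auto simp: power_mult_distrib field_simps)
  also have "r *\<^sub>R (LINT x|lborel. \<dots> x) = of_real (r * sqrt (2 * pi) * exp (- (t * r)\<^sup>2 / 2))"
    unfolding fourier_std_gaussian_real by (simp add: scaleR_conv_of_real)
  also have "r * sqrt (2 * pi) = sqrt (pi / c)"
    using assms by (simp add: r_def real_sqrt_divide real_sqrt_mult)
  also have "- (t * r)\<^sup>2 / 2 = - t\<^sup>2 / (4 * c)"
    by (simp add: power_mult_distrib r(2))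
  finally show ?thesis .
qed

text \<open>The integrand factorises over an orthonormal basis, so the one-dimensional formula
  applies in each coordinate. Integrability of the Gaussian itself comes from the modulus of the
  oscillating integrand.\<close>

lemma
  fixes t :: "'a::euclidean_space"
  assumes "c > 0"
  shows integrable_gaussian: "integrable lborel (\<lambda>x::'a. exp (- (c * (norm x)\<^sup>2)))"
    and fourier_gaussian: "(LINT x|lborel. exp (\<i> * of_real (t \<bullet> x)) * of_real (exp (- (c * (norm x)\<^sup>2))))
    = of_real (sqrt (pi / c) ^ DIM('a) * exp (- (norm t)\<^sup>2 / (4 * c)))"
proof -
  let ?f = "\<lambda>b x. exp (\<i> * of_real ((t \<bullet> b) * x)) * of_real (exp (- (c * x\<^sup>2)))"
  have i: "integrable lborel (?f b)" for b
  proof (rule Bochner_Integration.integrable_bound[OF integrable_gaussian_real[OF assms]])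
    show "AE x in lborel. cmod (?f b x) \<le> norm (exp (- (c * x\<^sup>2)))"
      by (auto simp: norm_mult)
  qed simp
  have eq: "(\<Prod>b\<in>Basis. ?f b (x \<bullet> b)) = exp (\<i> * of_real (t \<bullet> x)) * of_real (exp (- (c * (norm x)\<^sup>2)))" for x
    unfolding prod.distrib
    by (simp add: exp_sum[symmetric] sum_distrib_left[symmetric] sum_negf norm_square_Basis
        euclidean_inner[of t x] flip: of_real_prod)
  have "integrable lborel (\<lambda>x::'a. exp (\<i> * of_real (t \<bullet> x)) * of_real (exp (- (c * (norm x)\<^sup>2))))"
    using lborel_integrable_prod(1)[of ?f, OF i] unfolding eq .
  from integrable_norm[OF this] show "integrable lborel (\<lambda>x::'a. exp (- (c * (norm x)\<^sup>2)))"
    by (simp add: norm_mult)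
  have "(LINT x|lborel. exp (\<i> * of_real (t \<bullet> x)) * of_real (exp (- (c * (norm x)\<^sup>2)))) =
      (\<Prod>b\<in>Basis. of_real (sqrt (pi / c) * exp (- (t \<bullet> b)\<^sup>2 / (4 * c))))"
    using lborel_integrable_prod(2)[of ?f, OF i] unfolding eq fourier_gaussian_real[OF assms] .
  also have "\<dots> = of_real (\<Prod>b\<in>Basis. sqrt (pi / c) * exp (- (t \<bullet> b)\<^sup>2 / (4 * c)))"
    by (rule of_real_prod[symmetric])
  also have "(\<Prod>b\<in>Basis. sqrt (pi / c) * exp (- (t \<bullet> b)\<^sup>2 / (4 * c))) =
      sqrt (pi / c) ^ DIM('a) * exp (- (norm t)\<^sup>2 / (4 * c))"
    by (simp add: prod.distrib exp_sum[symmetric] norm_square_Basis sum_divide_distrib sum_negf)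
  finally show "(LINT x|lborel. exp (\<i> * of_real (t \<bullet> x)) * of_real (exp (- (c * (norm x)\<^sup>2))))
    = of_real (sqrt (pi / c) ^ DIM('a) * exp (- (norm t)\<^sup>2 / (4 * c)))" .
qed

section \<open>Completeness, Riesz representation and adjoints\<close>

text \<open>Riesz-Fischer. Multiplication by a Gaussian \<open>w\<close>, itself square integrable,
  turns an L2-Cauchy sequence into an L1-Cauchy one, which has a subsequence converging almost
  everywhere. As \<open>w\<close> vanishes nowhere, the factor can be divided out again, and Fatou's
  lemma shows that the pointwise limit is the limit in norm.\<close>

instance L2 :: (euclidean_space) banach
proof
  fix X :: "nat \<Rightarrow> 'a L2"
  assume X: "Cauchy X"
  have "\<exists>f. \<forall>n. square_integrable (f n) \<and> X n = abs_L2 (f n)"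
    by (rule choice) (metis L2_obtain_rep)
  then obtain f where f: "\<And>n. square_integrable (f n)" and Xf: "\<And>n. X n = abs_L2 (f n)"
    by auto
  have [measurable]: "f n \<in> borel_measurable borel" for n
    by (rule square_integrable_measurable[OF f])
  define w where "w y = complex_of_real (exp (- (1 * (norm y)\<^sup>2)))" for y :: 'a
  have "(cmod (w y))\<^sup>2 = exp (- (2 * (norm y)\<^sup>2))" for y
    by (simp add: w_def power2_eq_square flip: exp_add)
  moreover have "w \<in> borel_measurable borel"
    unfolding w_def by measurable
  ultimately have w: "square_integrable w"
    using integrable_gaussian[of 2, where 'a = 'a] by (simp add: square_integrable_def)
  define s where "s n y = f n y * w y" for n y
  have int: "integrable lborel (s n)" for n
    using square_integrable_prod[OF f w, of n] by (simp add: s_def[abs_def] w_def)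
  have s_le: "(LINT y|lborel. norm (s i y - s j y)) \<le> norm (X i - X j) * norm (abs_L2 w)" for i j
    using integrable_cmod_prod(2)[OF square_integrable_diff[OF f f] w, of i j]
    by (simp add: s_def Xf diff_abs_L2[OF f f] norm_mult flip: left_diff_distrib)
  have "\<exists>N. \<forall>i\<ge>N. \<forall>j\<ge>N. LINT y|lborel. norm (s i y - s j y) < e" if "e > 0" for e
  proof -
    from that have "e / (norm (abs_L2 w) + 1) > 0"
      by (simp add: add_nonneg_pos)
    from metric_CauchyD[OF X this] obtain N
      where N: "\<And>i j. i \<ge> N \<Longrightarrow> j \<ge> N \<Longrightarrow> norm (X i - X j) < e / (norm (abs_L2 w) + 1)"
      by (auto simp: dist_norm)
    have "(LINT y|lborel. norm (s i y - s j y)) < e" if ij: "i \<ge> N" "j \<ge> N" for i j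
    proof -
      have "(LINT y|lborel. norm (s i y - s j y)) \<le> norm (X i - X j) * (norm (abs_L2 w) + 1)"
        using s_le[of i j] by (simp add: distrib_left add_increasing2)
      also have "\<dots> < e"
        using N[OF ij] by (simp add: pos_less_divide_eq add_nonneg_pos)
      finally show ?thesis .
    qed
    then show ?thesis by blast
  qed
  from cauchy_L1_AE_cauchy_subseq[OF int this] obtain r where r: "strict_mono r"
    and AE_Cauchy: "AE y in lborel. Cauchy (\<lambda>i. s (r i) y)"
    by blast
  define F where "F y = lim (\<lambda>i. f (r i) y)" for y
  from AE_Cauchy have lim: "AE y in lborel. (\<lambda>i. f (r i) y) \<longlonglongrightarrow> F y"
  proof (eventually_elim)
    case (elim y)
    have "w y \<noteq> 0" by (simp add: w_def)
    then have "(\<lambda>i. s (r i) y * inverse (w y)) = (\<lambda>i. f (r i) y)"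
      by (simp add: s_def fun_eq_iff)
    moreover have "convergent (\<lambda>i. s (r i) y * inverse (w y))"
      using elim by (intro convergent_mult convergent_const) (simp add: Cauchy_convergent)
    ultimately show ?case
      by (simp add: F_def convergent_LIMSEQ_iff)
  qed
  have [measurable]: "F \<in> borel_measurable borel"
    unfolding F_def by measurable
  \<comment> \<open>Fatou along the subsequence: \<open>f (r i) - f n\<close> tends to
    \<open>F - f n\<close> almost everywhere, and \<open>r i \<ge> i\<close> puts its indices beyond
    \<open>n\<close> eventually.\<close>
  have bound: "(\<integral>\<^sup>+y. (ennreal (cmod (F y - f n y)))\<^sup>2 \<partial>lborel) \<le> ennreal (e\<^sup>2)"
    if n: "\<And>i. i \<ge> n \<Longrightarrow> norm (X i - X n) \<le> e" for n e
  proof -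
    have "(\<integral>\<^sup>+y. (ennreal (cmod (F y - f n y)))\<^sup>2 \<partial>lborel) =
        (\<integral>\<^sup>+y. liminf (\<lambda>i. (ennreal (cmod (f (r i) y - f n y)))\<^sup>2) \<partial>lborel)"
    proof (rule nn_integral_cong_AE, use lim in eventually_elim)
      fix y assume "(\<lambda>i. f (r i) y) \<longlonglongrightarrow> F y"
      then have "(\<lambda>i. ennreal ((cmod (f (r i) y - f n y))\<^sup>2)) \<longlonglongrightarrow> ennreal ((cmod (F y - f n y))\<^sup>2)"
        by (intro tendsto_intros)
      from lim_imp_Liminf[OF _ this]
      show "(ennreal (cmod (F y - f n y)))\<^sup>2 = liminf (\<lambda>i. (ennreal (cmod (f (r i) y - f n y)))\<^sup>2)"
        by (simp add: ennreal_power)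
    qed
    also have "\<dots> \<le> liminf (\<lambda>i. \<integral>\<^sup>+y. (ennreal (cmod (f (r i) y - f n y)))\<^sup>2 \<partial>lborel)"
      by (rule nn_integral_liminf) measurable
    also have "\<dots> = liminf (\<lambda>i. ennreal ((norm (X (r i) - X n))\<^sup>2))"
      by (simp add: nn_integral_L2 square_integrable_diff f Xf diff_abs_L2)
    also have "\<dots> \<le> ennreal (e\<^sup>2)"
    proof -
      have "eventually (\<lambda>i. ennreal ((norm (X (r i) - X n))\<^sup>2) \<le> ennreal (e\<^sup>2)) sequentially"
        using eventually_ge_at_top[of n]
      proof eventually_elim
        case (elim i)
        then have "r i \<ge> n" using seq_suble[OF r, of i] by linarith
        then show ?case by (intro ennreal_leI power_mono n) auto
      qed
      from Liminf_mono[OF this] show ?thesis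
        by (simp add: Liminf_const)
    qed
    finally show ?thesis .
  qed
  have sq: "square_integrable (\<lambda>y. F y - f n y)"
    if "\<And>i. i \<ge> n \<Longrightarrow> norm (X i - X n) \<le> e" for n e
  proof -
    have "(\<integral>\<^sup>+y. ennreal ((cmod (F y - f n y))\<^sup>2) \<partial>lborel) < \<infinity>"
      using bound[OF that] by (simp add: ennreal_power le_less_trans[OF _ ennreal_less_top])
    then show ?thesis
      by (auto simp: square_integrable_def integrable_iff_bounded)
  qed
  have ev: "\<exists>N. \<forall>n\<ge>N. \<forall>i\<ge>n. norm (X i - X n) \<le> e" if "e > 0" for e
    using metric_CauchyD[OF X that] by (metis dist_norm le_trans less_imp_le)
  obtain N where "\<And>i. i \<ge> N \<Longrightarrow> norm (X i - X N) \<le> 1"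
    using ev[of 1] by auto
  from square_integrable_add[OF sq[OF this] f[of N]] have F: "square_integrable F"
    by simp
  have "X \<longlonglongrightarrow> abs_L2 F"
  proof (rule LIMSEQ_I)
    fix e :: real assume "e > 0"
    then obtain N where N: "\<And>n i. n \<ge> N \<Longrightarrow> i \<ge> n \<Longrightarrow> norm (X i - X n) \<le> e / 2"
      using ev[of "e / 2"] by auto
    have "norm (X n - abs_L2 F) < e" if "n \<ge> N" for n
    proof -
      have "ennreal ((norm (abs_L2 F - X n))\<^sup>2) \<le> ennreal ((e / 2)\<^sup>2)"
        using bound[OF N[OF that]] by (simp add: Xf diff_abs_L2 F f nn_integral_L2 square_integrable_diff)
      then have "(norm (abs_L2 F - X n))\<^sup>2 \<le> (e / 2)\<^sup>2"
        by (simp add: ennreal_le_iff)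
      then have "norm (abs_L2 F - X n) \<le> e / 2"
        by (rule power2_le_imp_le) (use \<open>e > 0\<close> in simp)
      then show ?thesis
        using \<open>e > 0\<close> by (simp add: norm_minus_commute)
    qed
    then show "\<exists>no. \<forall>n\<ge>no. norm (X n - abs_L2 F) < e" by blast
  qed
  then show "convergent X" by (rule convergentI)
qed

text \<open>The Riesz vector is the minimiser of \<open>\<lambda>u. \<parallel>u\<parallel>\<^sup>2 / 2 - f u\<close>.\<close>

lemma riesz_representation:
  fixes f :: "'h::{real_inner, complete_space} \<Rightarrow> real"
  assumes "bounded_linear f"
  obtains z where "\<And>u. f u = inner u z"
proof -
  interpret f: bounded_linear f by fact
  define J where "J u = (norm u)\<^sup>2 / 2 - f u" for u
  obtain K where K: "\<And>u. norm (f u) \<le> norm u * K"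
    using f.bounded by auto
  have J_ge: "J u \<ge> - K\<^sup>2 / 2" for u
  proof -
    have "0 \<le> (norm u - K)\<^sup>2" by simp
    moreover have "f u \<le> norm u * K" using K[of u] by simp
    ultimately show ?thesis by (simp add: J_def power2_diff)
  qed
  define m where "m = (INF u. J u)"
  have bdd: "bdd_below (range J)"
    using J_ge by (intro bdd_belowI[of _ "- K\<^sup>2 / 2"]) auto
  have m_le: "m \<le> J u" for u
    unfolding m_def by (rule cINF_lower[OF bdd]) simp
  define q :: "nat \<Rightarrow> real" where "q n = 1 / Suc n" for n
  have "\<exists>u. J u < m + q n" for n
    using cINF_less_iff[OF _ bdd, of "m + q n"] by (simp add: q_def flip: m_def)
  then obtain x where x: "\<And>n. J (x n) < m + q n"
    by metis
  \<comment> \<open>The linear part of \<open>J\<close> cancels between \<open>u\<close>,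
    \<open>v\<close> and their midpoint, where \<open>J\<close> is still at least \<open>m\<close>.
    Hence approximate minimisers are close to each other.\<close>
  have parallelogram: "(norm (u - v))\<^sup>2 \<le> 4 * (J u - m) + 4 * (J v - m)" for u v
  proof -
    have "J u + J v - 2 * J ((1/2) *\<^sub>R (u + v)) = (norm (u - v))\<^sup>2 / 4"
      by (simp add: J_def power2_norm_eq_inner inner_add_left inner_add_right inner_diff_left
          inner_diff_right f.scaleR f.add inner_commute field_simps)
    then show ?thesis using m_le[of "(1/2) *\<^sub>R (u + v)"] by simp
  qed
  have "Cauchy x"
  proof (rule metric_CauchyI)
    fix e :: real assume "e > 0"
    then obtain N where N: "q N < e\<^sup>2 / 8"
      using nat_approx_posE[of "e\<^sup>2 / 8"] by (auto simp: q_def)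
    have "dist (x i) (x j) < e" if "i \<ge> N" "j \<ge> N" for i j
    proof -
      have "q i \<le> q N" "q j \<le> q N"
        using that by (auto intro!: divide_left_mono simp: q_def)
      then have "J (x i) - m < e\<^sup>2 / 8" "J (x j) - m < e\<^sup>2 / 8"
        using x[of i] x[of j] N by simp_all
      then have "4 * (J (x i) - m) + 4 * (J (x j) - m) < e\<^sup>2"
        by simp
      then have "(norm (x i - x j))\<^sup>2 < e\<^sup>2"
        by (rule le_less_trans[OF parallelogram])
      then show ?thesis
        using \<open>e > 0\<close> by (auto simp: dist_norm intro: power2_less_imp_less)
    qed
    then show "\<exists>M. \<forall>i\<ge>M. \<forall>j\<ge>M. dist (x i) (x j) < e" by blast
  qed
  then obtain z where z: "x \<longlonglongrightarrow> z"
    using Cauchy_convergent convergent_def by blast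
  have "(\<lambda>n. J (x n)) \<longlonglongrightarrow> J z"
    unfolding J_def by (intro tendsto_intros z f.tendsto) simp
  moreover have "(\<lambda>n. m + q n) \<longlonglongrightarrow> m + 0"
    unfolding q_def by (intro tendsto_intros LIMSEQ_Suc[OF lim_1_over_n])
  ultimately have "J z \<le> m"
    using LIMSEQ_le[of "\<lambda>n. J (x n)" "J z" "\<lambda>n. m + q n" m] x by (auto intro: less_imp_le)
  have "f u = inner u z" for u
  proof -
    have pos: "0 \<le> t * (inner u z - f u) + t * t * ((norm u)\<^sup>2 / 2)" for t
    proof -
      have "J (z + t *\<^sub>R u) - J z = t * (inner u z - f u) + t * t * ((norm u)\<^sup>2 / 2)"
        by (simp add: J_def power2_norm_eq_inner inner_add_left inner_add_right
          f.scaleR f.add inner_commute field_simps)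
      then show ?thesis
        using m_le[of "z + t *\<^sub>R u"] \<open>J z \<le> m\<close> by linarith
    qed
    define a where "a = inner u z - f u"
    define b where "b = (norm u)\<^sup>2 / 2"
    have b: "b \<ge> 0" by (simp add: b_def)
    \<comment> \<open>A quadratic \<open>t * a + t * t * b\<close> that is nonnegative for all
      \<open>t\<close> has \<open>a = 0\<close>. This \<open>t\<close> gives it the value
      \<open>- a\<^sup>2 / (b + 1)\<^sup>2\<close>; dividing by \<open>b + 1\<close> rather than
      \<open>b\<close> covers \<open>u = 0\<close> as well.\<close>
    have "0 \<le> (- a / (b + 1)) * a + (- a / (b + 1)) * (- a / (b + 1)) * b"
      using pos[of "- a / (b + 1)"] by (simp only: a_def b_def)
    also have "\<dots> = - (a\<^sup>2 / (b + 1)\<^sup>2)"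
    proof -
      have "b + 1 \<noteq> 0" using b by simp
      then show ?thesis by (simp add: divide_simps) (simp add: algebra_simps power2_eq_square)
    qed
    finally have "a = 0"
      using b by (smt (verit) divide_pos_pos zero_less_power2)
    then show ?thesis by (simp add: a_def)
  qed
  then show ?thesis by (rule that)
qed

section \<open>Adjoints of complex-linear operators\<close>

lemma cinner_L2_eqI: "u = v" if "\<And>w. cinner_L2 w u = cinner_L2 w v"
proof -
  have "cinner_L2 (u - v) (u - v) = 0"
    using that by (simp add: cinner_L2_diff_right)
  then show ?thesis
    by (simp add: cinner_L2_self)
qed

lemma bounded_operatorsD:
  "S \<in> bounded_operators \<Longrightarrow> blinfun_apply S (scaleC_L2 c u) = scaleC_L2 c (blinfun_apply S u)"
  by (simp add: bounded_operators_def)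

lemma adjoint_op_eqI:
  assumes "\<And>u v. cinner_L2 (blinfun_apply S u) v = cinner_L2 u (blinfun_apply T v)"
  shows "adjoint_op S = T"
  unfolding adjoint_op_def
proof (rule the_equality)
  show "R = T" if "\<forall>u v. cinner_L2 (blinfun_apply S u) v = cinner_L2 u (blinfun_apply R v)" for R
    by (rule blinfun_eqI, rule cinner_L2_eqI) (metis that assms)
qed (use assms in blast)

text \<open>Riesz representation is applied to the real product only, which yields a real adjoint.
  Complex linearity of \<open>S\<close> then supplies the imaginary parts.\<close>

lemma exists_adjoint_op:
  fixes S :: "'a::euclidean_space L2 \<Rightarrow>\<^sub>L 'a L2"
  assumes S: "S \<in> bounded_operators"
  obtains T where "\<And>u v. cinner_L2 (blinfun_apply S u) v = cinner_L2 u (blinfun_apply T v)"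
proof -
  have "\<exists>z. \<forall>u. inner (blinfun_apply S u) v = inner u z" for v
    by (rule riesz_representation[of "\<lambda>u. inner (blinfun_apply S u) v"])
      (auto intro!: bounded_linear_intros)
  then obtain T where T: "\<And>v u. inner (blinfun_apply S u) v = inner u (T v)"
    by metis
  have ext: "x = y" if "\<And>u. inner u x = inner u y" for x y :: "'a L2"
    using that vector_eq_rdot by (metis inner_commute)
  have "bounded_linear T"
  proof (rule bounded_linear_intro[where K = "norm S"])
    show "T (x + y) = T x + T y" for x y
      by (rule ext) (simp add: inner_add_right flip: T)
    show "T (r *\<^sub>R x) = r *\<^sub>R T x" for r x
      by (rule ext) (simp flip: T)
    show "norm (T x) \<le> norm x * norm S" for x
    proof -
      have "norm (T x) * norm (T x) = inner (blinfun_apply S (T x)) x"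
        by (simp add: T power2_eq_square flip: power2_norm_eq_inner)
      also have "\<dots> \<le> norm (blinfun_apply S (T x)) * norm x"
        by (rule norm_cauchy_schwarz)
      also have "\<dots> \<le> (norm S * norm (T x)) * norm x"
        by (intro mult_right_mono norm_blinfun) simp
      finally have "norm (T x) * norm (T x) \<le> (norm x * norm S) * norm (T x)"
        by (simp add: mult_ac)
      then show ?thesis
        by (cases "norm (T x) = 0") (auto simp: mult_le_cancel_right)
    qed
  qed
  moreover have "cinner_L2 (blinfun_apply S u) v = cinner_L2 u (T v)" for u v
  proof -
    \<comment> \<open>Moves \<i> into the left slot, where it passes through \<open>S\<close>; the
      real adjoint relation applies there, and \<i> is moved back.\<close>
    have "inner u (scaleC_L2 \<i> w) = - inner (scaleC_L2 \<i> u) w" for u w :: "'a L2"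
      by (simp add: inner_L2_def cinner_L2_scaleC_left cinner_L2_scaleC_right)
    then show ?thesis
      unfolding cinner_L2_eq_inner by (simp add: bounded_operatorsD[OF S, symmetric] T)
  qed
  ultimately show ?thesis
    by (intro that[of "Blinfun T"]) (simp add: bounded_linear_Blinfun_apply)
qed

lemma cinner_adjoint_op:
  "S \<in> bounded_operators \<Longrightarrow>
    cinner_L2 (blinfun_apply S u) v = cinner_L2 u (blinfun_apply (adjoint_op S) v)"
  by (metis exists_adjoint_op adjoint_op_eqI)

lemma cinner_adjoint_op':
  "S \<in> bounded_operators \<Longrightarrow>
    cinner_L2 (blinfun_apply (adjoint_op S) v) u = cinner_L2 v (blinfun_apply S u)"
  by (metis cinner_adjoint_op cnj_cinner_L2)

lemma adjoint_op_bounded_operators: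
  "S \<in> bounded_operators \<Longrightarrow> adjoint_op S \<in> bounded_operators"
  unfolding bounded_operators_def mem_Collect_eq
  by (intro allI cinner_L2_eqI)
    (simp add: cinner_L2_scaleC_right bounded_operators_def flip: cinner_adjoint_op)

lemma norm_adjoint_op_le:
  assumes "S \<in> bounded_operators"
  shows "norm (blinfun_apply (adjoint_op S) v) \<le> norm S * norm v"
proof -
  let ?w = "blinfun_apply (adjoint_op S) v"
  have "norm ?w * norm ?w = cmod (cinner_L2 (blinfun_apply S ?w) v)"
    by (simp add: cinner_adjoint_op[OF assms] cinner_L2_self power2_eq_square norm_mult)
  also have "\<dots> \<le> norm (blinfun_apply S ?w) * norm v"
    by (rule cmod_cinner_L2_le)
  also have "\<dots> \<le> (norm S * norm ?w) * norm v"
    by (intro mult_right_mono norm_blinfun) simp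
  finally have "norm ?w * norm ?w \<le> (norm S * norm v) * norm ?w"
    by (simp add: mult_ac)
  then show ?thesis
    by (cases "norm ?w = 0") (auto simp: mult_le_cancel_right)
qed

lemma adjoint_op_diff:
  "S \<in> bounded_operators \<Longrightarrow> T \<in> bounded_operators \<Longrightarrow>
    adjoint_op (S - T) = adjoint_op S - adjoint_op T"
  by (rule adjoint_op_eqI)
    (simp add: minus_blinfun.rep_eq cinner_L2_diff_left cinner_L2_diff_right cinner_adjoint_op)

lemma zero_bounded_operators: "0 \<in> bounded_operators"
  by (simp add: bounded_operators_def
      linear_0[OF bounded_linear.linear[OF bounded_linear_scaleC_L2]])

section \<open>Ultrafilters, operator topologies and compact operators\<close>

text \<open>Zorn's lemma for the proper filters below \<open>F\<close>. The infimum of a chain is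
  proper because an event is eventual for it only if it is so for some member. A minimal filter
  decides every \<open>P\<close>: if it does not contain the negation, its restriction to
  \<open>P\<close> is proper and hence equal to it.\<close>

lemma exists_ultrafilter_le:
  assumes "F \<noteq> bot"
  obtains G where "ultrafilter G" "G \<le> F"
proof -
  let ?A = "{G. G \<noteq> bot \<and> G \<le> F}"
  have "\<exists>G\<in>?A. \<forall>H\<in>?A. H \<le> G \<longrightarrow> H = G"
  proof (rule predicate_Zorn)
    show "partial_order_on ?A (relation_of (\<lambda>G H. H \<le> G) ?A)"
      by (rule partial_order_on_relation_ofI) auto
  next
    fix C assume C: "C \<in> Chains (relation_of (\<lambda>G H. H \<le> G) ?A)"
    then have CA: "C \<subseteq> ?A" and lin: "\<And>G H. G \<in> C \<Longrightarrow> H \<in> C \<Longrightarrow> G \<le> H \<or> H \<le> G"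
      by (auto simp: Chains_def relation_of_def)
    show "\<exists>u\<in>?A. \<forall>a\<in>C. u \<le> a"
    proof (cases "C = {}")
      case True
      then show ?thesis using assms by auto
    next
      case False
      have ev: "eventually P (Inf C) \<longleftrightarrow> (\<exists>b\<in>C. eventually P b)" for P
        using False by (rule eventually_Inf_base) (use lin in \<open>auto simp: inf_absorb1 inf_absorb2\<close>)
      have "Inf C \<noteq> bot"
        using CA ev[of "\<lambda>_. False"] by (auto simp: eventually_False)
      moreover have "Inf C \<le> F"
        using False CA by (metis (no_types, lifting) Inf_lower2 ex_in_conv mem_Collect_eq subset_iff)
      ultimately show ?thesis
        by (intro bexI[of _ "Inf C"]) (auto intro: Inf_lower)
    qed
  qed
  then obtain G where G: "G \<noteq> bot" "G \<le> F"
    and max: "\<And>H. H \<noteq> bot \<Longrightarrow> H \<le> F \<Longrightarrow> H \<le> G \<Longrightarrow> H = G"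
    by blast
  have "eventually P G \<or> eventually (\<lambda>x. \<not> P x) G" for P
  proof (rule disjCI)
    assume "\<not> eventually (\<lambda>x. \<not> P x) G"
    then have "inf G (principal {x. P x}) \<noteq> bot"
      by (simp add: eventually_inf_principal flip: eventually_False)
    then have "inf G (principal {x. P x}) = G"
      using G by (intro max) (auto intro: le_infI1)
    then have "G \<le> principal {x. P x}"
      by (simp add: inf.absorb_iff1)
    then show "eventually P G"
      by (simp add: le_principal)
  qed
  with G show ?thesis
    by (intro that[of G]) (auto simp: ultrafilter_def)
qed

text \<open>If convergence along \<open>F\<close> fails at a neighbourhood \<open>U\<close>, then
  \<open>F\<close> restricted to the points with \<open>f x \<notin> U\<close> is proper, and no
  ultrafilter below this restriction can converge.\<close>

lemma limitin_iff_ultrafilters: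
  "limitin \<tau> f l F \<longleftrightarrow> (\<forall>G. ultrafilter G \<and> G \<le> F \<longrightarrow> limitin \<tau> f l G)"
  if "F \<noteq> bot"
proof
  assume "limitin \<tau> f l F"
  then show "\<forall>G. ultrafilter G \<and> G \<le> F \<longrightarrow> limitin \<tau> f l G"
    unfolding limitin_def by (meson filter_leD)
next
  assume G: "\<forall>G. ultrafilter G \<and> G \<le> F \<longrightarrow> limitin \<tau> f l G"
  show "limitin \<tau> f l F"
    unfolding limitin_def
  proof (intro conjI allI impI)
    show "l \<in> topspace \<tau>"
      using exists_ultrafilter_le[OF that] G by (metis limitin_topspace)
    fix U assume U: "openin \<tau> U \<and> l \<in> U"
    show "eventually (\<lambda>x. f x \<in> U) F"
    proof (rule ccontr)
      assume "\<not> eventually (\<lambda>x. f x \<in> U) F"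
      then have "inf F (principal {x. f x \<notin> U}) \<noteq> bot"
        by (simp add: eventually_inf_principal flip: eventually_False)
      then obtain H where H: "ultrafilter H" "H \<le> F" "H \<le> principal {x. f x \<notin> U}"
        by (metis exists_ultrafilter_le le_inf_iff)
      then have "eventually (\<lambda>x. f x \<in> U) H" "eventually (\<lambda>x. f x \<notin> U) H"
        using G U by (auto simp: limitin_def le_principal)
      then have "eventually (\<lambda>x. False) H"
        by eventually_elim simp
      with H(1) show False
        by (simp add: ultrafilter_def eventually_False)
    qed
  qed
qed

text \<open>The generating sets have arbitrary centres \<open>S\<close>, so a triangle inequality is
  needed to find a neighbourhood centred at 0 inside each one that contains 0. It is assumed only on
  \<open>V\<close> because \<open>adjoint_op\<close> is a definite description, controlled only on
  \<open>bounded_operators\<close>.\<close>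

lemma limitin_seminorm_topology:
  fixes f :: "'i \<Rightarrow> 'b::real_vector"
  assumes ne: "\<N> \<noteq> {}" and V: "0 \<in> V" and f: "\<And>x. f x \<in> V"
    and zero: "\<And>p. p \<in> \<N> \<Longrightarrow> p 0 = 0"
    and nonneg: "\<And>p S. p \<in> \<N> \<Longrightarrow> 0 \<le> p S"
    and tri: "\<And>p S T. p \<in> \<N> \<Longrightarrow> S \<in> V \<Longrightarrow> T \<in> V \<Longrightarrow> p (T - S) \<le> p T + p (0 - S)"
  shows "limitin (seminorm_topology V \<N>) f 0 F \<longleftrightarrow> (\<forall>p\<in>\<N>. ((\<lambda>x. p (f x)) \<longlongrightarrow> 0) F)"
proof
  assume L: "limitin (seminorm_topology V \<N>) f 0 F"
  show "\<forall>p\<in>\<N>. ((\<lambda>x. p (f x)) \<longlongrightarrow> 0) F"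
  proof (intro ballI tendstoI)
    fix p and e :: real assume p: "p \<in> \<N>" "e > 0"
    let ?U = "{T \<in> V. p (T - 0) < e}"
    have "openin (seminorm_topology V \<N>) ?U"
      unfolding seminorm_topology_def
      by (rule topology_generated_by_Basis) (use p V in blast)
    moreover have "0 \<in> ?U"
      using p V by (simp add: zero[OF p(1)])
    ultimately have "eventually (\<lambda>x. f x \<in> ?U) F"
      using L by (auto simp: limitin_def)
    then show "eventually (\<lambda>x. dist (p (f x)) 0 < e) F"
      by eventually_elim (simp add: nonneg[OF p(1)])
  qed
next
  assume lim: "\<forall>p\<in>\<N>. ((\<lambda>x. p (f x)) \<longlongrightarrow> 0) F"
  let ?\<S> = "{{T \<in> V. p (T - S) < e} | p S e. p \<in> \<N> \<and> S \<in> V \<and> e > 0}"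
  have ev: "0 \<in> U \<longrightarrow> eventually (\<lambda>x. f x \<in> U) F" if "generate_topology_on ?\<S> U" for U
    using that
  proof induction
    case (Int A B)
    then show ?case by (auto intro: eventually_conj)
  next
    case (UN K)
    show ?case
    proof
      assume "0 \<in> \<Union>K"
      then obtain A where "A \<in> K" "0 \<in> A" by blast
      with UN have "eventually (\<lambda>x. f x \<in> A) F" by blast
      then show "eventually (\<lambda>x. f x \<in> \<Union>K) F"
        by eventually_elim (use \<open>A \<in> K\<close> in blast)
    qed
  next
    case (Basis A)
    then obtain p S e where A: "A = {T \<in> V. p (T - S) < e}" and p: "p \<in> \<N>" and S: "S \<in> V"
      by blast
    show ?case
    proof
      assume "0 \<in> A"
      then have "p (0 - S) < e" by (simp add: A)
      \<comment> \<open>The slack left by \<open>0 \<in> A\<close> is the radius of the ball around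
        0.\<close>
      then have "eventually (\<lambda>x. p (f x) < e - p (0 - S)) F"
        using lim p by (intro order_tendstoD(2)[of _ 0]) auto
      then show "eventually (\<lambda>x. f x \<in> A) F"
      proof eventually_elim
        case (elim x)
        then show ?case
          using tri[OF p S f[of x]] f[of x] by (simp add: A)
      qed
    qed
  qed simp
  show "limitin (seminorm_topology V \<N>) f 0 F"
    unfolding limitin_def
  proof (intro conjI allI impI)
    obtain p where p: "p \<in> \<N>" using ne by blast
    have "{T \<in> V. p (T - 0) < 1} \<in> ?\<S>"
      using p V zero_less_one by blast
    then have "{T \<in> V. p (T - 0) < 1} \<subseteq> topspace (seminorm_topology V \<N>)"
      unfolding seminorm_topology_def topology_generated_by_topspace by (rule Union_upper)
    moreover have "0 \<in> {T \<in> V. p (T - 0) < 1}"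
      using V zero[OF p] by simp
    ultimately show "0 \<in> topspace (seminorm_topology V \<N>)"
      by blast
  next
    fix U assume "openin (seminorm_topology V \<N>) U \<and> 0 \<in> U"
    then show "eventually (\<lambda>x. f x \<in> U) F"
      using ev[of U] unfolding seminorm_topology_def openin_topology_generated_by_iff by blast
  qed
qed

lemma tendsto_add_nonneg_iff:
  fixes f g :: "'i \<Rightarrow> real"
  assumes "\<And>x. 0 \<le> f x" "\<And>x. 0 \<le> g x"
  shows "((\<lambda>x. f x + g x) \<longlongrightarrow> 0) F \<longleftrightarrow> (f \<longlongrightarrow> 0) F \<and> (g \<longlongrightarrow> 0) F"
proof
  assume L: "((\<lambda>x. f x + g x) \<longlongrightarrow> 0) F"
  show "(f \<longlongrightarrow> 0) F \<and> (g \<longlongrightarrow> 0) F"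
    using assms
    by (intro conjI Lim_null_comparison[OF _ L] always_eventually allI) simp_all
qed (use tendsto_add[of f 0 F g 0] in simp)

lemma adjoint_op_zero [simp]: "adjoint_op 0 = 0"
  by (rule adjoint_op_eqI) (simp add: cinner_L2_self cinner_L2_diff_left[of 0 0, simplified]
      cinner_L2_diff_right[of _ 0 0, simplified])

lemma limitin_star_strong_iff:
  fixes f :: "'i \<Rightarrow> 'a::euclidean_space L2 \<Rightarrow>\<^sub>L 'a L2"
  assumes f: "\<And>x. f x \<in> bounded_operators"
  shows "limitin star_strong_topology f 0 F \<longleftrightarrow>
    (\<forall>u. ((\<lambda>x. norm (blinfun_apply (f x) u)) \<longlongrightarrow> 0) F \<and>
         ((\<lambda>x. norm (blinfun_apply (adjoint_op (f x)) u)) \<longlongrightarrow> 0) F)"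
proof -
  have "limitin star_strong_topology f 0 F \<longleftrightarrow>
    (\<forall>p\<in>range (\<lambda>u S. norm (blinfun_apply S u) + norm (blinfun_apply (adjoint_op S) u)).
      ((\<lambda>x. p (f x)) \<longlongrightarrow> 0) F)"
    unfolding star_strong_topology_def
  proof (rule limitin_seminorm_topology)
    fix p :: "('a L2 \<Rightarrow>\<^sub>L 'a L2) \<Rightarrow> real" and S T :: "'a L2 \<Rightarrow>\<^sub>L 'a L2"
    assume "p \<in> range (\<lambda>u S. norm (blinfun_apply S u) + norm (blinfun_apply (adjoint_op S) u))"
    then obtain u where p: "p = (\<lambda>S. norm (blinfun_apply S u) + norm (blinfun_apply (adjoint_op S) u))"
      by auto
    show "p 0 = 0" "0 \<le> p S" by (simp_all add: p)
    assume ST: "S \<in> bounded_operators" "T \<in> bounded_operators"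
    show "p (T - S) \<le> p T + p (0 - S)"
      unfolding p adjoint_op_diff[OF ST(2,1)] adjoint_op_diff[OF zero_bounded_operators ST(1)]
      using norm_triangle_ineq4[of "blinfun_apply T u" "blinfun_apply S u"]
        norm_triangle_ineq4[of "blinfun_apply (adjoint_op T) u" "blinfun_apply (adjoint_op S) u"]
      by (simp add: minus_blinfun.rep_eq uminus_blinfun.rep_eq)
  qed (auto simp: f zero_bounded_operators)
  then show ?thesis
    by (simp add: tendsto_add_nonneg_iff)
qed

lemma zero_compact_operators: "0 \<in> compact_operators"
  by (simp add: compact_operators_def zero_bounded_operators image_constant_conv)

lemma limitin_strict_iff:
  fixes f :: "'i \<Rightarrow> 'a::euclidean_space L2 \<Rightarrow>\<^sub>L 'a L2"
  assumes f: "\<And>x. f x \<in> bounded_operators" and "\<J> \<noteq> {}"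
  shows "limitin (strict_topology \<J>) f 0 F \<longleftrightarrow>
    (\<forall>K\<in>\<J>. ((\<lambda>x. norm (K o\<^sub>L f x)) \<longlongrightarrow> 0) F \<and> ((\<lambda>x. norm (f x o\<^sub>L K)) \<longlongrightarrow> 0) F)"
proof -
  have "limitin (strict_topology \<J>) f 0 F \<longleftrightarrow>
    (\<forall>p\<in>(\<lambda>K S. norm (K o\<^sub>L S) + norm (S o\<^sub>L K)) ` \<J>. ((\<lambda>x. p (f x)) \<longlongrightarrow> 0) F)"
    unfolding strict_topology_def
  proof (rule limitin_seminorm_topology)
    fix p :: "('a L2 \<Rightarrow>\<^sub>L 'a L2) \<Rightarrow> real" and S T :: "'a L2 \<Rightarrow>\<^sub>L 'a L2"
    assume "p \<in> (\<lambda>K S. norm (K o\<^sub>L S) + norm (S o\<^sub>L K)) ` \<J>"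
    then obtain K where p: "p = (\<lambda>S. norm (K o\<^sub>L S) + norm (S o\<^sub>L K))"
      by auto
    interpret bounded_bilinear "blinfun_compose :: ('a L2 \<Rightarrow>\<^sub>L 'a L2) \<Rightarrow> ('a L2 \<Rightarrow>\<^sub>L 'a L2) \<Rightarrow> _"
      by (rule bounded_bilinear_blinfun_compose)
    show "p 0 = 0" "0 \<le> p S" by (simp_all add: p zero_left zero_right)
    show "p (T - S) \<le> p T + p (0 - S)"
      using norm_triangle_ineq4[of "K o\<^sub>L T" "K o\<^sub>L S"] norm_triangle_ineq4[of "T o\<^sub>L K" "S o\<^sub>L K"]
      by (simp add: p diff_left diff_right minus_left minus_right)
  qed (use assms in \<open>auto simp: zero_bounded_operators\<close>)
  then show ?thesis
    by (simp add: tendsto_add_nonneg_iff)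
qed

section \<open>Compactness through total boundedness\<close>

lemma compact_closure_subset:
  fixes A B :: "'m::t2_space set"
  assumes "compact B" "A \<subseteq> B"
  shows "compact (closure A)"
proof -
  have "closure A \<subseteq> B"
    using assms by (intro closure_minimal compact_imp_closed)
  then have "B \<inter> closure A = closure A" by blast
  with compact_Int_closed[OF assms(1) closed_closure[of A]] show ?thesis by simp
qed

text \<open>Total boundedness passes to \<open>f\<close> when finitely many maps with relatively
  compact images control its oscillation. It serves twice: for Schauder's theorem, with one map, the
  operator composed with its adjoint; and for the converse direction of the theorem, with finitely
  many functionals \<open>\<lambda>u. cinner_L2 u t\<close>.\<close>

lemma compact_closure_imageI:
  fixes f :: "'c \<Rightarrow> 'm::complete_space"
  assumes "\<And>e. e > 0 \<Longrightarrow> \<exists>I h. \<exists>\<delta>>0. finite (I :: 'i set) \<and>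
      (\<forall>i\<in>I. compact (closure (h i ` A :: 'n::metric_space set))) \<and>
      (\<forall>x\<in>A. \<forall>y\<in>A. (\<forall>i\<in>I. dist (h i x) (h i y) < \<delta>) \<longrightarrow> dist (f x) (f y) < e)"
  shows "compact (closure (f ` A))"
proof -
  have tb: "\<exists>k. finite k \<and> f ` A \<subseteq> (\<Union>x\<in>k. ball x e)" if e: "e > 0" for e
  proof -
    obtain I :: "'i set" and h :: "'i \<Rightarrow> 'c \<Rightarrow> 'n" and \<delta> where I: "\<delta> > 0" "finite I"
      and "\<forall>i\<in>I. compact (closure (h i ` A))"
      and "\<forall>x\<in>A. \<forall>y\<in>A. (\<forall>i\<in>I. dist (h i x) (h i y) < \<delta>) \<longrightarrow> dist (f x) (f y) < e"
      using assms[OF e] by (elim exE conjE)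
    then have h: "\<And>i. i \<in> I \<Longrightarrow> compact (closure (h i ` A))"
      and fine: "\<And>x y. x \<in> A \<Longrightarrow> y \<in> A \<Longrightarrow> (\<And>i. i \<in> I \<Longrightarrow> dist (h i x) (h i y) < \<delta>) \<Longrightarrow> dist (f x) (f y) < e"
      by simp_all
    have "\<exists>k. finite k \<and> closure (h i ` A) \<subseteq> (\<Union>x\<in>k. ball x (\<delta>/2))" if "i \<in> I" for i
      using h[OF that] half_gt_zero[OF \<open>\<delta> > 0\<close>] unfolding compact_eq_totally_bounded by blast
    then obtain k where k: "\<And>i. i \<in> I \<Longrightarrow> finite (k i)"
      "\<And>i. i \<in> I \<Longrightarrow> closure (h i ` A) \<subseteq> (\<Union>x\<in>k i. ball x (\<delta>/2))"
      by metis
    have "\<exists>c\<in>k i. dist c (h i x) < \<delta>/2" if "i \<in> I" "x \<in> A" for i x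
      using k(2)[OF that(1)] closure_subset[of "h i ` A"] that by fastforce
    then obtain c where c: "\<And>i x. i \<in> I \<Longrightarrow> x \<in> A \<Longrightarrow> c i x \<in> k i \<and> dist (c i x) (h i x) < \<delta>/2"
      by metis
    \<comment> \<open>The tuple of nearby centres takes finitely many values. Points with equal
      tuples have \<open>h i\<close>-values less than \<open>\<delta>\<close> apart, so one
      representative per tuple yields a finite net for \<open>f\<close>.\<close>
    define g where "g x = (\<lambda>i\<in>I. c i x)" for x
    have "g ` A \<subseteq> Pi\<^sub>E I k"
      using c by (auto simp: g_def)
    moreover have "finite (Pi\<^sub>E I k)"
      using I k by (intro finite_PiE) auto
    ultimately have "finite (g ` A)"
      by (rule finite_subset)
    then obtain B where B: "B \<subseteq> A" "finite B" "g ` A = g ` B"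
      using finite_subset_image[of "g ` A" g A] by blast
    have "f x \<in> (\<Union>x\<in>f ` B. ball x e)" if x: "x \<in> A" for x
    proof -
      obtain y where y: "y \<in> B" "g x = g y"
        using B(3) x by blast
      have "dist (h i x) (h i y) < \<delta>" if "i \<in> I" for i
      proof -
        have "c i x = c i y"
          using fun_cong[OF y(2), of i] that by (simp add: g_def)
        then show ?thesis
          using c[OF that x] c[OF that, of y] y B(1) dist_triangle3[of "h i x" "h i y" "c i x"]
          by fastforce
      qed
      then have "dist (f x) (f y) < e"
        using x y B(1) by (intro fine) auto
      then show ?thesis
        using y by (auto simp: dist_commute)
    qed
    then show ?thesis
      using B(2) by (intro exI[of _ "f ` B"]) auto
  qed
  show ?thesis
    unfolding compact_eq_totally_bounded
  proof (intro conjI allI impI, goal_cases)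
    case 1
    show ?case by (simp add: complete_eq_closed)
  next
    case (2 e)
    \<comment> \<open>Half the radius leaves room for the closure: closed balls of radius
      \<open>e/2\<close> contain it and lie in the open balls of radius \<open>e\<close>.\<close>
    then obtain k where k: "finite k" "f ` A \<subseteq> (\<Union>x\<in>k. ball x (e/2))"
      using tb[of "e/2"] by auto
    have "closure (f ` A) \<subseteq> (\<Union>x\<in>k. cball x (e/2))"
    proof (rule closure_minimal)
      show "f ` A \<subseteq> (\<Union>x\<in>k. cball x (e/2))"
        by (rule order_trans[OF k(2)]) (intro UN_mono ball_subset_cball order_refl)
      show "closed (\<Union>x\<in>k. cball x (e/2))"
        using k(1) by (intro closed_UN) auto
    qed
    also have "\<dots> \<subseteq> (\<Union>x\<in>k. ball x e)"
      using \<open>e > 0\<close> by (intro UN_mono) (auto simp: cball_subset_ball_iff)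
    finally show ?case
      using k(1) by blast
  qed
qed

lemma norm_blinfun_le_unit:
  fixes f :: "'c::real_normed_vector \<Rightarrow>\<^sub>L 'd::real_normed_vector"
  assumes "b \<ge> 0" "\<And>v. norm v \<le> 1 \<Longrightarrow> norm (blinfun_apply f v) \<le> b"
  shows "norm f \<le> b"
proof (rule norm_blinfun_bound[OF assms(1)])
  fix x
  have "norm (blinfun_apply f (sgn x)) \<le> b"
    by (rule assms(2)) (simp add: norm_sgn)
  then have "norm x * norm (blinfun_apply f (sgn x)) \<le> norm x * b"
    by (rule mult_left_mono) simp
  moreover have "norm x * norm (blinfun_apply f (sgn x)) = norm (blinfun_apply f (norm x *\<^sub>R sgn x))"
    by (simp add: blinfun.scaleR_right)
  moreover have "norm x *\<^sub>R sgn x = x"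
    by (cases "x = 0") (simp_all add: sgn_div_norm)
  ultimately show "norm (blinfun_apply f x) \<le> b * norm x"
    by (simp only: mult.commute)
qed

text \<open>A uniformly bounded family that tends to 0 at each vector does so uniformly on a
  relatively compact set, because a finite net suffices for testing.\<close>

lemma tendsto_compose_compact:
  fixes K :: "'c::real_normed_vector \<Rightarrow>\<^sub>L 'd::real_normed_vector" and g :: "'i \<Rightarrow> 'd \<Rightarrow>\<^sub>L 'e::real_normed_vector"
  assumes K: "compact (closure (blinfun_apply K ` cball 0 1))"
    and C: "\<And>x. norm (g x) \<le> C"
    and lim: "\<And>u. ((\<lambda>x. norm (blinfun_apply (g x) u)) \<longlongrightarrow> 0) F"
  shows "((\<lambda>x. norm (g x o\<^sub>L K)) \<longlongrightarrow> 0) F"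
proof (rule tendstoI)
  fix e :: real assume "e > 0"
  have C0: "C \<ge> 0" using C norm_ge_zero order_trans by blast
  \<comment> \<open>Moving to the nearest net point then costs at most \<open>e / 4\<close>;
    \<open>C + 1\<close> allows for \<open>C = 0\<close>.\<close>
  define d where "d = e / (4 * (C + 1))"
  have d: "d > 0" "C * d \<le> e / 4"
    using \<open>e > 0\<close> C0 by (auto simp: d_def field_simps)
  from d(1) obtain T where T: "finite T" "closure (blinfun_apply K ` cball 0 1) \<subseteq> (\<Union>t\<in>T. ball t d)"
    using K by (metis compact_eq_totally_bounded)
  have "eventually (\<lambda>x. \<forall>t\<in>T. norm (blinfun_apply (g x) t) < e / 4) F"
    using T(1) \<open>e > 0\<close> by (intro eventually_ball_finite ballI order_tendstoD(2)[OF lim]) auto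
  then show "eventually (\<lambda>x. dist (norm (g x o\<^sub>L K)) 0 < e) F"
  proof eventually_elim
    case (elim x)
    have "norm (g x o\<^sub>L K) \<le> e / 2"
    proof (rule norm_blinfun_le_unit)
      fix v :: 'c assume "norm v \<le> 1"
      then have "blinfun_apply K v \<in> closure (blinfun_apply K ` cball 0 1)"
        using closure_subset by fastforce
      then obtain t where t: "t \<in> T" "dist t (blinfun_apply K v) < d"
        using T(2) by auto
      have "norm (blinfun_apply (g x) (blinfun_apply K v)) \<le>
          norm (blinfun_apply (g x) t) + norm (blinfun_apply (g x) (blinfun_apply K v - t))"
        by (metis blinfun.diff_right norm_triangle_sub add.commute)
      also have "norm (blinfun_apply (g x) (blinfun_apply K v - t)) \<le> norm (g x) * norm (blinfun_apply K v - t)"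
        by (rule norm_blinfun)
      also have "\<dots> \<le> C * d"
        using t(2) C C0 by (intro mult_mono) (auto simp: dist_norm norm_minus_commute)
      also have "norm (blinfun_apply (g x) t) \<le> e / 4"
        using elim t(1) by (simp add: less_imp_le)
      finally show "norm (blinfun_apply (g x o\<^sub>L K) v) \<le> e / 2"
        using d(2) by simp
    qed (use \<open>e > 0\<close> in simp)
    then show ?case using \<open>e > 0\<close> by simp
  qed
qed

section \<open>Compactness of adjoints, and star-strong versus strict limits\<close>

lemma bounded_operators_compose:
  "S \<in> bounded_operators \<Longrightarrow> T \<in> bounded_operators \<Longrightarrow> S o\<^sub>L T \<in> bounded_operators"
  by (simp add: bounded_operators_def)

lemma adjoint_op_compose:
  "S \<in> bounded_operators \<Longrightarrow> T \<in> bounded_operators \<Longrightarrow>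
    adjoint_op (S o\<^sub>L T) = adjoint_op T o\<^sub>L adjoint_op S"
  by (rule adjoint_op_eqI) (simp add: cinner_adjoint_op)

lemma adjoint_op_adjoint_op [simp]: "S \<in> bounded_operators \<Longrightarrow> adjoint_op (adjoint_op S) = S"
  by (rule adjoint_op_eqI) (rule cinner_adjoint_op')

lemma norm_adjoint_op [simp]:
  fixes S :: "'a::euclidean_space L2 \<Rightarrow>\<^sub>L 'a L2"
  assumes S: "S \<in> bounded_operators"
  shows "norm (adjoint_op S) = norm S"
proof -
  have le: "norm (adjoint_op T) \<le> norm T" if "T \<in> bounded_operators" for T :: "'a L2 \<Rightarrow>\<^sub>L 'a L2"
    by (rule norm_blinfun_bound) (auto intro: norm_adjoint_op_le[OF that])
  from le[OF S] le[OF adjoint_op_bounded_operators[OF S]] S show ?thesis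
    by simp
qed

text \<open>Schauder's theorem. With K' for the adjoint, the square of \<open>norm (K' w)\<close>
  equals \<open><K K' w, w>\<close>, so the oscillation of K' on the unit ball is controlled by that
  of the composite K K', whose image of the ball is relatively compact.\<close>

lemma adjoint_op_compact_operators:
  fixes K :: "'a::euclidean_space L2 \<Rightarrow>\<^sub>L 'a L2"
  assumes K: "K \<in> compact_operators"
  shows "adjoint_op K \<in> compact_operators"
proof -
  have Kb: "K \<in> bounded_operators" and Kc: "compact (closure (blinfun_apply K ` cball 0 1))"
    using K by (auto simp: compact_operators_def)
  let ?h = "\<lambda>u. blinfun_apply K (blinfun_apply (adjoint_op K) u)"
  \<comment> \<open>The adjoint maps the unit ball into the ball of radius \<open>norm K\<close>, so
    the compact set has to be rescaled; \<open>norm K + 1\<close> is positive even when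
    \<open>K = 0\<close>.\<close>
  have scaled: "blinfun_apply K v \<in> (\<lambda>x. (norm K + 1) *\<^sub>R x) ` closure (blinfun_apply K ` cball 0 1)"
    if "norm v \<le> norm K" for v
  proof (rule image_eqI)
    have pos: "norm K + 1 > 0" by (simp add: add_nonneg_pos)
    then show "blinfun_apply K v = (norm K + 1) *\<^sub>R blinfun_apply K (v /\<^sub>R (norm K + 1))"
      by (simp add: blinfun.scaleR_right)
    have "norm (v /\<^sub>R (norm K + 1)) \<le> 1"
      using that pos by (simp add: divide_simps)
    then show "blinfun_apply K (v /\<^sub>R (norm K + 1)) \<in> closure (blinfun_apply K ` cball 0 1)"
      using closure_subset by fastforce
  qed
  have "?h ` cball 0 1 \<subseteq> (\<lambda>x. (norm K + 1) *\<^sub>R x) ` closure (blinfun_apply K ` cball 0 1)"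
  proof safe
    fix u :: "'a L2" assume "u \<in> cball 0 1"
    then have "norm (blinfun_apply (adjoint_op K) u) \<le> norm K"
      using norm_adjoint_op_le[OF Kb, of u] mult_left_le[of "norm u" "norm K"] by simp
    then show "?h u \<in> (\<lambda>x. (norm K + 1) *\<^sub>R x) ` closure (blinfun_apply K ` cball 0 1)"
      by (rule scaled)
  qed
  moreover have "compact ((\<lambda>x. (norm K + 1) *\<^sub>R x) ` closure (blinfun_apply K ` cball 0 1))"
    by (rule compact_scaling[OF Kc])
  ultimately have hc: "compact (closure (?h ` cball 0 1))"
    by (rule compact_closure_subset[rotated])
  have "compact (closure (blinfun_apply (adjoint_op K) ` cball 0 1))"
  proof (rule compact_closure_imageI)
    fix e :: real assume e: "e > 0"
    show "\<exists>I h. \<exists>\<delta>>0. finite (I :: unit set) \<and>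
      (\<forall>i\<in>I. compact (closure (h i ` cball 0 1 :: 'a L2 set))) \<and>
      (\<forall>x\<in>cball 0 1. \<forall>y\<in>cball 0 1. (\<forall>i\<in>I. dist (h i x) (h i y) < \<delta>) \<longrightarrow>
        dist (blinfun_apply (adjoint_op K) x) (blinfun_apply (adjoint_op K) y) < e)"
    proof (intro exI conjI ballI impI)
      fix x y :: "'a L2" assume xy: "x \<in> cball 0 1" "y \<in> cball 0 1"
        and d: "\<forall>i\<in>{()}. dist (?h x) (?h y) < e\<^sup>2 / 4"
      let ?w = "blinfun_apply (adjoint_op K) (x - y)"
      have "complex_of_real ((norm ?w)\<^sup>2) = cinner_L2 (?h x - ?h y) (x - y)"
        by (simp add: cinner_adjoint_op[OF Kb] cinner_L2_self flip: blinfun.diff_right del: of_real_power)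
      then have "(norm ?w)\<^sup>2 = cmod (cinner_L2 (?h x - ?h y) (x - y))"
        by (metis abs_of_nonneg norm_of_real zero_le_power2)
      also have "\<dots> \<le> norm (?h x - ?h y) * norm (x - y)"
        by (rule cmod_cinner_L2_le)
      also have "\<dots> \<le> (e\<^sup>2 / 4) * 2"
        using d xy norm_triangle_ineq4[of x y] by (intro mult_mono) (auto simp: dist_norm)
      also have "\<dots> < e\<^sup>2" using e by simp
      finally have "norm ?w < e"
        using e by (intro power2_less_imp_less[of "norm ?w" e]) auto
      then show "dist (blinfun_apply (adjoint_op K) x) (blinfun_apply (adjoint_op K) y) < e"
        by (simp add: dist_norm blinfun.diff_right)
    next
      show "e\<^sup>2 / 4 > 0" using e by simp
    qed (use hc in auto)
  qed
  then show ?thesis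
    by (simp add: compact_operators_def adjoint_op_bounded_operators[OF Kb])
qed

text \<open>Test operators that recover strong limits from strict ones: they map \<open>u\<close> to
  \<open>(norm u)\<^sup>2\<close> times itself.\<close>

lemma rank_one_compact_operators:
  fixes u :: "'a::euclidean_space L2"
  obtains K where "K \<in> compact_operators" "\<And>w. blinfun_apply K w = scaleC_L2 (cinner_L2 w u) u"
proof -
  interpret bounded_bilinear "cinner_L2 :: 'a L2 \<Rightarrow> _"
    by (rule bounded_bilinear_cinner_L2)
  have scale: "bounded_linear (\<lambda>c. scaleC_L2 c u)"
  proof (rule bounded_linear_intro[where K = "norm u"])
    show "scaleC_L2 (b + c) u = scaleC_L2 b u + scaleC_L2 c u" for b c
      by transfer (simp add: L2_rel_def square_integrable_cmult distrib_right square_integrable_add)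
    show "scaleC_L2 (r *\<^sub>R c) u = r *\<^sub>R scaleC_L2 c u" for r c
      by (simp add: scaleR_L2_def scaleC_L2_scaleC scaleR_conv_of_real)
  qed (simp add: norm_scaleC_L2)
  define K where "K = Blinfun (\<lambda>w. scaleC_L2 (cinner_L2 w u) u)"
  have K: "blinfun_apply K w = scaleC_L2 (cinner_L2 w u) u" for w
    unfolding K_def
    by (subst bounded_linear_Blinfun_apply)
      (auto intro: bounded_linear_compose[OF scale bounded_linear_left])
  have "blinfun_apply K ` cball 0 1 \<subseteq> (\<lambda>c. scaleC_L2 c u) ` cball 0 (norm u)"
  proof safe
    fix w :: "'a L2" assume "w \<in> cball 0 1"
    then have "cmod (cinner_L2 w u) \<le> norm u"
      using cmod_cinner_L2_le[of w u] mult_right_mono[of "norm w" 1 "norm u"] by simp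
    then show "blinfun_apply K w \<in> (\<lambda>c. scaleC_L2 c u) ` cball 0 (norm u)"
      unfolding K by (intro imageI) simp
  qed
  moreover have "compact ((\<lambda>c. scaleC_L2 c u) ` cball 0 (norm u))"
    by (intro compact_continuous_image linear_continuous_on scale compact_cball)
  ultimately have "compact (closure (blinfun_apply K ` cball 0 1))"
    by (rule compact_closure_subset[rotated])
  then have "K \<in> compact_operators"
    by (simp add: compact_operators_def bounded_operators_def K cinner_L2_scaleC_left scaleC_L2_scaleC)
  with K show ?thesis by (rule that[rotated])
qed

text \<open>Boundedness makes strong convergence uniform on the image of a compact \<open>K\<close>,
  which settles \<open>f x o\<^sub>L K\<close>. The other product has the same norm as its adjoint,
  and since the adjoint of \<open>K\<close> is compact, this is the same case. Conversely, a
  rank-one \<open>K\<close> tests the convergence at its own vector.\<close>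

lemma limitin_star_strong_iff_strict:
  fixes f :: "'i \<Rightarrow> 'a::euclidean_space L2 \<Rightarrow>\<^sub>L 'a L2"
  assumes f: "\<And>x. f x \<in> bounded_operators" and C: "\<And>x. norm (f x) \<le> C"
  shows "limitin star_strong_topology f 0 F \<longleftrightarrow>
    limitin (strict_topology compact_operators) f 0 F"
proof -
  have adj: "norm (K o\<^sub>L f x) = norm (adjoint_op (f x) o\<^sub>L adjoint_op K)" if "K \<in> bounded_operators" for K x
    by (metis adjoint_op_compose bounded_operators_compose f norm_adjoint_op that)
  have ne: "compact_operators \<noteq> {}" using zero_compact_operators by auto
  show ?thesis
    unfolding limitin_star_strong_iff[of f, OF f] limitin_strict_iff[of f, OF f ne]
  proof (intro iffI allI ballI)
    fix K :: "'a L2 \<Rightarrow>\<^sub>L 'a L2" assume K: "K \<in> compact_operators"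
      and lim: "\<forall>u. ((\<lambda>x. norm (blinfun_apply (f x) u)) \<longlongrightarrow> 0) F \<and>
        ((\<lambda>x. norm (blinfun_apply (adjoint_op (f x)) u)) \<longlongrightarrow> 0) F"
    then have "K \<in> bounded_operators" by (simp add: compact_operators_def)
    then show "((\<lambda>x. norm (K o\<^sub>L f x)) \<longlongrightarrow> 0) F \<and> ((\<lambda>x. norm (f x o\<^sub>L K)) \<longlongrightarrow> 0) F"
      using lim K adjoint_op_compact_operators[OF K]
      by (auto simp: adj compact_operators_def f C intro!: tendsto_compose_compact[where C = C])
  next
    fix u :: "'a L2"
    assume lim: "\<forall>K\<in>compact_operators.
      ((\<lambda>x. norm (K o\<^sub>L f x)) \<longlongrightarrow> 0) F \<and> ((\<lambda>x. norm (f x o\<^sub>L K)) \<longlongrightarrow> 0) F"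
    show "((\<lambda>x. norm (blinfun_apply (f x) u)) \<longlongrightarrow> 0) F \<and>
        ((\<lambda>x. norm (blinfun_apply (adjoint_op (f x)) u)) \<longlongrightarrow> 0) F"
    proof (cases "u = 0")
      case False
      obtain K where K: "K \<in> compact_operators"
        and K_apply: "\<And>w. blinfun_apply K w = scaleC_L2 (cinner_L2 w u) u"
        using rank_one_compact_operators[of u] by blast
      have Kb: "K \<in> bounded_operators" using K by (simp add: compact_operators_def)
      have adjK: "adjoint_op K = K"
        by (rule adjoint_op_eqI) (simp add: K_apply cinner_L2_scaleC_left cinner_L2_scaleC_right cnj_cinner_L2)
      have Ku: "blinfun_apply K u = (norm u)\<^sup>2 *\<^sub>R u"
        by (simp add: K_apply cinner_L2_self scaleC_L2_of_real del: of_real_power)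
      have le: "norm (blinfun_apply T u) \<le> norm (T o\<^sub>L K) / norm u" for T :: "'a L2 \<Rightarrow>\<^sub>L 'a L2"
      proof -
        have "(norm u)\<^sup>2 * norm (blinfun_apply T u) = norm (blinfun_apply (T o\<^sub>L K) u)"
          by (simp add: Ku blinfun.scaleR_right)
        also have "\<dots> \<le> norm (T o\<^sub>L K) * norm u" by (rule norm_blinfun)
        finally show ?thesis
          using False by (simp add: power2_eq_square field_simps)
      qed
      have 1: "((\<lambda>x. norm (f x o\<^sub>L K) / norm u) \<longlongrightarrow> 0) F"
        and 2: "((\<lambda>x. norm (adjoint_op (f x) o\<^sub>L K) / norm u) \<longlongrightarrow> 0) F"
        using bspec[OF lim K] adj[OF Kb] by (auto simp: adjK intro!: tendsto_divide_zero)
      show ?thesis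
        by (intro conjI Lim_null_comparison[OF _ 1] Lim_null_comparison[OF _ 2] always_eventually allI)
          (simp_all add: le)
    qed simp
  qed
qed

section \<open>Strong continuity and weak decay of the Weyl operators\<close>

lemma tendsto_abs_L2:
  fixes f :: "nat \<Rightarrow> 'a::euclidean_space \<Rightarrow> complex"
  assumes f: "\<And>n. square_integrable (f n)" and F: "square_integrable F"
    and lim: "AE y in lborel. (\<lambda>n. f n y) \<longlonglongrightarrow> F y"
    and w: "integrable lborel w" and bound: "\<And>n. AE y in lborel. (cmod (f n y - F y))\<^sup>2 \<le> w y"
  shows "(\<lambda>n. abs_L2 (f n)) \<longlonglongrightarrow> abs_L2 F"
proof -
  have [measurable]: "f n \<in> borel_measurable borel" "F \<in> borel_measurable borel" for n
    using f F by (auto intro: square_integrable_measurable)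
  have "(\<lambda>n. LINT y|lborel. (cmod (f n y - F y))\<^sup>2) \<longlonglongrightarrow> (LINT y|(lborel :: 'a measure). (0::real))"
  proof (rule integral_dominated_convergence[OF _ _ w])
    show "AE y in lborel. (\<lambda>n. (cmod (f n y - F y))\<^sup>2) \<longlonglongrightarrow> 0"
      using lim
    proof eventually_elim
      case (elim y)
      have "(\<lambda>n. (cmod (f n y - F y))\<^sup>2) \<longlonglongrightarrow> (cmod (F y - F y))\<^sup>2"
        by (intro tendsto_intros elim)
      then show ?case by simp
    qed
    show "AE y in lborel. norm ((cmod (f n y - F y))\<^sup>2) \<le> w y" for n
      using bound by simp
  qed simp_all
  moreover have "(LINT y|lborel. (cmod (f n y - F y))\<^sup>2) = (norm (abs_L2 (f n) - abs_L2 F))\<^sup>2" for n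
    using norm_abs_L2[OF square_integrable_diff[OF f F]] by (simp add: diff_abs_L2[OF f F])
  ultimately have "(\<lambda>n. sqrt ((norm (abs_L2 (f n) - abs_L2 F))\<^sup>2)) \<longlonglongrightarrow> sqrt 0"
    by (intro tendsto_intros) simp
  then show ?thesis
    by (simp add: tendsto_norm_zero_iff LIM_zero_iff)
qed

lemma integrable_indicator_cball:
  "integrable lborel (\<lambda>y::'a::euclidean_space. c * indicator (cball 0 r) y :: real)"
  using emeasure_lborel_cball_finite[of "0::'a" r]
  by (intro integrable_mult_right integrable_real_indicator) (simp_all add: less_top)

lemma square_integrable_continuous:
  fixes g :: "'a::euclidean_space \<Rightarrow> complex"
  assumes g: "continuous_on UNIV g" and M: "\<And>y. cmod (g y) \<le> M" and R: "\<And>y. norm y > R \<Longrightarrow> g y = 0"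
  shows "square_integrable g"
proof -
  have [measurable]: "g \<in> borel_measurable borel"
    by (rule borel_measurable_continuous_onI[OF g])
  have "integrable lborel (\<lambda>y::'a. M\<^sup>2 * indicator (cball 0 R) y)"
    by (rule integrable_indicator_cball)
  then have "integrable lborel (\<lambda>y. (cmod (g y))\<^sup>2)"
  proof (rule Bochner_Integration.integrable_bound)
    show "AE y in lborel. norm ((cmod (g y))\<^sup>2) \<le> norm (M\<^sup>2 * indicator (cball 0 R) y)"
      using M R by (auto simp: indicator_def intro!: power_mono AE_I2)
  qed simp
  then show ?thesis by (simp add: square_integrable_def)
qed

text \<open>Approximate almost everywhere by continuous functions, after truncating both the support and
  the values so that dominated convergence applies.\<close>

lemma dense_continuous_L2:
  fixes u :: "'a::euclidean_space L2"
  assumes "e > 0"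
  obtains g M R where "continuous_on UNIV g" "\<And>y. cmod (g y) \<le> M" "\<And>y. norm y > R \<Longrightarrow> g y = 0"
    "norm (u - abs_L2 g) < e"
proof -
  obtain f where f: "square_integrable f" and u: "u = abs_L2 f"
    by (rule L2_obtain_rep)
  have [measurable]: "f \<in> borel_measurable borel"
    by (rule square_integrable_measurable[OF f])
  \<comment> \<open>A tent cutoff, equal to 1 up to radius \<open>Suc k\<close> and to 0 from
    \<open>Suc k + 1\<close> on, times the factor that shrinks \<open>z\<close> to modulus at most
    \<open>Suc k\<close>. Being continuous in both arguments, it can be applied to \<open>f\<close>
    and to continuous approximants alike.\<close>
  define s where "s k y z = max 0 (min 1 (real (Suc k) + 1 - norm y)) * (real (Suc k) / max (real (Suc k)) (cmod z))"
    for k and y :: 'a and z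
  have s01: "0 \<le> s k y z" "s k y z \<le> 1" for k y z
  proof -
    show "0 \<le> s k y z" unfolding s_def by (intro mult_nonneg_nonneg divide_nonneg_nonneg) auto
    show "s k y z \<le> 1" unfolding s_def
      by (rule mult_le_one) (auto intro!: divide_nonneg_nonneg divide_le_eq_1_pos[THEN iffD2] simp: less_max_iff_disj)
  qed
  have s_bound: "cmod (of_real (s k y z) * z) \<le> real (Suc k)" for k y z
  proof -
    have "s k y z \<le> real (Suc k) / max (real (Suc k)) (cmod z)"
      unfolding s_def by (rule mult_left_le_one_le) (auto intro!: divide_nonneg_nonneg)
    then have "s k y z * cmod z \<le> (real (Suc k) / max (real (Suc k)) (cmod z)) * cmod z"
      by (rule mult_right_mono) simp
    also have "\<dots> = real (Suc k) * (cmod z / max (real (Suc k)) (cmod z))"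
      by simp
    also have "\<dots> \<le> real (Suc k) * 1"
      by (intro mult_left_mono divide_le_eq_1[THEN iffD2]) auto
    finally show ?thesis
      using s01 by (simp add: norm_mult)
  qed
  have s_supp: "s k y z = 0" if "norm y > real (Suc k) + 1" for k y z
    using that by (simp add: s_def)
  have s_cont: "continuous_on UNIV (\<lambda>y. s k y (h y))" if "continuous_on UNIV h" for k h
    unfolding s_def by (intro continuous_intros that) (auto simp: max_def)
  have [measurable]: "(\<lambda>y. s k y (f y)) \<in> borel_measurable borel" for k
    unfolding s_def by measurable
  have sf: "square_integrable (\<lambda>y. of_real (s k y (f y)) * f y)" for k
    by (rule square_integrable_mult_bounded[OF f, where c = 1]) (use s01 in auto)
  have "(\<lambda>k. abs_L2 (\<lambda>y. of_real (s k y (f y)) * f y)) \<longlonglongrightarrow> abs_L2 f"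
  proof (rule tendsto_abs_L2[OF sf f])
    show "integrable lborel (\<lambda>y. (cmod (f y))\<^sup>2)"
      using f by (simp add: square_integrable_def)
    show "AE y in lborel. (cmod (of_real (s k y (f y)) * f y - f y))\<^sup>2 \<le> (cmod (f y))\<^sup>2" for k
    proof (intro AE_I2 power_mono)
      fix y
      have "of_real (s k y (f y)) * f y - f y = of_real (s k y (f y) - 1) * f y"
        by (simp add: algebra_simps)
      then have "cmod (of_real (s k y (f y)) * f y - f y) = \<bar>s k y (f y) - 1\<bar> * cmod (f y)"
        by (simp only: norm_mult norm_of_real)
      also have "\<dots> \<le> 1 * cmod (f y)"
        using s01[of k y "f y"] by (intro mult_right_mono) (auto simp: abs_if)
      finally show "cmod (of_real (s k y (f y)) * f y - f y) \<le> cmod (f y)" by simp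
    qed simp
    show "AE y in lborel. (\<lambda>k. of_real (s k y (f y)) * f y) \<longlonglongrightarrow> f y"
    proof (rule AE_I2, rule tendsto_eventually)
      fix y
      obtain N where N: "norm y \<le> real N" "cmod (f y) \<le> real N"
        using real_arch_simple[of "max (norm y) (cmod (f y))"] by auto
      have "s k y (f y) = 1" if "k \<ge> N" for k
      proof -
        have "norm y \<le> real (Suc k)" "cmod (f y) \<le> real (Suc k)"
          using N that by auto
        then show ?thesis by (simp add: s_def max_def min_def)
      qed
      then show "eventually (\<lambda>k. of_real (s k y (f y)) * f y = f y) sequentially"
        by (auto simp: eventually_sequentially)
    qed
  qed
  from LIMSEQ_D[OF this half_gt_zero[OF assms]]
  obtain k where k: "norm (abs_L2 (\<lambda>y. of_real (s k y (f y)) * f y) - u) < e / 2"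
    unfolding u by blast
  \<comment> \<open>A Lebesgue measurable function is an almost everywhere limit of continuous ones,
    but without any norm control. Truncating the approximants by \<open>s k\<close> supplies the
    dominating function.\<close>
  have "f \<in> borel_measurable lebesgue"
    by (simp add: measurable_completion)
  from lebesgue_measurable_imp_measurable_on[OF this, of UNIV] obtain N g where N: "negligible N"
    and g: "\<And>n. continuous_on UNIV (g n)" and lim: "\<And>y. y \<notin> N \<Longrightarrow> (\<lambda>n. g n y) \<longlonglongrightarrow> f y"
    by (auto simp: measurable_on_def)
  have "AE y in completion lborel. y \<notin> N"
    using N by (intro AE_not_in) (simp add: negligible_iff_null_sets)
  then have AE_N: "AE y in lborel. y \<notin> N"
    by (simp only: AE_completion_iff)
  define h where "h n y = of_real (s k y (g n y)) * g n y" for n y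
  have h: "continuous_on UNIV (h n)" for n
    unfolding h_def by (intro continuous_intros g s_cont)
  have h_bound: "cmod (h n y) \<le> real (Suc k)" and h_supp: "norm y > real (Suc k) + 1 \<Longrightarrow> h n y = 0" for n y
    by (auto simp: h_def s_supp s_bound simp del: of_nat_Suc)
  have hsq: "square_integrable (h n)" for n
    by (rule square_integrable_continuous[OF h h_bound h_supp])
  have "(\<lambda>n. abs_L2 (h n)) \<longlonglongrightarrow> abs_L2 (\<lambda>y. of_real (s k y (f y)) * f y)"
  proof (rule tendsto_abs_L2[OF hsq sf])
    show "AE y in lborel. (\<lambda>n. h n y) \<longlonglongrightarrow> of_real (s k y (f y)) * f y"
      using AE_N
    proof eventually_elim
      case (elim y)
      show ?case
        unfolding h_def s_def
        by (intro tendsto_intros lim[OF elim]) (auto simp: max_def)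
    qed
    show "integrable lborel (\<lambda>y::'a. (2 * real (Suc k))\<^sup>2 * indicator (cball 0 (real (Suc k) + 1)) y)"
      by (rule integrable_indicator_cball)
    show "AE y in lborel. (cmod (h n y - of_real (s k y (f y)) * f y))\<^sup>2
        \<le> (2 * real (Suc k))\<^sup>2 * indicator (cball 0 (real (Suc k) + 1)) y" for n
    proof (rule AE_I2)
      fix y
      show "(cmod (h n y - of_real (s k y (f y)) * f y))\<^sup>2
        \<le> (2 * real (Suc k))\<^sup>2 * indicator (cball 0 (real (Suc k) + 1)) y"
      proof (cases "norm y > real (Suc k) + 1")
        case True
        then show ?thesis by (simp only: h_supp s_supp) simp
      next
        case False
        have "cmod (h n y - of_real (s k y (f y)) * f y) \<le> 2 * real (Suc k)"
          unfolding mult_2 by (rule order_trans[OF norm_triangle_ineq4 add_mono[OF h_bound s_bound]])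
        then have "(cmod (h n y - of_real (s k y (f y)) * f y))\<^sup>2 \<le> (2 * real (Suc k))\<^sup>2"
          by (rule power_mono) simp
        moreover have "y \<in> cball 0 (real (Suc k) + 1)" using False by simp
        ultimately show ?thesis by (simp only: indicator_simps mult_1_right)
      qed
    qed
  qed
  from LIMSEQ_D[OF this half_gt_zero[OF assms]]
  obtain n where n: "norm (abs_L2 (h n) - abs_L2 (\<lambda>y. of_real (s k y (f y)) * f y)) < e / 2"
    by blast
  have "norm (u - abs_L2 (h n)) < e"
    using k n norm_triangle_ineq[of "u - abs_L2 (\<lambda>y. of_real (s k y (f y)) * f y)"
        "abs_L2 (\<lambda>y. of_real (s k y (f y)) * f y) - abs_L2 (h n)"]
    by (simp add: norm_minus_commute)
  show ?thesis
    by (rule that[of "h n" "real (Suc k)" "real (Suc k) + 1"]) (fact h h_bound h_supp | fact)+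
qed

text \<open>Identifies the dual with the space itself through the inner product. Phase space becomes
  a Euclidean space, on which Lebesgue integrals, Gaussians and Fourier transforms are
  available.\<close>

definition phase :: "'a::euclidean_space \<times> 'a \<Rightarrow> 'a \<times> ('a \<Rightarrow>\<^sub>L real)" where
  "phase X = (fst X, blinfun_inner_right (snd X))"

definition weyl_unitary :: "'a::euclidean_space \<times> 'a \<Rightarrow> 'a L2 \<Rightarrow> 'a L2" where
  "weyl_unitary X = weyl_fun (fst X) (blinfun_inner_right (snd X))"

definition unitary_phase :: "'a::euclidean_space \<times> 'a \<Rightarrow> 'a \<Rightarrow> complex" where
  "unitary_phase X y = exp (\<i> * of_real (snd X \<bullet> (y - fst X /\<^sub>R 2)))"

lemma cmod_unitary_phase [simp]: "cmod (unitary_phase X y) = 1"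
  by (simp add: unitary_phase_def)

lemma unitary_phase_eq: "unitary_phase X = weyl_phase (fst X) (blinfun_inner_right (snd X))"
  by (simp add: fun_eq_iff unitary_phase_def weyl_phase_def)

lemma square_integrable_weyl_unitary:
  "square_integrable f \<Longrightarrow> square_integrable (\<lambda>y. unitary_phase X y * f (y - fst X))"
  unfolding unitary_phase_eq by (rule square_integrable_weyl)

lemma weyl_unitary_abs_L2:
  "square_integrable f \<Longrightarrow> weyl_unitary X (abs_L2 f) = abs_L2 (\<lambda>y. unitary_phase X y * f (y - fst X))"
  by (simp add: weyl_unitary_def weyl_fun.abs_eq L2_rel_def unitary_phase_eq)

lemma weyl_phase_apply: "blinfun_apply (weyl (phase X)) u = weyl_unitary X u"
  by (simp add: weyl.rep_eq phase_def weyl_unitary_def)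

lemma phase_uminus: "phase (- X) = - phase X"
  by (simp add: phase_def bounded_linear.linear[OF bounded_linear_blinfun_inner_right] linear_neg prod_eq_iff)

lemma norm_weyl_unitary [simp]: "norm (weyl_unitary X u) = norm u"
  by (simp add: weyl_unitary_def norm_weyl_fun)

lemma bounded_linear_weyl_unitary: "bounded_linear (weyl_unitary X)"
  by (simp add: weyl_unitary_def bounded_linear_weyl_fun)

lemma weyl_unitary_diff: "weyl_unitary X (u - v) = weyl_unitary X u - weyl_unitary X v"
  by (rule bounded_linear.linear[OF bounded_linear_weyl_unitary, THEN linear_diff])

text \<open>The canonical commutation relation. Both orders translate by
  \<open>fst X + fst Y\<close>, and their phases differ by a constant given by the symplectic
  form.\<close>

lemma weyl_unitary_weyl_unitary:
  "weyl_unitary X (weyl_unitary Y u) = scaleC_L2 (exp (\<i> * of_real (snd X \<bullet> fst Y - fst X \<bullet> snd Y))) (weyl_unitary Y (weyl_unitary X u))"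
proof -
  obtain f where f: "square_integrable f" and u: "u = abs_L2 f"
    by (rule L2_obtain_rep)
  have sq: "square_integrable (\<lambda>y. unitary_phase Y y * (unitary_phase X (y - fst Y) * f (y - fst Y - fst X)))"
    by (intro square_integrable_weyl_unitary[of "\<lambda>y. unitary_phase X y * f (y - fst X)"] square_integrable_weyl_unitary f)
  have "unitary_phase X y * (unitary_phase Y (y - fst X) * f (y - fst X - fst Y)) =
    exp (\<i> * of_real (snd X \<bullet> fst Y - fst X \<bullet> snd Y)) * (unitary_phase Y y * (unitary_phase X (y - fst Y) * f (y - fst Y - fst X)))" for y
  proof -
    have "unitary_phase X y * unitary_phase Y (y - fst X) =
      exp (\<i> * of_real (snd X \<bullet> fst Y - fst X \<bullet> snd Y)) * (unitary_phase Y y * unitary_phase X (y - fst Y))"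
      unfolding unitary_phase_def exp_add[symmetric] distrib_left[symmetric] of_real_add[symmetric]
      by (rule arg_cong[where f = "\<lambda>r. exp (\<i> * of_real r)"])
        (simp add: inner_diff_right inner_commute)
    moreover have "y - fst X - fst Y = y - fst Y - fst X" by simp
    ultimately show ?thesis by (metis mult.assoc)
  qed
  then show ?thesis
    by (simp add: u weyl_unitary_abs_L2 square_integrable_weyl_unitary f scaleC_L2.abs_eq L2_rel_def sq)
qed

lemma weyl_unitary_weyl_unitary_uminus [simp]: "weyl_unitary X (weyl_unitary (- X) u) = u"
proof -
  obtain f where f: "square_integrable f" and u: "u = abs_L2 f"
    by (rule L2_obtain_rep)
  have "unitary_phase X y * unitary_phase (- X) (y - fst X) = 1" for y
    unfolding unitary_phase_def exp_add[symmetric] distrib_left[symmetric] of_real_add[symmetric]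
    by (simp add: inner_diff_right inner_add_right)
  then have "(\<lambda>y. unitary_phase X y * (unitary_phase (- X) (y - fst X) * f y)) = f"
    by (simp add: fun_eq_iff flip: mult.assoc)
  then show ?thesis
    using weyl_unitary_abs_L2[OF square_integrable_weyl_unitary[OF f, of "- X"], of X] by (simp add: u weyl_unitary_abs_L2 f)
qed

lemma cinner_weyl_unitary_weyl_unitary [simp]: "cinner_L2 (weyl_unitary X u) (weyl_unitary X v) = cinner_L2 u v"
  by (simp add: weyl_unitary_def cinner_weyl_fun)

lemma cinner_weyl_unitary: "cinner_L2 (weyl_unitary X u) v = cinner_L2 u (weyl_unitary (- X) v)"
  by (metis cinner_weyl_unitary_weyl_unitary weyl_unitary_weyl_unitary_uminus)

lemma weyl_unitary_zero [simp]: "weyl_unitary 0 u = u"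
proof -
  obtain f where f: "square_integrable f" and u: "u = abs_L2 f"
    by (rule L2_obtain_rep)
  then show ?thesis by (simp add: weyl_unitary_abs_L2 unitary_phase_def)
qed

text \<open>The operators are isometric, so a dense set of vectors is enough. For bounded continuous
  functions of bounded support the integrands converge pointwise, and bounded shifts keep all
  supports in one ball, so convergence is dominated.\<close>

lemma continuous_on_weyl_unitary: "continuous_on UNIV (\<lambda>X. weyl_unitary X u)"
proof (rule continuous_on_sequentiallyI)
  fix X :: "nat \<Rightarrow> 'a \<times> 'a" and Z assume X: "X \<longlonglongrightarrow> Z"
  have core: "(\<lambda>n. weyl_unitary (X n) (abs_L2 g)) \<longlonglongrightarrow> weyl_unitary Z (abs_L2 g)"
    if g: "continuous_on UNIV g" and M: "\<And>y. cmod (g y) \<le> M" and R: "\<And>y. norm y > R \<Longrightarrow> g y = 0"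
    for g :: "'a \<Rightarrow> complex" and M R
  proof -
    have sq: "square_integrable g" by (rule square_integrable_continuous[OF g M R])
    have [measurable]: "g \<in> borel_measurable borel"
      by (rule square_integrable_measurable[OF sq])
    obtain B where B: "\<And>n. norm (fst (X n)) \<le> B" "norm (fst Z) \<le> B"
    proof -
      have "bounded (insert (fst Z) (range (\<lambda>n. fst (X n))))"
        unfolding bounded_insert by (intro convergent_imp_bounded[where l = "fst Z"] tendsto_intros X)
      then show ?thesis
        using that by (auto simp: bounded_iff)
    qed
    show ?thesis
      unfolding weyl_unitary_abs_L2[OF sq]
    proof (rule tendsto_abs_L2)
      show "AE y in lborel. (\<lambda>n. unitary_phase (X n) y * g (y - fst (X n))) \<longlonglongrightarrow> unitary_phase Z y * g (y - fst Z)"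
        unfolding unitary_phase_def
        by (intro AE_I2 tendsto_intros X continuous_on_tendsto_compose[OF g]) auto
      show "integrable lborel (\<lambda>y::'a. (2 * M)\<^sup>2 * indicator (cball 0 (R + B)) y)"
        by (rule integrable_indicator_cball)
      show "AE y in lborel. (cmod (unitary_phase (X n) y * g (y - fst (X n)) - unitary_phase Z y * g (y - fst Z)))\<^sup>2
          \<le> (2 * M)\<^sup>2 * indicator (cball 0 (R + B)) y" for n
      proof (rule AE_I2)
        fix y :: 'a
        show "(cmod (unitary_phase (X n) y * g (y - fst (X n)) - unitary_phase Z y * g (y - fst Z)))\<^sup>2
          \<le> (2 * M)\<^sup>2 * indicator (cball 0 (R + B)) y"
        proof (cases "norm y > R + B")
          case True
          then have "norm (y - fst (X n)) > R" "norm (y - fst Z) > R"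
            using B(1)[of n] B(2) norm_triangle_ineq2[of y "fst (X n)"] norm_triangle_ineq2[of y "fst Z"]
            by linarith+
          then show ?thesis by (simp add: R)
        next
          case False
          have "cmod (unitary_phase (X n) y * g (y - fst (X n)) - unitary_phase Z y * g (y - fst Z)) \<le> 2 * M"
            using norm_triangle_ineq4[of "unitary_phase (X n) y * g (y - fst (X n))" "unitary_phase Z y * g (y - fst Z)"]
              M[of "y - fst (X n)"] M[of "y - fst Z"] by (simp add: norm_mult)
          then have "(cmod (unitary_phase (X n) y * g (y - fst (X n)) - unitary_phase Z y * g (y - fst Z)))\<^sup>2 \<le> (2 * M)\<^sup>2"
            by (rule power_mono) simp
          then show ?thesis using False by simp
        qed
      qed
    qed (intro square_integrable_weyl_unitary sq)+
  qed
  show "(\<lambda>n. weyl_unitary (X n) u) \<longlonglongrightarrow> weyl_unitary Z u"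
  proof (rule LIMSEQ_I)
    fix e :: real assume e: "e > 0"
    then have "e / 3 > 0" by simp
    then obtain g M R where g: "continuous_on UNIV g" "\<And>y. cmod (g y) \<le> M" "\<And>y. norm y > R \<Longrightarrow> g y = 0"
      and ug: "norm (u - abs_L2 g) < e / 3"
      using dense_continuous_L2[of "e / 3" u] by blast
    obtain N where N: "\<And>n. n \<ge> N \<Longrightarrow> norm (weyl_unitary (X n) (abs_L2 g) - weyl_unitary Z (abs_L2 g)) < e / 3"
      using LIMSEQ_D[OF core[OF g] \<open>e / 3 > 0\<close>] by blast
    have "norm (weyl_unitary (X n) u - weyl_unitary Z u) < e" if "n \<ge> N" for n
    proof -
      have "weyl_unitary (X n) u - weyl_unitary Z u = weyl_unitary (X n) (u - abs_L2 g) + (weyl_unitary (X n) (abs_L2 g) - weyl_unitary Z (abs_L2 g)) - weyl_unitary Z (u - abs_L2 g)"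
        by (simp add: weyl_unitary_diff)
      then have "norm (weyl_unitary (X n) u - weyl_unitary Z u) \<le>
          norm (weyl_unitary (X n) (u - abs_L2 g)) + norm (weyl_unitary (X n) (abs_L2 g) - weyl_unitary Z (abs_L2 g)) + norm (weyl_unitary Z (u - abs_L2 g))"
        using norm_triangle_ineq[of "weyl_unitary (X n) (u - abs_L2 g)" "weyl_unitary (X n) (abs_L2 g) - weyl_unitary Z (abs_L2 g)"]
          norm_triangle_ineq4[of "weyl_unitary (X n) (u - abs_L2 g) + (weyl_unitary (X n) (abs_L2 g) - weyl_unitary Z (abs_L2 g))" "weyl_unitary Z (u - abs_L2 g)"]
        by simp
      then show ?thesis
        using N[OF that] ug by simp
    qed
    then show "\<exists>no. \<forall>n\<ge>no. norm (weyl_unitary (X n) u - weyl_unitary Z u) < e" by blast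
  qed
qed

text \<open>For \<open>Y = \<pi> (\<eta>, -x) / \<parallel>X\<parallel>\<^sup>2\<close>, where \<open>X = (x, \<eta>)\<close>, the operators \<open>W(X)\<close> and \<open>W(Y)\<close>
  anticommute, whence
  \<open>2 \<langle>W(X) u, v\<rangle> = \<langle>W(X) (u - W(Y) u), v\<rangle> + \<langle>W(X) W(Y) u, v - W(Y) v\<rangle>\<close>.\<close>

lemma weyl_unitary_weakly_null:
  fixes u v :: "'a::euclidean_space L2"
  assumes "e > 0"
  shows "\<exists>R. \<forall>X. norm X \<ge> R \<longrightarrow> cmod (cinner_L2 (weyl_unitary X u) v) < e"
proof -
  define e' where "e' = e / (norm u + norm v + 1)"
  have e': "e' > 0" using assms by (simp add: e'_def add_nonneg_pos)
  have lim: "((\<lambda>Y. weyl_unitary Y w) \<longlongrightarrow> w) (at 0)" for w :: "'a L2"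
    using continuous_on_weyl_unitary[of w] by (metis UNIV_I continuous_on_def weyl_unitary_zero)
  obtain d where d: "d > 0"
    "\<And>Y. Y \<noteq> 0 \<Longrightarrow> norm Y < d \<Longrightarrow> norm (weyl_unitary Y u - u) < e'"
    "\<And>Y. Y \<noteq> 0 \<Longrightarrow> norm Y < d \<Longrightarrow> norm (weyl_unitary Y v - v) < e'"
  proof -
    have "eventually (\<lambda>Y. norm (weyl_unitary Y u - u) < e' \<and> norm (weyl_unitary Y v - v) < e') (at 0)"
      using tendstoD[OF lim e', of u] tendstoD[OF lim e', of v] by eventually_elim (simp add: dist_norm)
    then show ?thesis
      using that by (auto simp: eventually_at dist_norm)
  qed
  show ?thesis
  \<comment> \<open>Since \<open>norm Y = pi / norm X\<close>, this radius makes \<open>Y\<close>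
    shorter than \<open>d\<close>; the 1 keeps \<open>X\<close> away from 0.\<close>
  proof (intro exI[of _ "max 1 (pi / d + 1)"] allI impI)
    fix X :: "'a \<times> 'a" assume "norm X \<ge> max 1 (pi / d + 1)"
    then have X: "norm X > 0" "norm X > pi / d" by linarith+
    define Y where "Y = (pi / (norm X)\<^sup>2) *\<^sub>R (snd X, - fst X)"
    have swap: "norm (snd X, - fst X) = norm X"
      by (simp add: norm_prod_def add.commute)
    have "norm Y = pi / norm X"
      using X(1) by (simp only: Y_def norm_scaleR swap) (simp add: power2_eq_square)
    moreover have "pi / norm X < d" "pi / norm X > 0"
      using X d(1) by (simp_all add: field_simps)
    ultimately have Yd: "norm Y < d" and Y0: "Y \<noteq> 0"
      by auto
    have "snd X \<bullet> fst Y - fst X \<bullet> snd Y = pi / (norm X)\<^sup>2 * (norm X)\<^sup>2"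
      by (simp add: Y_def power2_norm_eq_inner inner_prod_def algebra_simps add_divide_distrib)
    then have "snd X \<bullet> fst Y - fst X \<bullet> snd Y = pi" using X(1) by simp
    \<comment> \<open>The symplectic form of \<open>X\<close> and \<open>Y\<close> is
      \<open>pi\<close>, and the exponential of \<open>\<i> * pi\<close> is -1.\<close>
    then have comm: "weyl_unitary X (weyl_unitary Y u) = - weyl_unitary Y (weyl_unitary X u)"
      by (subst weyl_unitary_weyl_unitary) (simp add: uminus_L2_def mult.commute[of \<i>])
    have "cinner_L2 (weyl_unitary X u) v = - cinner_L2 (weyl_unitary X (weyl_unitary Y u)) (weyl_unitary Y v)"
      by (simp add: comm cinner_L2_uminus_left)
    then have "2 * cinner_L2 (weyl_unitary X u) v = cinner_L2 (weyl_unitary X (u - weyl_unitary Y u)) v + cinner_L2 (weyl_unitary X (weyl_unitary Y u)) (v - weyl_unitary Y v)"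
      by (simp add: weyl_unitary_diff cinner_L2_diff_left cinner_L2_diff_right)
    then have "2 * cmod (cinner_L2 (weyl_unitary X u) v) \<le>
        cmod (cinner_L2 (weyl_unitary X (u - weyl_unitary Y u)) v) + cmod (cinner_L2 (weyl_unitary X (weyl_unitary Y u)) (v - weyl_unitary Y v))"
      by (metis norm_mult norm_numeral norm_triangle_ineq)
    also have "\<dots> \<le> norm (u - weyl_unitary Y u) * norm v + norm u * norm (v - weyl_unitary Y v)"
      using cmod_cinner_L2_le[of "weyl_unitary X (u - weyl_unitary Y u)" v] cmod_cinner_L2_le[of "weyl_unitary X (weyl_unitary Y u)" "v - weyl_unitary Y v"]
      by simp
    also have "\<dots> \<le> e' * norm v + norm u * e'"
      using d(2)[OF Y0 Yd] d(3)[OF Y0 Yd]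
      by (intro add_mono mult_right_mono mult_left_mono) (auto simp: norm_minus_commute)
    also have "\<dots> < e' * (norm u + norm v + 1)"
      using e' by (simp add: algebra_simps)
    also have "\<dots> = e"
      by (simp add: e'_def add_nonneg_pos add_nonneg_nonneg pos_le_divide_eq nonzero_eq_divide_eq)
        (smt (verit) norm_ge_zero)
    finally show "cmod (cinner_L2 (weyl_unitary X u) v) < e"
      using norm_ge_zero[of "cinner_L2 (weyl_unitary X u) v"] by linarith
  qed
qed

section \<open>The Frechet filter in Euclidean coordinates\<close>

lemma continuous_on_phase: "continuous_on S phase"
  unfolding phase_def
  by (intro continuous_intros linear_continuous_on bounded_linear_compose[OF bounded_linear_blinfun_inner_right bounded_linear_snd])

lemma norm_le_phase: "norm X \<le> norm (phase X)"
proof -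
  have "norm \<eta> \<le> norm (blinfun_inner_right \<eta>)" for \<eta> :: 'a
  proof (cases "\<eta> = 0")
    case False
    have "norm \<eta> * norm \<eta> \<le> norm (blinfun_inner_right \<eta>) * norm \<eta>"
      using norm_blinfun[of "blinfun_inner_right \<eta>" \<eta>] by (simp add: power2_eq_square dot_square_norm)
    then show ?thesis using False by simp
  qed simp
  then show ?thesis
    by (simp add: norm_prod_def phase_def power_mono)
qed

lemma surj_phase: "surj phase"
proof (rule surjI)
  fix Y :: "'a \<times> ('a \<Rightarrow>\<^sub>L real)"
  have "blinfun_inner_right (\<Sum>b\<in>Basis. blinfun_apply (snd Y) b *\<^sub>R b) = snd Y"
  proof (rule blinfun_eqI)
    fix y :: 'a
    have "blinfun_apply (snd Y) y = blinfun_apply (snd Y) (\<Sum>b\<in>Basis. (y \<bullet> b) *\<^sub>R b)"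
      by (simp add: euclidean_representation)
    also have "\<dots> = (\<Sum>b\<in>Basis. (y \<bullet> b) * blinfun_apply (snd Y) b)"
      by (simp add: blinfun.sum_right blinfun.scaleR_right)
    finally show "blinfun_apply (blinfun_inner_right (\<Sum>b\<in>Basis. blinfun_apply (snd Y) b *\<^sub>R b)) y = blinfun_apply (snd Y) y"
      by (simp add: inner_sum_left inner_commute[of y] mult.commute)
  qed
  then show "phase (fst Y, \<Sum>b\<in>Basis. blinfun_apply (snd Y) b *\<^sub>R b) = Y"
    by (simp add: phase_def)
qed

text \<open>Relatively compact sets correspond to bounded ones. \<open>phase\<close> does not
  decrease norms, so bounded sets pull back to bounded sets; it is continuous and onto, so the
  exceptional points lie in the compact image of a ball.\<close>

lemma eventually_frechet_phase:
  fixes P :: "'a::euclidean_space \<times> ('a \<Rightarrow>\<^sub>L real) \<Rightarrow> bool"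
  shows "eventually P frechet_filter \<longleftrightarrow> (\<exists>R. \<forall>X. norm X \<ge> R \<longrightarrow> P (phase X))"
proof
  assume "eventually P frechet_filter"
  then have "bounded (closure {x. \<not> P x})"
    by (simp add: eventually_frechet_filter compact_imp_bounded)
  then obtain B where B: "\<And>x. \<not> P x \<Longrightarrow> norm x \<le> B"
    using closure_subset[of "{x. \<not> P x}"] by (auto simp: bounded_iff)
  then have "P (phase X)" if "norm X \<ge> B + 1" for X
    using norm_le_phase[of X] that B[of "phase X"] by fastforce
  then show "\<exists>R. \<forall>X. norm X \<ge> R \<longrightarrow> P (phase X)" by blast
next
  assume "\<exists>R. \<forall>X. norm X \<ge> R \<longrightarrow> P (phase X)"
  then obtain R where R: "\<And>X. norm X \<ge> R \<Longrightarrow> P (phase X)" by blast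
  have "{x. \<not> P x} \<subseteq> phase ` cball 0 R"
  proof
    fix x assume x: "x \<in> {x. \<not> P x}"
    obtain X where X: "x = phase X" using surj_phase by (metis surjD)
    then have "norm X < R" using R[of X] x by (cases "norm X < R") auto
    then show "x \<in> phase ` cball 0 R" by (auto simp: X)
  qed
  moreover have "compact (phase ` cball 0 R)"
    by (intro compact_continuous_image continuous_on_phase compact_cball)
  ultimately show "eventually P frechet_filter"
    unfolding eventually_frechet_filter by (rule compact_closure_subset[rotated])
qed

lemma frechet_filter_phase_neq_bot: "(frechet_filter :: ('a::euclidean_space \<times> ('a \<Rightarrow>\<^sub>L real)) filter) \<noteq> bot"
proof
  assume "(frechet_filter :: ('a::euclidean_space \<times> ('a \<Rightarrow>\<^sub>L real)) filter) = bot"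
  then obtain R where R: "\<And>X :: 'a \<times> 'a. norm X < R"
    using eventually_frechet_phase[of "\<lambda>_ :: 'a \<times> ('a \<Rightarrow>\<^sub>L real). False"] by (auto simp: not_le)
  obtain x :: "'a \<times> 'a" where "norm x = \<bar>R\<bar>" by (metis abs_ge_zero vector_choose_size)
  with R[of x] show False by simp
qed

text \<open>With \<open>G x = \<langle>\<cdot>, g x\<rangle>\<close> one has \<open>\<parallel>K (g x)\<parallel> \<le> \<parallel>G x \<circ> K\<^sup>*\<parallel>\<close>, and \<open>G x \<rightarrow> 0\<close> strongly.\<close>

lemma norm_compact_compose_weakly_null:
  fixes g :: "'i \<Rightarrow> 'a::euclidean_space L2"
  assumes K: "K \<in> compact_operators" and C: "\<And>x. norm (g x) \<le> C"
    and lim: "\<And>v. ((\<lambda>x. cinner_L2 (g x) v) \<longlongrightarrow> 0) F"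
  shows "((\<lambda>x. norm (blinfun_apply K (g x))) \<longlongrightarrow> 0) F"
proof -
  interpret bounded_bilinear "cinner_L2 :: 'a L2 \<Rightarrow> _"
    by (rule bounded_bilinear_cinner_L2)
  have Kb: "K \<in> bounded_operators" using K by (simp add: compact_operators_def)
  define G where "G x = Blinfun (\<lambda>v. cinner_L2 v (g x))" for x
  have G: "blinfun_apply (G x) v = cinner_L2 v (g x)" for x v
    unfolding G_def by (simp add: bounded_linear_Blinfun_apply bounded_linear_left)
  have "norm (G x) \<le> C" for x
  proof -
    have "norm (G x) \<le> norm (g x)"
      by (rule norm_blinfun_bound) (simp_all add: G cmod_cinner_L2_le mult.commute)
    then show ?thesis using C[of x] by simp
  qed
  moreover have "((\<lambda>x. norm (blinfun_apply (G x) v)) \<longlongrightarrow> 0) F" for v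
  proof -
    have "norm (blinfun_apply (G x) v) = cmod (cinner_L2 (g x) v)" for x
      by (metis G cnj_cinner_L2 complex_mod_cnj)
    then show ?thesis using tendsto_norm_zero[OF lim[of v]] by simp
  qed
  ultimately have GK: "((\<lambda>x. norm (G x o\<^sub>L adjoint_op K)) \<longlongrightarrow> 0) F"
    using adjoint_op_compact_operators[OF K]
    by (intro tendsto_compose_compact) (auto simp: compact_operators_def)
  have "norm (blinfun_apply K (g x)) \<le> norm (G x o\<^sub>L adjoint_op K)" for x
  proof -
    let ?w = "blinfun_apply K (g x)"
    have "norm ?w * norm ?w = cmod (blinfun_apply (G x o\<^sub>L adjoint_op K) ?w)"
      by (simp add: G cinner_adjoint_op'[OF Kb] cinner_L2_self power2_eq_square norm_mult)
    also have "\<dots> \<le> norm (G x o\<^sub>L adjoint_op K) * norm ?w"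
      by (rule norm_blinfun)
    finally show ?thesis by (cases "norm ?w = 0") (auto simp: mult_le_cancel_right)
  qed
  then show ?thesis
    by (intro Lim_null_comparison[OF _ GK]) simp
qed

lemma translate_op_phase_apply:
  "blinfun_apply (translate_op (phase X) S) u = weyl_unitary X (blinfun_apply S (weyl_unitary (- X) u))"
  by (simp add: translate_op_def weyl_phase_apply flip: phase_uminus)

lemma adjoint_translate_op:
  assumes "S \<in> bounded_operators"
  shows "adjoint_op (translate_op X S) = translate_op X (adjoint_op S)"
proof -
  obtain Y where "X = phase Y" using surj_phase by (metis surjD)
  then show ?thesis
    by (intro adjoint_op_eqI)
      (simp add: translate_op_phase_apply cinner_weyl_unitary cinner_adjoint_op[OF assms] minus_minus)
qed

lemma norm_translate_op_le: "norm (translate_op X S) \<le> norm S"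
proof -
  obtain Y where Y: "X = phase Y" using surj_phase by (metis surjD)
  show ?thesis
    by (rule norm_blinfun_bound)
      (use norm_blinfun[of S "weyl_unitary (- Y) _"] in \<open>simp_all add: Y translate_op_phase_apply\<close>)
qed

lemma tendsto_translate_op_compact:
  fixes K :: "'a::euclidean_space L2 \<Rightarrow>\<^sub>L 'a L2"
  assumes K: "K \<in> compact_operators"
  shows "((\<lambda>X. norm (blinfun_apply (translate_op X K) u)) \<longlongrightarrow> 0) frechet_filter"
proof -
  have "((\<lambda>X. norm (blinfun_apply K (blinfun_apply (weyl (- X)) u))) \<longlongrightarrow> 0) frechet_filter"
  proof (rule norm_compact_compose_weakly_null[OF K, where C = "norm u"])
    show "norm (blinfun_apply (weyl (- X)) u) \<le> norm u" for X
      by (simp add: weyl.rep_eq case_prod_beta norm_weyl_fun)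
    show "((\<lambda>X. cinner_L2 (blinfun_apply (weyl (- X)) u) v) \<longlongrightarrow> 0) frechet_filter" for v
    proof (rule tendstoI)
      fix e :: real assume "e > 0"
      then obtain R where R: "\<And>X. norm X \<ge> R \<Longrightarrow> cmod (cinner_L2 (weyl_unitary X u) v) < e"
        using weyl_unitary_weakly_null by blast
      have "cmod (cinner_L2 (weyl_unitary (- X) u) v) < e" if "norm X \<ge> R" for X
        by (rule R) (simp add: that)
      then show "eventually (\<lambda>X. dist (cinner_L2 (blinfun_apply (weyl (- X)) u) v) 0 < e) frechet_filter"
        unfolding eventually_frechet_phase
        by (intro exI[of _ R]) (simp add: weyl_phase_apply flip: phase_uminus)
    qed
  qed
  moreover have "norm (blinfun_apply (weyl X) w) = norm w" for X and w :: "'a L2"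
    by (simp add: weyl.rep_eq case_prod_beta norm_weyl_fun)
  ultimately show ?thesis
    by (simp add: translate_op_def)
qed

lemma limitin_translate_op_compact:
  fixes K :: "'a::euclidean_space L2 \<Rightarrow>\<^sub>L 'a L2"
  assumes K: "K \<in> compact_operators"
  shows "limitin star_strong_topology (\<lambda>X. translate_op X K) 0 frechet_filter"
proof -
  have Kb: "K \<in> bounded_operators" using K by (simp add: compact_operators_def)
  show ?thesis
    using tendsto_translate_op_compact[OF K]
      tendsto_translate_op_compact[OF adjoint_op_compact_operators[OF K]]
    by (subst limitin_star_strong_iff)
      (simp_all add: translate_op_bounded_operators[OF Kb] adjoint_translate_op[OF Kb])
qed

section \<open>Gaussian regularisation of Fourier integrals\<close>

lemma integral_gaussian:
  assumes "c > 0"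
  shows "(LINT x|lborel. exp (- (c * (norm (x::'e::euclidean_space))\<^sup>2))) = sqrt (pi / c) ^ DIM('e)"
proof -
  have "(LINT x|lborel. complex_of_real (exp (- (c * (norm (x::'e))\<^sup>2)))) = of_real (sqrt (pi / c) ^ DIM('e))"
    using fourier_gaussian[OF assms, of "0::'e"] by simp
  then show ?thesis
    by (simp only: integral_complex_of_real of_real_eq_iff)
qed

lemma lborel_integral_scaleR:
  fixes f :: "'e::euclidean_space \<Rightarrow> 'b::{banach, second_countable_topology}"
  assumes "c > 0" and [measurable]: "f \<in> borel_measurable borel"
  shows "(LINT x|lborel. f x) = c ^ DIM('e) *\<^sub>R (LINT x|lborel. f (c *\<^sub>R x))"
proof -
  have "(LINT x|lborel. f x) = (LINT x|density (distr lborel borel (\<lambda>x. 0 + c *\<^sub>R x)) (\<lambda>_. ennreal (\<bar>c\<bar> ^ DIM('e))). f x)"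
    using lborel_affine[of c "0::'e"] assms(1) by (simp add: ennreal_power)
  also have "\<dots> = (LINT x|distr lborel borel (\<lambda>x. 0 + c *\<^sub>R x). (\<bar>c\<bar> ^ DIM('e)) *\<^sub>R f x)"
    by (rule integral_density) auto
  also have "\<dots> = (LINT x|lborel. (\<bar>c\<bar> ^ DIM('e)) *\<^sub>R f (0 + c *\<^sub>R x))"
    by (rule integral_distr) auto
  finally show ?thesis
    using assms(1) by simp
qed

section \<open>Fubini on products of Euclidean spaces\<close>

lemma integrable_pair_mult:
  fixes f :: "'e::euclidean_space \<Rightarrow> real" and g :: "'f::euclidean_space \<Rightarrow> real"
  assumes f: "integrable lborel f" and g: "integrable lborel g"
  shows "integrable (lborel \<Otimes>\<^sub>M lborel) (\<lambda>(x, y). f x * g y)"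
proof (rule lborel_pair.Fubini_integrable)
  have [measurable]: "f \<in> borel_measurable borel" "g \<in> borel_measurable borel"
    using assms by (auto dest: borel_measurable_integrable)
  show "(\<lambda>(x, y). f x * g y) \<in> borel_measurable (lborel \<Otimes>\<^sub>M lborel)"
    by measurable
  show "integrable lborel (\<lambda>x. LINT y|lborel. norm (case (x, y) of (x, y) \<Rightarrow> f x * g y))"
    using f by (simp add: abs_mult integrable_norm)
  show "AE x in lborel. integrable lborel (\<lambda>y. case (x, y) of (x, y) \<Rightarrow> f x * g y)"
    using g by simp
qed

lemma integrable_pair_bound:
  fixes F :: "'e::euclidean_space \<times> 'f::euclidean_space \<Rightarrow> complex"
  assumes F: "F \<in> borel_measurable borel"
    and f: "integrable lborel f" and g: "integrable lborel g"
    and le: "\<And>x y. cmod (F (x, y)) \<le> f x * g y"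
  shows "integrable lborel F"
  unfolding lborel_prod[symmetric]
proof (rule Bochner_Integration.integrable_bound[OF integrable_pair_mult[OF f g]])
  show "F \<in> borel_measurable (lborel \<Otimes>\<^sub>M lborel)"
    using F by (simp add: lborel_prod)
  show "AE p in lborel \<Otimes>\<^sub>M lborel. norm (F p) \<le> norm (case p of (x, y) \<Rightarrow> f x * g y)"
  proof (rule AE_I2)
    fix p show "norm (F p) \<le> norm (case p of (x, y) \<Rightarrow> f x * g y)"
      using le[of "fst p" "snd p"] by (cases p) auto
  qed
qed

lemma
  fixes F :: "'e::euclidean_space \<times> 'f::euclidean_space \<Rightarrow> complex"
  assumes "integrable lborel F"
  shows integral_lborel_pair: "(LINT p|lborel. F p) = (LINT x|lborel. LINT y|lborel. F (x, y))"
    and integral_lborel_pair': "(LINT p|lborel. F p) = (LINT y|lborel. LINT x|lborel. F (x, y))"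
proof -
  have *: "integrable (lborel \<Otimes>\<^sub>M lborel) (case_prod (\<lambda>x y. F (x, y)))"
    using assms by (simp add: lborel_prod)
  show "(LINT p|lborel. F p) = (LINT x|lborel. LINT y|lborel. F (x, y))"
    using lborel_pair.integral_fst[OF *] by (simp add: lborel_prod)
  show "(LINT p|lborel. F p) = (LINT y|lborel. LINT x|lborel. F (x, y))"
    using lborel_pair.integral_snd[OF *] by (simp add: lborel_prod)
qed

text \<open>The Gaussian regularises the divergent \<open>\<integral> exp (i Z \<bullet> X) dZ\<close>.\<close>

lemma integral_gaussian_fourier:
  fixes h :: "'p::euclidean_space \<Rightarrow> complex" and y :: "'p \<Rightarrow> 'e::euclidean_space"
  assumes c: "c > 0" and g: "integrable lborel h" and [measurable]: "y \<in> borel_measurable borel"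
  shows "(LINT Z|lborel. of_real (exp (- (c * (norm Z)\<^sup>2))) * (LINT P|lborel. exp (\<i> * of_real (Z \<bullet> y P)) * h P)) =
    (LINT P|lborel. of_real (sqrt (pi / c) ^ DIM('e) * exp (- (norm (y P))\<^sup>2 / (4 * c))) * h P)"
proof -
  have [measurable]: "h \<in> borel_measurable borel"
    using g by (auto dest: borel_measurable_integrable)
  define F where "F q = of_real (exp (- (c * (norm (fst q))\<^sup>2))) * (exp (\<i> * of_real (fst q \<bullet> y (snd q))) * h (snd q))" for q
  have m: "F \<in> borel_measurable (borel \<Otimes>\<^sub>M borel)"
    unfolding F_def by measurable
  have F: "integrable lborel F"
    by (rule integrable_pair_bound[OF _ integrable_gaussian[OF c] integrable_norm[OF g]])
      (use m in \<open>auto simp: F_def norm_mult borel_prod\<close>)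
  have "(LINT Z|lborel. of_real (exp (- (c * (norm Z)\<^sup>2))) * (LINT P|lborel. exp (\<i> * of_real (Z \<bullet> y P)) * h P)) =
     (LINT Z|lborel. LINT P|lborel. F (Z, P))"
    by (simp add: F_def)
  also have "\<dots> = (LINT P|lborel. LINT Z|lborel. F (Z, P))"
    using integral_lborel_pair[OF F] integral_lborel_pair'[OF F] by simp
  also have "(\<lambda>P. LINT Z|lborel. F (Z, P)) =
      (\<lambda>P. of_real (sqrt (pi / c) ^ DIM('e) * exp (- (norm (y P))\<^sup>2 / (4 * c))) * h P)"
  proof
    fix P
    have "(LINT Z|lborel. F (Z, P)) = (LINT Z|lborel. exp (\<i> * of_real (y P \<bullet> Z)) * of_real (exp (- (c * (norm Z)\<^sup>2))) * h P)"
      by (simp add: F_def inner_commute mult_ac)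
    also have "\<dots> = (LINT Z|lborel. exp (\<i> * of_real (y P \<bullet> Z)) * of_real (exp (- (c * (norm Z)\<^sup>2)))) * h P"
      by (rule integral_mult_left_zero)
    also have "\<dots> = of_real (sqrt (pi / c) ^ DIM('e) * exp (- (norm (y P))\<^sup>2 / (4 * c))) * h P"
      by (simp only: fourier_gaussian[OF c])
    finally show "(LINT Z|lborel. F (Z, P)) = of_real (sqrt (pi / c) ^ DIM('e) * exp (- (norm (y P))\<^sup>2 / (4 * c))) * h P" .
  qed
  finally show ?thesis .
qed

text \<open>The kernel is the Fourier transform of \<open>exp (- (c * (norm Z)\<^sup>2))\<close>.
  Its mass does not depend on \<open>c\<close>, which makes bounds derived from it uniform in the
  regularisation.\<close>

lemma integral_gaussian_kernel:
  fixes c :: real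
  assumes "c > 0"
  shows "integrable lborel (\<lambda>x::'e::euclidean_space. sqrt (pi / c) ^ DIM('e) * exp (- (norm x)\<^sup>2 / (4 * c)))"
    and "(LINT x|lborel. sqrt (pi / c) ^ DIM('e) * exp (- (norm (x::'e))\<^sup>2 / (4 * c))) = (2 * pi) ^ DIM('e)"
proof -
  have eq: "- (norm x)\<^sup>2 / (4 * c) = - (1 / (4 * c) * (norm x)\<^sup>2)" for x :: 'e
    by simp
  have c: "1 / (4 * c) > 0" using assms by simp
  show "integrable lborel (\<lambda>x::'e. sqrt (pi / c) ^ DIM('e) * exp (- (norm x)\<^sup>2 / (4 * c)))"
    unfolding eq by (intro integrable_mult_right integrable_gaussian c)
  have "sqrt (pi / c) * sqrt (pi / (1 / (4 * c))) = 2 * pi"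
    using assms by (simp flip: real_sqrt_mult) (simp add: real_sqrt_mult)
  then show "(LINT x|lborel. sqrt (pi / c) ^ DIM('e) * exp (- (norm (x::'e))\<^sup>2 / (4 * c))) = (2 * pi) ^ DIM('e)"
    unfolding eq integral_mult_right_zero integral_gaussian[OF c] by (simp only: power_mult_distrib[symmetric])
qed

text \<open>By \<open>integral_gaussian_fourier\<close> the left-hand side integrates
  \<open>h\<close> against a positive kernel of mass \<open>(2 * pi) ^ DIM('e)\<close>. The bound
  persists as \<open>c\<close> tends to 0, whether or not the Fourier transform of \<open>h\<close>
  is integrable.\<close>

lemma gaussian_regularised_le:
  fixes h :: "'e::euclidean_space \<Rightarrow> complex"
  assumes c: "c > 0" and h: "integrable lborel h" and C: "\<And>x. cmod (h x) \<le> C"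
  shows "cmod (LINT Z|lborel. of_real (exp (- (c * (norm Z)\<^sup>2))) * (LINT X|lborel. exp (\<i> * of_real (Z \<bullet> X)) * h X))
    \<le> C * (2 * pi) ^ DIM('e)"
proof -
  let ?K = "\<lambda>x::'e. sqrt (pi / c) ^ DIM('e) * exp (- (norm x)\<^sup>2 / (4 * c))"
  have K0: "?K x \<ge> 0" for x using c by simp
  have "cmod (LINT X|lborel. of_real (?K X) * h X) \<le> (LINT X|lborel. C * ?K X)"
  proof (rule Bochner_Integration.integral_norm_bound_integral)
    have bound: "norm (of_real (?K x) * h x) \<le> C * ?K x" for x
      using mult_left_mono[OF C K0, of x x] K0[of x] by (simp only: norm_mult norm_of_real abs_of_nonneg mult.commute)
    show i: "integrable lborel (\<lambda>x. C * ?K x)"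
      by (intro integrable_mult_right integral_gaussian_kernel c)
    have [measurable]: "h \<in> borel_measurable borel"
      using h by (auto dest: borel_measurable_integrable)
    show "integrable lborel (\<lambda>x. of_real (?K x) * h x)"
    proof (rule Bochner_Integration.integrable_bound[OF i])
      show "AE x in lborel. norm (of_real (?K x) * h x) \<le> norm (C * ?K x)"
      proof (rule AE_I2)
        fix x show "norm (of_real (?K x) * h x) \<le> norm (C * ?K x)"
          using bound[of x] abs_ge_self[of "C * ?K x"] unfolding real_norm_def by (rule order_trans)
      qed
    qed measurable
    show "norm (of_real (?K x) * h x) \<le> C * ?K x" for x by (rule bound)
  qed
  also have "\<dots> = C * (2 * pi) ^ DIM('e)"
    by (subst integral_mult_right_zero) (simp only: integral_gaussian_kernel(2)[OF c])
  finally have le: "cmod (LINT X|lborel. of_real (?K X) * h X) \<le> C * (2 * pi) ^ DIM('e)" .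
  have eq: "(LINT Z|lborel. of_real (exp (- (c * (norm Z)\<^sup>2))) * (LINT X|lborel. exp (\<i> * of_real (Z \<bullet> X)) * h X)) =
      (LINT X|lborel. of_real (?K X) * h X)"
    by (rule integral_gaussian_fourier[OF c h, where y = "\<lambda>X. X"]) simp
  show ?thesis
    unfolding eq by (rule le)
qed

lemma borel_measurable_fst_snd [measurable]:
  "(fst :: 'e::euclidean_space \<times> 'f::euclidean_space \<Rightarrow> 'e) \<in> borel_measurable borel"
  "(snd :: 'e \<times> 'f \<Rightarrow> 'f) \<in> borel_measurable borel"
  by (intro borel_measurable_continuous_onI continuous_intros)+

text \<open>Fourier inversion on the diagonal. Integrating out \<open>Z\<close> leaves a kernel in
  \<open>fst P - snd P\<close> that concentrates at 0. The majorant \<open>a\<close> depends on the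
  second variable alone, so it still dominates after the substitution
  \<open>X = Y + r n *\<^sub>R V\<close>.\<close>

lemma gaussian_regularised_limit:
  fixes g :: "'e::euclidean_space \<times> 'e \<Rightarrow> complex" and r :: "nat \<Rightarrow> real"
  assumes g: "continuous_on UNIV g" "integrable lborel g"
    and dom: "\<And>X Y. cmod (g (X, Y)) \<le> a Y" and a: "integrable lborel a"
    and r: "\<And>n. r n > 0" "r \<longlonglongrightarrow> 0"
  shows "(\<lambda>n. LINT Z|lborel. of_real (exp (- ((r n)\<^sup>2 * (norm Z)\<^sup>2))) *
      (LINT P|lborel. exp (\<i> * of_real (Z \<bullet> (fst P - snd P))) * g P))
    \<longlonglongrightarrow> of_real ((2 * pi) ^ DIM('e)) * (LINT X|lborel. g (X, X))"
proof -
  have [measurable]: "g \<in> borel_measurable borel"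
    using g(1) by (rule borel_measurable_continuous_onI)
  have [measurable]: "(\<lambda>x. g (u x, v x)) \<in> borel_measurable M"
    if [measurable]: "u \<in> borel_measurable M" "v \<in> borel_measurable M" for u v M
    by (rule measurable_compose[of "\<lambda>x. (u x, v x)" M borel g]) (use that in \<open>simp_all add: borel_measurable_Pair\<close>)
  \<comment> \<open>Under that substitution the kernel and the volume factor together become
    \<open>p * G V\<close>, free of \<open>n\<close>. The mass of \<open>G\<close> is
    \<open>sqrt (4 * pi) ^ DIM('e)\<close>, and its product with \<open>p\<close> is
    \<open>(2 * pi) ^ DIM('e)\<close>.\<close>
  define p where "p = sqrt pi ^ DIM('e)"
  define G where "G V = exp (- (norm (V::'e))\<^sup>2 / 4)" for V
  have G: "integrable lborel G"
    using integrable_gaussian[of "1/4", where 'a = 'e] by (simp add: G_def[abs_def])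
  have [measurable]: "G \<in> borel_measurable borel"
    using G by (auto dest: borel_measurable_integrable)
  have pair: "integrable lborel (\<lambda>q. of_real (G (fst q)) * g (snd q + t *\<^sub>R fst q, snd q))" for t
  proof (rule integrable_pair_bound[OF _ G a])
    show "cmod (of_real (G (fst (V, Y))) * g (snd (V, Y) + t *\<^sub>R fst (V, Y), snd (V, Y))) \<le> G V * a Y" for V Y
      by (auto simp: norm_mult G_def intro!: mult_left_mono dom)
  qed measurable
  have main: "(LINT Z|lborel. of_real (exp (- ((r n)\<^sup>2 * (norm Z)\<^sup>2))) *
      (LINT P|lborel. exp (\<i> * of_real (Z \<bullet> (fst P - snd P))) * g P))
    = of_real p * (LINT q|lborel. of_real (G (fst q)) * g (snd q + r n *\<^sub>R fst q, snd q))" for n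
  proof -
    have r2: "(r n)\<^sup>2 > 0" using r(1)[of n] by simp
    define K where "K X = sqrt (pi / (r n)\<^sup>2) ^ DIM('e) * exp (- (norm (X::'e))\<^sup>2 / (4 * (r n)\<^sup>2))" for X
    have K_le: "\<bar>K X\<bar> \<le> sqrt (pi / (r n)\<^sup>2) ^ DIM('e)" for X
      by (simp add: K_def abs_mult mult_left_le)
    have [measurable]: "K \<in> borel_measurable borel"
      unfolding K_def by measurable
    have i: "integrable lborel (\<lambda>P. of_real (K (fst P - snd P)) * g P)"
    proof (rule Bochner_Integration.integrable_bound)
      show "integrable lborel (\<lambda>P. of_real (sqrt (pi / (r n)\<^sup>2) ^ DIM('e)) * g P)"
        by (intro integrable_mult_right g)
      show "AE P in lborel. norm (of_real (K (fst P - snd P)) * g P) \<le> norm (of_real (sqrt (pi / (r n)\<^sup>2) ^ DIM('e)) * g P)"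
      proof (rule AE_I2)
        fix P :: "'e \<times> 'e"
        have "\<bar>K (fst P - snd P)\<bar> * cmod (g P) \<le> \<bar>sqrt (pi / (r n)\<^sup>2) ^ DIM('e)\<bar> * cmod (g P)"
          using K_le[of "fst P - snd P"] by (intro mult_right_mono) auto
        then show "norm (of_real (K (fst P - snd P)) * g P) \<le> norm (of_real (sqrt (pi / (r n)\<^sup>2) ^ DIM('e)) * g P)"
          by (simp only: norm_mult norm_of_real)
      qed
    qed measurable
    have "(LINT Z|lborel. of_real (exp (- ((r n)\<^sup>2 * (norm Z)\<^sup>2))) *
      (LINT P|lborel. exp (\<i> * of_real (Z \<bullet> (fst P - snd P))) * g P)) =
      (LINT P|lborel. of_real (K (fst P - snd P)) * g P)"
      unfolding K_def by (rule integral_gaussian_fourier[OF r2 g(2)]) measurable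
    also have "\<dots> = (LINT Y|lborel. LINT X|lborel. of_real (K (X - Y)) * g (X, Y))"
      using integral_lborel_pair'[OF i] by simp
    also have "(\<lambda>Y. LINT X|lborel. of_real (K (X - Y)) * g (X, Y)) =
      (\<lambda>Y. of_real p * (LINT V|lborel. of_real (G V) * g (Y + r n *\<^sub>R V, Y)))"
    proof
      fix Y
      have "(LINT X|lborel. of_real (K (X - Y)) * g (X, Y)) = (LINT X|lborel. of_real (K X) * g (Y + X, Y))"
        using integral_lborel_translate(2)[of "\<lambda>X. of_real (K X) * g (Y + X, Y)" Y] by simp
      also have "\<dots> = (r n) ^ DIM('e) *\<^sub>R (LINT V|lborel. of_real (K (r n *\<^sub>R V)) * g (Y + r n *\<^sub>R V, Y))"
        by (rule lborel_integral_scaleR[OF r(1)]) measurable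
      also have "(\<lambda>V. of_real (K (r n *\<^sub>R V)) * g (Y + r n *\<^sub>R V, Y)) =
          (\<lambda>V. of_real (sqrt (pi / (r n)\<^sup>2) ^ DIM('e)) * (of_real (G V) * g (Y + r n *\<^sub>R V, Y)))"
        using r(1)[of n] by (auto simp: K_def G_def power_mult_distrib mult_ac)
      also have "(r n) ^ DIM('e) *\<^sub>R (LINT V|lborel. \<dots> V) =
          of_real ((r n * sqrt (pi / (r n)\<^sup>2)) ^ DIM('e)) * (LINT V|lborel. of_real (G V) * g (Y + r n *\<^sub>R V, Y))"
        unfolding integral_mult_right_zero by (simp add: scaleR_conv_of_real power_mult_distrib)
      also have "r n * sqrt (pi / (r n)\<^sup>2) = sqrt pi"
        using r(1)[of n] by (simp add: real_sqrt_divide)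
      finally show "(LINT X|lborel. of_real (K (X - Y)) * g (X, Y)) =
        of_real p * (LINT V|lborel. of_real (G V) * g (Y + r n *\<^sub>R V, Y))"
        by (simp add: p_def)
    qed
    also have "(LINT Y|lborel. of_real p * (LINT V|lborel. of_real (G V) * g (Y + r n *\<^sub>R V, Y))) =
       of_real p * (LINT q|lborel. of_real (G (fst q)) * g (snd q + r n *\<^sub>R fst q, snd q))"
      using integral_lborel_pair'[OF pair, of "r n"] by simp
    finally show ?thesis .
  qed
  have lim: "(\<lambda>n. LINT q|lborel. of_real (G (fst q)) * g (snd q + r n *\<^sub>R fst q, snd q))
    \<longlonglongrightarrow> (LINT q|lborel. of_real (G (fst q)) * g (snd q, snd q))"
  proof (rule integral_dominated_convergence[where w = "\<lambda>q. G (fst q) * a (snd q)"])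
    show "integrable lborel (\<lambda>q. G (fst q) * a (snd q))"
      using integrable_pair_mult[OF G a] by (simp add: lborel_prod case_prod_unfold)
    show "AE q in lborel. (\<lambda>n. of_real (G (fst q)) * g (snd q + r n *\<^sub>R fst q, snd q))
        \<longlonglongrightarrow> of_real (G (fst q)) * g (snd q, snd q)"
    proof (rule AE_I2)
      fix q :: "'e \<times> 'e"
      have "(\<lambda>n. (snd q + r n *\<^sub>R fst q, snd q)) \<longlonglongrightarrow> (snd q + 0 *\<^sub>R fst q, snd q)"
        by (intro tendsto_intros r)
      then have "(\<lambda>n. g (snd q + r n *\<^sub>R fst q, snd q)) \<longlonglongrightarrow> g (snd q, snd q)"
        using continuous_on_tendsto_compose[OF g(1)] by simp
      then show "(\<lambda>n. of_real (G (fst q)) * g (snd q + r n *\<^sub>R fst q, snd q))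
        \<longlonglongrightarrow> of_real (G (fst q)) * g (snd q, snd q)"
        by (intro tendsto_intros)
    qed
    show "AE q in lborel. norm (of_real (G (fst q)) * g (snd q + r n *\<^sub>R fst q, snd q)) \<le> G (fst q) * a (snd q)" for n
      by (intro AE_I2) (auto simp: norm_mult G_def intro!: mult_left_mono dom)
  qed measurable
  have eq: "(LINT q|lborel. of_real (G (fst q)) * g (snd q, snd q)) =
      of_real (sqrt (4 * pi) ^ DIM('e)) * (LINT X|lborel. g (X, X))"
  proof -
    have "(LINT q|lborel. of_real (G (fst q)) * g (snd q, snd q)) =
      (LINT V|lborel. LINT Y|lborel. of_real (G V) * g (Y, Y))"
      using integral_lborel_pair[OF pair[of 0]] by simp
    also have "\<dots> = (LINT V|lborel. complex_of_real (G V)) * (LINT Y|lborel. g (Y, Y))"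
      by simp
    also have "(LINT V|lborel. complex_of_real (G V)) = of_real (sqrt (4 * pi) ^ DIM('e))"
      using integral_gaussian[of "1/4", where 'e = 'e] unfolding integral_complex_of_real by (simp add: G_def mult.commute)
    finally show ?thesis .
  qed
  have eq': "of_real p * (of_real (sqrt (4 * pi) ^ DIM('e)) * x) = of_real ((2 * pi) ^ DIM('e)) * x" for x :: complex
  proof -
    have "p * sqrt (4 * pi) ^ DIM('e) = (2 * pi) ^ DIM('e)"
    proof -
      have "sqrt pi * sqrt (4 * pi) = 2 * pi"
        by (simp add: real_sqrt_mult)
      then show ?thesis
        by (simp only: p_def power_mult_distrib[symmetric])
    qed
    then show ?thesis by (simp only: mult.assoc[symmetric] of_real_mult[symmetric])
  qed
  show ?thesis
    using tendsto_mult_left[OF lim, of "of_real p"] unfolding main eq eq' .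
qed

section \<open>Coherent states\<close>

lemma
  fixes f :: "'a::euclidean_space \<Rightarrow> 'b::{banach, second_countable_topology}"
  assumes [measurable]: "f \<in> borel_measurable borel"
  shows integrable_lborel_reflect: "integrable lborel (\<lambda>x. f (y - x)) \<longleftrightarrow> integrable lborel f"
    and integral_lborel_reflect: "(LINT x|lborel. f (y - x)) = (LINT x|lborel. f x)"
proof -
  have eq: "distr lborel borel (\<lambda>x. y - x) = (lborel :: 'a measure)"
    using lborel_affine[of "-1" y] by (simp add: density_1 one_ennreal_def[symmetric])
  show "integrable lborel (\<lambda>x. f (y - x)) \<longleftrightarrow> integrable lborel f"
    using integrable_distr_eq[of "\<lambda>x. y - x" lborel borel f] by (simp add: eq)
  show "(LINT x|lborel. f (y - x)) = (LINT x|lborel. f x)"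
    using integral_distr[of "\<lambda>x. y - x" lborel borel f] by (simp add: eq)
qed

definition gauss_fun :: "real \<Rightarrow> 'a::euclidean_space \<Rightarrow> complex" where
  "gauss_fun s y = of_real (exp (- (1 / (2 * s) * (norm y)\<^sup>2)))"

definition gauss_L2 :: "real \<Rightarrow> 'a::euclidean_space L2" where
  "gauss_L2 s = abs_L2 (gauss_fun s)"

text \<open>The ambiguity function of the Gaussian \<open>g = gauss_L2 s\<close>, that is
  \<open><W(X) g, g>\<close> divided by the squared norm of \<open>g\<close>, so that it equals 1 at
  the origin.\<close>

definition ambiguity :: "real \<Rightarrow> 'a::euclidean_space \<times> 'a \<Rightarrow> real" where
  "ambiguity s X = exp (- (1 / (4 * s) * (norm (fst X))\<^sup>2)) * exp (- (s / 4 * (norm (snd X))\<^sup>2))"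

lemma square_integrable_gauss_fun:
  assumes "s > 0" shows "square_integrable (gauss_fun s :: 'a::euclidean_space \<Rightarrow> complex)"
proof -
  have "(cmod (gauss_fun s y))\<^sup>2 = exp (- (1 / s * (norm y)\<^sup>2))" for y :: 'a
    by (simp add: gauss_fun_def power2_eq_square flip: exp_add)
  moreover have "gauss_fun s \<in> borel_measurable borel"
    unfolding gauss_fun_def[abs_def] by measurable
  ultimately show ?thesis
    using integrable_gaussian[of "1 / s", where 'a = 'a] assms by (simp add: square_integrable_def)
qed

lemma ambiguity_pos: "ambiguity s X > 0"
  by (simp add: ambiguity_def)

lemma ambiguity_le_1:
  assumes "s > 0" shows "ambiguity s X \<le> 1"
  unfolding ambiguity_def by (rule mult_le_one) (use assms in auto)

lemma continuous_on_ambiguity: "continuous_on S (ambiguity s)"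
  unfolding ambiguity_def by (intro continuous_intros)

lemma integrable_ambiguity:
  assumes "s > 0" shows "integrable lborel (ambiguity s :: 'a::euclidean_space \<times> 'a \<Rightarrow> real)"
  using integrable_pair_mult[OF integrable_gaussian[of "1 / (4 * s)", where 'a = 'a]
      integrable_gaussian[of "s / 4", where 'a = 'a]] assms
  by (simp add: lborel_prod case_prod_unfold ambiguity_def[abs_def])

text \<open>The decay rates \<open>1 / (4 * s)\<close> and \<open>s / 4\<close> trade places when
  \<open>s\<close> becomes \<open>1 / s\<close>. Their sums therefore agree in both variables, and
  the product depends on \<open>norm X\<close> alone.\<close>

lemma ambiguity_mult:
  assumes "s > 0"
  shows "ambiguity s X * ambiguity (1 / s) X = exp (- ((s + 1 / s) / 4 * (norm X)\<^sup>2))"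
proof -
  have "(norm X)\<^sup>2 = (norm (fst X))\<^sup>2 + (norm (snd X))\<^sup>2"
    by (simp add: norm_prod_def)
  then show ?thesis
    using assms unfolding ambiguity_def by (simp add: field_simps flip: exp_add)
qed

lemma continuous_on_cinner_L2 [continuous_intros]:
  "continuous_on S f \<Longrightarrow> continuous_on S g \<Longrightarrow> continuous_on S (\<lambda>x. cinner_L2 (f x) (g x))"
  by (rule bounded_bilinear.continuous_on[OF bounded_bilinear_cinner_L2])

lemma continuous_on_weyl_unitary_comp [continuous_intros]:
  "continuous_on S f \<Longrightarrow> continuous_on S (\<lambda>x. weyl_unitary (f x) u)"
  using continuous_on_compose2[OF continuous_on_weyl_unitary] by blast

lemma integrable_ambiguity_cinner:
  assumes "s > 0"
  shows "integrable lborel (\<lambda>X. of_real (ambiguity s X) * cinner_L2 (weyl_unitary X u) v)"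
proof (rule Bochner_Integration.integrable_bound)
  show "integrable lborel (\<lambda>X::'a\<times>'a. norm u * norm v * ambiguity s X)"
    by (intro integrable_mult_right integrable_ambiguity assms)
  have "continuous_on UNIV (\<lambda>X. of_real (ambiguity s X) * cinner_L2 (weyl_unitary X u) v)"
    by (intro continuous_intros continuous_on_ambiguity)
  then show "(\<lambda>X. of_real (ambiguity s X) * cinner_L2 (weyl_unitary X u) v) \<in> borel_measurable lborel"
    by (simp add: borel_measurable_continuous_onI)
  show "AE X in lborel. norm (of_real (ambiguity s X) * cinner_L2 (weyl_unitary X u) v) \<le> norm (norm u * norm v * ambiguity s X)"
    using cmod_cinner_L2_le[of "weyl_unitary _ u" v] ambiguity_pos[of s]
    by (intro AE_I2) (auto simp: norm_mult abs_mult mult.commute intro!: mult_left_mono)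
qed

text \<open>The exponents combine by the parallelogram law:
  \<open>\<parallel>x\<parallel>\<^sup>2 / 4 + \<parallel>y - x / 2\<parallel>\<^sup>2 = (\<parallel>y\<parallel>\<^sup>2 + \<parallel>y - x\<parallel>\<^sup>2) / 2\<close>.\<close>

lemma integral_ambiguity_cinner:
  fixes u v :: "'a::euclidean_space L2"
  assumes s: "s > 0"
  shows "(LINT X|lborel. of_real (ambiguity s X) * cinner_L2 (weyl_unitary X u) v) =
    of_real (sqrt (4 * pi / s) ^ DIM('a)) * cinner_L2 u (gauss_L2 s) * cinner_L2 (gauss_L2 s) v"
proof -
  obtain f where f: "square_integrable f" and u: "u = abs_L2 f"
    by (rule L2_obtain_rep)
  obtain g where g: "square_integrable g" and v: "v = abs_L2 g"
    by (rule L2_obtain_rep)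
  note gs = square_integrable_gauss_fun[OF s]
  have [measurable]: "f \<in> borel_measurable borel" "g \<in> borel_measurable borel"
    "gauss_fun s \<in> borel_measurable (borel :: 'a measure)"
    using f g gs by (auto intro: square_integrable_measurable)
  have cnj_meas [measurable]: "(\<lambda>y. cnj (g y)) \<in> borel_measurable borel"
    by (rule borel_measurable_continuous_on[where f = cnj and g = g]) (auto intro!: continuous_intros)
  define C where "C = sqrt (4 * pi / s) ^ DIM('a)"
  \<comment> \<open>The integrands of the two inner products on the right-hand side. The momentum
    integral leaves \<open>p (y - x) * q y\<close>, and integrating over \<open>x\<close> and then
    \<open>y\<close> separates the factors.\<close>
  define p where "p y = f y * cnj (gauss_fun s y)" for y
  define q where "q y = gauss_fun s y * cnj (g y)" for y
  have p: "integrable lborel p" and q: "integrable lborel q"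
    unfolding p_def q_def by (intro square_integrable_prod f g gs)+
  have [measurable]: "p \<in> borel_measurable borel" "q \<in> borel_measurable borel"
    using p q by (auto dest: borel_measurable_integrable)
  have inner: "(LINT \<eta>|lborel. of_real (ambiguity s (x, \<eta>)) * cinner_L2 (weyl_unitary (x, \<eta>) u) v) =
      of_real C * (LINT y|lborel. p (y - x) * q y)" for x
  proof -
    have fx: "square_integrable (\<lambda>y. f (y - x))"
      using f integral_lborel_translate(1)[of "\<lambda>y. (cmod (f y))\<^sup>2" x]
      by (simp add: square_integrable_def)
    define h where "h y = f (y - x) * cnj (g y)" for y
    have h: "integrable lborel h"
      unfolding h_def by (rule square_integrable_prod[OF fx g])
    have "cinner_L2 (weyl_unitary (x, \<eta>) u) v = (LINT y|lborel. exp (\<i> * of_real (\<eta> \<bullet> (y - x /\<^sub>R 2))) * h y)" for \<eta>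
      using square_integrable_weyl_unitary[OF f, of "(x, \<eta>)"] g
      by (simp add: u v weyl_unitary_abs_L2 f cinner_abs_L2 unitary_phase_def h_def mult.assoc)
    then have "(LINT \<eta>|lborel. of_real (ambiguity s (x, \<eta>)) * cinner_L2 (weyl_unitary (x, \<eta>) u) v) =
      (LINT \<eta>|lborel. of_real (exp (- (1 / (4 * s) * (norm x)\<^sup>2))) * (of_real (exp (- (s / 4 * (norm \<eta>)\<^sup>2))) *
        (LINT y|lborel. exp (\<i> * of_real (\<eta> \<bullet> (y - x /\<^sub>R 2))) * h y)))"
      by (simp add: ambiguity_def mult.assoc)
    also have "\<dots> = of_real (exp (- (1 / (4 * s) * (norm x)\<^sup>2))) * (LINT \<eta>|lborel. of_real (exp (- (s / 4 * (norm \<eta>)\<^sup>2))) *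
        (LINT y|lborel. exp (\<i> * of_real (\<eta> \<bullet> (y - x /\<^sub>R 2))) * h y))"
      by (rule integral_mult_right_zero)
    \<comment> \<open>Integrating out the momentum replaces the oscillating phase by a Gaussian in
      \<open>y - x /\<^sub>R 2\<close>.\<close>
    also have "(LINT \<eta>|lborel. of_real (exp (- (s / 4 * (norm \<eta>)\<^sup>2))) *
        (LINT y|lborel. exp (\<i> * of_real (\<eta> \<bullet> (y - x /\<^sub>R 2))) * h y)) =
      (LINT y|lborel. of_real (sqrt (pi / (s / 4)) ^ DIM('a) * exp (- (norm (y - x /\<^sub>R 2))\<^sup>2 / (4 * (s / 4)))) * h y)"
      by (rule integral_gaussian_fourier[OF _ h]) (use s in simp_all)
    also have "of_real (exp (- (1 / (4 * s) * (norm x)\<^sup>2))) * \<dots> =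
      (LINT y|lborel. of_real (exp (- (1 / (4 * s) * (norm x)\<^sup>2))) * (of_real (sqrt (pi / (s / 4)) ^ DIM('a) * exp (- (norm (y - x /\<^sub>R 2))\<^sup>2 / (4 * (s / 4)))) * h y))"
      by (rule integral_mult_right_zero[symmetric])
    also have "(\<lambda>y. of_real (exp (- (1 / (4 * s) * (norm x)\<^sup>2))) * (of_real (sqrt (pi / (s / 4)) ^ DIM('a) * exp (- (norm (y - x /\<^sub>R 2))\<^sup>2 / (4 * (s / 4)))) * h y)) =
      (\<lambda>y. of_real C * (p (y - x) * q y))"
    proof
      fix y
      have parallelogram: "(norm x)\<^sup>2 / 4 + (norm (y - x /\<^sub>R 2))\<^sup>2 = (norm (y - x))\<^sup>2 / 2 + (norm y)\<^sup>2 / 2"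
        by (simp add: power2_norm_eq_inner inner_diff_left inner_diff_right inner_commute field_simps)
      have "- (1 / (4 * s) * (norm x)\<^sup>2) + - (norm (y - x /\<^sub>R 2))\<^sup>2 / (4 * (s / 4)) =
        - (1 / s * ((norm x)\<^sup>2 / 4 + (norm (y - x /\<^sub>R 2))\<^sup>2))"
        using s by (simp add: field_simps)
      also have "\<dots> = - (1 / (2 * s) * (norm (y - x))\<^sup>2) + - (1 / (2 * s) * (norm y)\<^sup>2)"
        unfolding parallelogram using s by (simp add: field_simps)
      finally have "exp (- (1 / (4 * s) * (norm x)\<^sup>2)) * exp (- (norm (y - x /\<^sub>R 2))\<^sup>2 / (4 * (s / 4))) =
        exp (- (1 / (2 * s) * (norm (y - x))\<^sup>2)) * exp (- (1 / (2 * s) * (norm y)\<^sup>2))"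
        by (simp only: exp_add[symmetric])
      then have E: "complex_of_real (exp (- (1 / (4 * s) * (norm x)\<^sup>2))) * of_real (exp (- (norm (y - x /\<^sub>R 2))\<^sup>2 / (4 * (s / 4)))) =
        of_real (exp (- (1 / (2 * s) * (norm (y - x))\<^sup>2))) * of_real (exp (- (1 / (2 * s) * (norm y)\<^sup>2)))"
        by (simp only: of_real_mult[symmetric])
      have "sqrt (pi / (s / 4)) ^ DIM('a) = C"
        by (simp add: C_def mult.commute)
      then have "of_real (exp (- (1 / (4 * s) * (norm x)\<^sup>2))) * (of_real (sqrt (pi / (s / 4)) ^ DIM('a) * exp (- (norm (y - x /\<^sub>R 2))\<^sup>2 / (4 * (s / 4)))) * h y) =
        of_real C * ((of_real (exp (- (1 / (4 * s) * (norm x)\<^sup>2))) * of_real (exp (- (norm (y - x /\<^sub>R 2))\<^sup>2 / (4 * (s / 4))))) * h y)"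
        by (simp only: of_real_mult mult_ac)
      also have "\<dots> = of_real C * (p (y - x) * q y)"
        unfolding E p_def q_def h_def gauss_fun_def complex_cnj_complex_of_real by (simp only: mult_ac)
      finally show "of_real (exp (- (1 / (4 * s) * (norm x)\<^sup>2))) * (of_real (sqrt (pi / (s / 4)) ^ DIM('a) * exp (- (norm (y - x /\<^sub>R 2))\<^sup>2 / (4 * (s / 4)))) * h y) =
        of_real C * (p (y - x) * q y)" .
    qed
    also have "(LINT y|lborel. of_real C * (p (y - x) * q y)) = of_real C * (LINT y|lborel. p (y - x) * q y)"
      by (rule integral_mult_right_zero)
    finally show ?thesis .
  qed
  \<comment> \<open>Absolute integrability as for a convolution: for fixed \<open>y\<close>, the
    modulus integrates over \<open>x\<close> to the L1 norm of \<open>p\<close> times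
    \<open>norm (q y)\<close>.\<close>
  have pq: "integrable lborel (\<lambda>(y, x). p (y - x) * q y)"
    unfolding lborel_prod[symmetric]
  proof (rule lborel_pair.Fubini_integrable)
    show "(\<lambda>(y, x). p (y - x) * q y) \<in> borel_measurable (lborel \<Otimes>\<^sub>M lborel)"
      by measurable
    have "(LINT x|lborel. norm (case (y, x) of (y, x) \<Rightarrow> p (y - x) * q y)) = (LINT x|lborel. norm (p x)) * norm (q y)" for y
      using integral_lborel_reflect[of "\<lambda>x. norm (p x)" y] by (simp add: norm_mult)
    then show "integrable lborel (\<lambda>y. LINT x|lborel. norm (case (y, x) of (y, x) \<Rightarrow> p (y - x) * q y))"
      using integrable_norm[OF q] by simp
    show "AE y in lborel. integrable lborel (\<lambda>x. case (y, x) of (y, x) \<Rightarrow> p (y - x) * q y)"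
      using p by (simp add: integrable_lborel_reflect)
  qed
  have "(LINT X|lborel. of_real (ambiguity s X) * cinner_L2 (weyl_unitary X u) v) =
      (LINT x|lborel. LINT \<eta>|lborel. of_real (ambiguity s (x, \<eta>)) * cinner_L2 (weyl_unitary (x, \<eta>) u) v)"
    by (rule integral_lborel_pair[OF integrable_ambiguity_cinner[OF s]])
  also have "\<dots> = of_real C * (LINT x|lborel. LINT y|lborel. p (y - x) * q y)"
    unfolding inner by (rule integral_mult_right_zero)
  also have "(LINT x|lborel. LINT y|lborel. p (y - x) * q y) = (LINT y|lborel. LINT x|lborel. p (y - x) * q y)"
    using integral_lborel_pair[OF pq] integral_lborel_pair'[OF pq] by simp
  also have "\<dots> = (LINT y|lborel. (LINT x|lborel. p x) * q y)"
    by (simp add: integral_lborel_reflect)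
  also have "\<dots> = (LINT x|lborel. p x) * (LINT y|lborel. q y)"
    by (rule integral_mult_right_zero)
  also have "(LINT x|lborel. p x) = cinner_L2 u (gauss_L2 s)"
    by (simp add: u gauss_L2_def cinner_abs_L2 f gs p_def)
  also have "(LINT x|lborel. q x) = cinner_L2 (gauss_L2 s) v"
    by (simp add: v gauss_L2_def cinner_abs_L2 g gs q_def)
  finally show ?thesis by (simp add: C_def mult.assoc)
qed

text \<open>Chosen so that conjugation by \<open>W (symplectic_rot Z)\<close> multiplies \<open>W(X)\<close> by
  \<open>exp (i Z \<bullet> X)\<close>.\<close>

definition symplectic_rot :: "'a::euclidean_space \<times> 'a \<Rightarrow> 'a \<times> 'a" where
  "symplectic_rot Z = (- snd Z, fst Z)"

lemma norm_symplectic_rot [simp]: "norm (symplectic_rot Z) = norm Z"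
  by (simp add: symplectic_rot_def norm_prod_def add.commute)

lemma continuous_on_symplectic_rot [continuous_intros]:
  "continuous_on S f \<Longrightarrow> continuous_on S (\<lambda>x. symplectic_rot (f x))"
  unfolding symplectic_rot_def by (intro continuous_intros)

definition coherent :: "real \<Rightarrow> 'a::euclidean_space \<times> 'a \<Rightarrow> 'a L2" where
  "coherent s Z = weyl_unitary (symplectic_rot Z) (gauss_L2 s)"

lemma norm_coherent [simp]:
  fixes Z :: "'a::euclidean_space \<times> 'a"
  shows "norm (coherent s Z) = norm (gauss_L2 s :: 'a L2)"
  by (simp add: coherent_def)

lemma continuous_on_coherent [continuous_intros]:
  "continuous_on S f \<Longrightarrow> continuous_on S (\<lambda>x. coherent s (f x))"
  unfolding coherent_def by (intro continuous_intros)

text \<open>The constant produced by \<open>integral_ambiguity_cinner\<close>. The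
  \<open>itself\<close> argument fixes the type whose dimension enters, since the real argument does
  not determine it.\<close>

definition coherent_const :: "'a::euclidean_space itself \<Rightarrow> real \<Rightarrow> real" where
  "coherent_const _ s = sqrt (4 * pi / s) ^ DIM('a)"

lemma coherent_const_pos: "s > 0 \<Longrightarrow> coherent_const TYPE('a::euclidean_space) s > 0"
  by (simp add: coherent_const_def)

text \<open>Conjugation by a Weyl operator absorbs the Fourier character, so this is
  \<open>integral_ambiguity_cinner\<close> for translated vectors. In operator terms, the Fourier
  transform of the weighted Weyl operators is a multiple of the projection onto a coherent
  state.\<close>

lemma integral_coherent:
  fixes u w :: "'a::euclidean_space L2"
  assumes s: "s > 0"
  shows "(LINT X|lborel. exp (\<i> * of_real (Z \<bullet> X)) * (of_real (ambiguity s X) * cinner_L2 (weyl_unitary X u) w)) =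
    of_real (coherent_const TYPE('a) s) * cinner_L2 u (coherent s Z) * cinner_L2 (coherent s Z) w"
proof -
  have "cinner_L2 (weyl_unitary X (weyl_unitary (- symplectic_rot Z) u)) (weyl_unitary (- symplectic_rot Z) w) = exp (\<i> * of_real (Z \<bullet> X)) * cinner_L2 (weyl_unitary X u) w" for X
  proof -
    have "cinner_L2 (weyl_unitary X (weyl_unitary (- symplectic_rot Z) u)) (weyl_unitary (- symplectic_rot Z) w) = cinner_L2 (weyl_unitary (symplectic_rot Z) (weyl_unitary X (weyl_unitary (- symplectic_rot Z) u))) w"
      by (simp add: cinner_weyl_unitary)
    also have "weyl_unitary (symplectic_rot Z) (weyl_unitary X (weyl_unitary (- symplectic_rot Z) u)) =
        scaleC_L2 (exp (\<i> * of_real (snd (symplectic_rot Z) \<bullet> fst X - fst (symplectic_rot Z) \<bullet> snd X))) (weyl_unitary X u)"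
      by (subst weyl_unitary_weyl_unitary) (simp only: weyl_unitary_weyl_unitary_uminus)
    also have "snd (symplectic_rot Z) \<bullet> fst X - fst (symplectic_rot Z) \<bullet> snd X = Z \<bullet> X"
      by (simp add: symplectic_rot_def inner_prod_def)
    finally show ?thesis by (simp add: cinner_L2_scaleC_left)
  qed
  then have "(LINT X|lborel. exp (\<i> * of_real (Z \<bullet> X)) * (of_real (ambiguity s X) * cinner_L2 (weyl_unitary X u) w)) =
    (LINT X|lborel. of_real (ambiguity s X) * cinner_L2 (weyl_unitary X (weyl_unitary (- symplectic_rot Z) u)) (weyl_unitary (- symplectic_rot Z) w))"
    by (simp add: mult_ac)
  also have "\<dots> = of_real (coherent_const TYPE('a) s) * cinner_L2 (weyl_unitary (- symplectic_rot Z) u) (gauss_L2 s) * cinner_L2 (gauss_L2 s) (weyl_unitary (- symplectic_rot Z) w)"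
    unfolding coherent_const_def by (rule integral_ambiguity_cinner[OF s])
  also have "cinner_L2 (weyl_unitary (- symplectic_rot Z) u) (gauss_L2 s) = cinner_L2 u (coherent s Z)"
    by (simp add: cinner_weyl_unitary coherent_def)
  also have "cinner_L2 (gauss_L2 s) (weyl_unitary (- symplectic_rot Z) w) = cinner_L2 (coherent s Z) w"
    by (simp add: cinner_weyl_unitary coherent_def)
  finally show ?thesis .
qed

lemma cinner_mult_commute: "cinner_L2 u w * cinner_L2 w u = of_real ((cmod (cinner_L2 u w))\<^sup>2)"
  by (metis cnj_cinner_L2 complex_norm_square)

text \<open>For \<open>w = u\<close>, \<open>integral_coherent\<close> exhibits the squared
  coefficients as the Fourier transform of a function bounded by \<open>(norm u)\<^sup>2\<close>, so
  \<open>gaussian_regularised_le\<close> applies. It is one half of the resolution of the identity,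
  in a damped form with a bound free of \<open>c\<close>.\<close>

lemma coherent_bessel:
  fixes u :: "'a::euclidean_space L2"
  assumes s: "s > 0" and c: "c > 0"
  shows "integrable lborel (\<lambda>Z. exp (- (c * (norm Z)\<^sup>2)) * (cmod (cinner_L2 u (coherent s Z)))\<^sup>2)"
    and "coherent_const TYPE('a) s * (LINT Z|lborel. exp (- (c * (norm Z)\<^sup>2)) * (cmod (cinner_L2 u (coherent s Z)))\<^sup>2)
      \<le> (norm u)\<^sup>2 * (2 * pi) ^ DIM('a \<times> 'a)"
proof -
  let ?k = "\<lambda>Z::'a \<times> 'a. exp (- (c * (norm Z)\<^sup>2))"
  show "integrable lborel (\<lambda>Z. ?k Z * (cmod (cinner_L2 u (coherent s Z)))\<^sup>2)"
  proof (rule Bochner_Integration.integrable_bound)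
    show "integrable lborel (\<lambda>Z. (norm u * norm (gauss_L2 s :: 'a L2))\<^sup>2 * ?k Z)"
      by (intro integrable_mult_right integrable_gaussian c)
    have "continuous_on UNIV (\<lambda>Z. ?k Z * (cmod (cinner_L2 u (coherent s Z)))\<^sup>2)"
      by (intro continuous_intros)
    then show "(\<lambda>Z. ?k Z * (cmod (cinner_L2 u (coherent s Z)))\<^sup>2) \<in> borel_measurable lborel"
      by (simp add: borel_measurable_continuous_onI)
    show "AE Z in lborel. norm (?k Z * (cmod (cinner_L2 u (coherent s Z)))\<^sup>2) \<le> norm ((norm u * norm (gauss_L2 s :: 'a L2))\<^sup>2 * ?k Z)"
    proof (rule AE_I2)
      fix Z :: "'a \<times> 'a"
      have "(cmod (cinner_L2 u (coherent s Z)))\<^sup>2 \<le> (norm u * norm (gauss_L2 s :: 'a L2))\<^sup>2"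
        using cmod_cinner_L2_le[of u "coherent s Z"] by (intro power_mono) simp_all
      then show "norm (?k Z * (cmod (cinner_L2 u (coherent s Z)))\<^sup>2) \<le> norm ((norm u * norm (gauss_L2 s :: 'a L2))\<^sup>2 * ?k Z)"
        by (simp add: abs_mult mult.commute mult_left_mono)
    qed
  qed
  have h: "cmod (of_real (ambiguity s X) * cinner_L2 (weyl_unitary X u) u) \<le> (norm u)\<^sup>2" for X
  proof -
    have "cmod (of_real (ambiguity s X) * cinner_L2 (weyl_unitary X u) u) \<le> 1 * (norm u * norm u)"
      unfolding norm_mult using cmod_cinner_L2_le[of "weyl_unitary X u" u] ambiguity_pos[of s X] ambiguity_le_1[OF s, of X]
      by (intro mult_mono) auto
    then show ?thesis by (simp add: power2_eq_square)
  qed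
  have "cmod (LINT Z|lborel. of_real (?k Z) * (LINT X|lborel. exp (\<i> * of_real (Z \<bullet> X)) * (of_real (ambiguity s X) * cinner_L2 (weyl_unitary X u) u)))
    \<le> (norm u)\<^sup>2 * (2 * pi) ^ DIM('a \<times> 'a)"
    by (rule gaussian_regularised_le[OF c integrable_ambiguity_cinner[OF s] h])
  also have "(LINT Z|lborel. of_real (?k Z) * (LINT X|lborel. exp (\<i> * of_real (Z \<bullet> X)) * (of_real (ambiguity s X) * cinner_L2 (weyl_unitary X u) u))) =
    (LINT Z|lborel. complex_of_real (coherent_const TYPE('a) s * (?k Z * (cmod (cinner_L2 u (coherent s Z)))\<^sup>2)))"
    unfolding integral_coherent[OF s] mult.assoc cinner_mult_commute by (simp add: mult_ac)
  also have "\<dots> = of_real (coherent_const TYPE('a) s * (LINT Z|lborel. ?k Z * (cmod (cinner_L2 u (coherent s Z)))\<^sup>2))"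
    unfolding integral_complex_of_real by simp
  finally show "coherent_const TYPE('a) s * (LINT Z|lborel. ?k Z * (cmod (cinner_L2 u (coherent s Z)))\<^sup>2)
      \<le> (norm u)\<^sup>2 * (2 * pi) ^ DIM('a \<times> 'a)"
    unfolding norm_of_real by (rule order_trans[OF abs_ge_self])
qed

section \<open>Compactness from decay at infinity\<close>

text \<open>The operator \<open>|psi_Z><phi_Z|\<close> weighted by the symbol
  \<open><S phi_Z, psi_Z>\<close>, paired with \<open>u\<close> and \<open>v\<close>.\<close>

definition coherent_form :: "real \<Rightarrow> ('a::euclidean_space L2 \<Rightarrow>\<^sub>L 'a L2) \<Rightarrow> 'a L2 \<Rightarrow> 'a L2 \<Rightarrow> 'a \<times> 'a \<Rightarrow> complex" where
  "coherent_form s S u v Z = cinner_L2 u (coherent s Z) *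
     cinner_L2 (blinfun_apply S (coherent s Z)) (coherent (1 / s) Z) * cinner_L2 (coherent (1 / s) Z) v"

text \<open>The link between the two sides of the inversion: its Fourier transform in the difference
  of the two points is a multiple of \<open>coherent_form\<close>, and on the diagonal it is the
  Gaussian weight times a matrix element of a translate of \<open>S\<close>.\<close>

definition weyl_form :: "real \<Rightarrow> ('a::euclidean_space L2 \<Rightarrow>\<^sub>L 'a L2) \<Rightarrow> 'a L2 \<Rightarrow> 'a L2 \<Rightarrow> ('a \<times> 'a) \<times> ('a \<times> 'a) \<Rightarrow> complex" where
  "weyl_form s S u v P = of_real (ambiguity s (fst P) * ambiguity (1 / s) (snd P)) *
     cinner_L2 (blinfun_apply S (weyl_unitary (fst P) u)) (weyl_unitary (snd P) v)"

lemma continuous_on_blinfun_apply [continuous_intros]: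
  "continuous_on A f \<Longrightarrow> continuous_on A (\<lambda>x. blinfun_apply S (f x))"
  by (rule blinfun.continuous_on[OF continuous_on_const])

lemma continuous_on_weyl_form: "continuous_on UNIV (weyl_form s S u v)"
  unfolding weyl_form_def
  by (intro continuous_intros continuous_on_compose2[OF continuous_on_ambiguity[of UNIV]]) auto

lemma cmod_weyl_form_le:
  assumes s: "s > 0"
  shows "cmod (weyl_form s S u v (X, Y)) \<le> ambiguity s X * (norm S * norm u * norm v * ambiguity (1 / s) Y)"
proof -
  have "cmod (cinner_L2 (blinfun_apply S (weyl_unitary X u)) (weyl_unitary Y v)) \<le> norm (blinfun_apply S (weyl_unitary X u)) * norm (weyl_unitary Y v)"
    by (rule cmod_cinner_L2_le)
  also have "\<dots> \<le> (norm S * norm (weyl_unitary X u)) * norm (weyl_unitary Y v)"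
    by (intro mult_right_mono norm_blinfun) simp
  finally have "(ambiguity s X * ambiguity (1 / s) Y) * cmod (cinner_L2 (blinfun_apply S (weyl_unitary X u)) (weyl_unitary Y v)) \<le>
      (ambiguity s X * ambiguity (1 / s) Y) * (norm S * norm u * norm v)"
    using ambiguity_pos[of s X] ambiguity_pos[of "1/s" Y] by (intro mult_left_mono) simp_all
  then show ?thesis
    using ambiguity_pos[of s X] ambiguity_pos[of "1/s" Y]
    by (simp add: weyl_form_def norm_mult mult_ac)
qed

lemma integrable_weyl_form:
  fixes S :: "'a::euclidean_space L2 \<Rightarrow>\<^sub>L 'a L2"
  assumes s: "s > 0"
  shows "integrable lborel (weyl_form s S u v)"
proof (rule integrable_pair_bound[OF _ integrable_ambiguity[OF s]])
  show "weyl_form s S u v \<in> borel_measurable borel"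
    by (rule borel_measurable_continuous_onI[OF continuous_on_weyl_form])
  show "integrable lborel (\<lambda>Y::'a\<times>'a. norm S * norm u * norm v * ambiguity (1 / s) Y)"
    using s by (intro integrable_mult_right integrable_ambiguity) simp
qed (rule cmod_weyl_form_le[OF s])

text \<open>The exponential splits into a character of each point. For fixed \<open>Y\<close> the
  \<open>X\<close>-integral is \<open>integral_coherent\<close> with \<open>S\<close> moved to the
  other slot as its adjoint; the remaining \<open>Y\<close>-integral is the conjugate of the
  instance for \<open>1 / s\<close>.\<close>

lemma integral_weyl_form:
  fixes S :: "'a::euclidean_space L2 \<Rightarrow>\<^sub>L 'a L2"
  assumes s: "s > 0" and S: "S \<in> bounded_operators"
  shows "(LINT P|lborel. exp (\<i> * of_real (Z \<bullet> (fst P - snd P))) * weyl_form s S u v P) =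
    of_real (coherent_const TYPE('a) s * coherent_const TYPE('a) (1 / s)) * coherent_form s S u v Z"
proof -
  have s': "1 / s > 0" using s by simp
  define F where "F P = exp (\<i> * of_real (Z \<bullet> (fst P - snd P))) * weyl_form s S u v P" for P
  have i: "integrable lborel F"
  proof (rule Bochner_Integration.integrable_bound[OF integrable_weyl_form[OF s, of S u v]])
    have "continuous_on UNIV F"
      unfolding F_def by (intro continuous_intros continuous_on_compose2[OF continuous_on_weyl_form]) auto
    then show "F \<in> borel_measurable lborel"
      by (simp add: borel_measurable_continuous_onI)
  qed (simp add: F_def norm_mult)
  have F_eq: "F (X, Y) = (exp (\<i> * of_real (Z \<bullet> X)) * (of_real (ambiguity s X) * cinner_L2 (weyl_unitary X u) (blinfun_apply (adjoint_op S) (weyl_unitary Y v)))) *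
      (exp (- (\<i> * of_real (Z \<bullet> Y))) * of_real (ambiguity (1 / s) Y))" for X Y
  proof -
    have "exp (\<i> * of_real (Z \<bullet> (X - Y))) = exp (\<i> * of_real (Z \<bullet> X)) * exp (- (\<i> * of_real (Z \<bullet> Y)))"
      by (simp add: inner_diff_right algebra_simps flip: exp_add)
    then show ?thesis
      by (simp add: F_def weyl_form_def cinner_adjoint_op[OF S] mult_ac)
  qed
  have inner: "(LINT X|lborel. F (X, Y)) = (of_real (coherent_const TYPE('a) s) * cinner_L2 u (coherent s Z)) *
      cnj (exp (\<i> * of_real (Z \<bullet> Y)) * (of_real (ambiguity (1 / s) Y) * cinner_L2 (weyl_unitary Y v) (blinfun_apply S (coherent s Z))))" for Y
  proof -
    have "(LINT X|lborel. F (X, Y)) =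
        (of_real (coherent_const TYPE('a) s) * cinner_L2 u (coherent s Z) * cinner_L2 (coherent s Z) (blinfun_apply (adjoint_op S) (weyl_unitary Y v))) *
        (exp (- (\<i> * of_real (Z \<bullet> Y))) * of_real (ambiguity (1 / s) Y))"
      unfolding F_eq integral_mult_left_zero integral_coherent[OF s] ..
    moreover have "cnj (exp (\<i> * of_real (Z \<bullet> Y))) = exp (- (\<i> * of_real (Z \<bullet> Y)))"
      by (simp add: exp_cnj)
    ultimately show ?thesis
      by (simp add: cnj_cinner_L2 cinner_adjoint_op[OF S] mult_ac)
  qed
  have "(LINT P|lborel. F P) = (LINT Y|lborel. LINT X|lborel. F (X, Y))"
    by (rule integral_lborel_pair'[OF i])
  also have "\<dots> = (of_real (coherent_const TYPE('a) s) * cinner_L2 u (coherent s Z)) *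
      cnj (LINT Y|lborel. exp (\<i> * of_real (Z \<bullet> Y)) * (of_real (ambiguity (1 / s) Y) * cinner_L2 (weyl_unitary Y v) (blinfun_apply S (coherent s Z))))"
    unfolding inner integral_mult_right_zero by (simp only: Bochner_Integration.integral_cnj)
  also have "\<dots> = of_real (coherent_const TYPE('a) s * coherent_const TYPE('a) (1 / s)) * coherent_form s S u v Z"
    unfolding integral_coherent[OF s'] coherent_form_def by (simp add: cnj_cinner_L2 mult_ac)
  finally show ?thesis by (simp only: F_def)
qed

lemma cinner_translate_op:
  "cinner_L2 (blinfun_apply S (weyl_unitary X u)) (weyl_unitary X v) = cinner_L2 (blinfun_apply (translate_op (phase (- X)) S) u) v"
  by (simp add: translate_op_phase_apply cinner_weyl_unitary)

text \<open>An instance of \<open>gaussian_regularised_limit\<close> for \<open>weyl_form\<close>: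
  the Fourier side is evaluated by \<open>integral_weyl_form\<close>, the diagonal by
  \<open>ambiguity_mult\<close>.\<close>

lemma coherent_form_limit:
  fixes S :: "'a::euclidean_space L2 \<Rightarrow>\<^sub>L 'a L2"
  assumes s: "s > 0" and S: "S \<in> bounded_operators"
  shows "(\<lambda>n. of_real (coherent_const TYPE('a) s * coherent_const TYPE('a) (1 / s)) *
      (LINT Z|lborel. of_real (exp (- ((1 / Suc n)\<^sup>2 * (norm Z)\<^sup>2))) * coherent_form s S u v Z))
    \<longlonglongrightarrow> of_real ((2 * pi) ^ DIM('a \<times> 'a)) *
      (LINT X|lborel. of_real (exp (- ((s + 1 / s) / 4 * (norm X)\<^sup>2))) * cinner_L2 (blinfun_apply (translate_op (phase (- X)) S) u) v)"
proof -
  let ?cc = "complex_of_real (coherent_const TYPE('a) s * coherent_const TYPE('a) (1 / s))"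
  have "(\<lambda>n. LINT Z|lborel. of_real (exp (- ((1 / Suc n)\<^sup>2 * (norm Z)\<^sup>2))) *
      (LINT P|lborel. exp (\<i> * of_real (Z \<bullet> (fst P - snd P))) * weyl_form s S u v P))
    \<longlonglongrightarrow> of_real ((2 * pi) ^ DIM('a \<times> 'a)) * (LINT X|lborel. weyl_form s S u v (X, X))"
  proof (rule gaussian_regularised_limit)
    show "cmod (weyl_form s S u v (X, Y)) \<le> norm S * norm u * norm v * ambiguity (1 / s) Y" for X Y
    proof -
      have "0 \<le> norm S * norm u * norm v * ambiguity (1 / s) Y"
        using ambiguity_pos[of "1 / s" Y] by simp
      from mult_right_mono[OF ambiguity_le_1[OF s, of X] this] cmod_weyl_form_le[OF s, of S u v X Y]
      show ?thesis by simp
    qed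
    show "integrable lborel (\<lambda>Y::'a\<times>'a. norm S * norm u * norm v * ambiguity (1 / s) Y)"
      using s by (intro integrable_mult_right integrable_ambiguity) simp
    show "(\<lambda>n. 1 / real (Suc n)) \<longlonglongrightarrow> 0"
      by (rule LIMSEQ_Suc[OF lim_1_over_n])
  qed (use continuous_on_weyl_form integrable_weyl_form[OF s] in auto)
  moreover have "(LINT Z|lborel. of_real (exp (- ((1 / Suc n)\<^sup>2 * (norm Z)\<^sup>2))) *
      (LINT P|lborel. exp (\<i> * of_real (Z \<bullet> (fst P - snd P))) * weyl_form s S u v P)) =
    ?cc * (LINT Z|lborel. of_real (exp (- ((1 / Suc n)\<^sup>2 * (norm Z)\<^sup>2))) * coherent_form s S u v Z)" for n
    unfolding integral_weyl_form[OF s S] integral_mult_right_zero[symmetric] by (simp only: mult.left_commute)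
  moreover have "weyl_form s S u v (X, X) = of_real (exp (- ((s + 1 / s) / 4 * (norm X)\<^sup>2))) *
      cinner_L2 (blinfun_apply (translate_op (phase (- X)) S) u) v" for X
    by (simp only: weyl_form_def fst_conv snd_conv ambiguity_mult[OF s] cinner_translate_op)
  ultimately show ?thesis by (simp only:)
qed

text \<open>Inside the ball the coefficient of \<open>u\<close> is at most \<open>M\<close> and the
  other factors are bounded. Outside, \<open>S\<close> contributes at most \<open>\<tau>\<close>,
  and the product of the coefficients of \<open>u\<close> and \<open>v\<close> is at most the sum of
  their squares, which \<open>coherent_bessel\<close> integrates. The bound is free of
  \<open>c\<close>.\<close>

lemma coherent_form_integral_le:
  fixes S :: "'a::euclidean_space L2 \<Rightarrow>\<^sub>L 'a L2"
  assumes s: "s > 0" and c: "c > 0" and uv: "norm u \<le> 1" "norm v \<le> 1"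
    and M: "M \<ge> 0" "\<And>Z. norm Z \<le> R \<Longrightarrow> cmod (cinner_L2 u (coherent s Z)) \<le> M"
    and \<tau>: "\<tau> \<ge> 0" "\<And>Z. norm Z > R \<Longrightarrow> norm (blinfun_apply S (coherent s Z)) \<le> \<tau>"
  shows "cmod (LINT Z|lborel. of_real (exp (- (c * (norm Z)\<^sup>2))) * coherent_form s S u v Z) \<le>
    M * (norm S * norm (gauss_L2 s :: 'a L2) * (norm (gauss_L2 (1 / s) :: 'a L2))\<^sup>2 * measure lborel (cball (0 :: 'a \<times> 'a) R)) +
    \<tau> * (norm (gauss_L2 (1 / s) :: 'a L2) * ((2 * pi) ^ DIM('a \<times> 'a) / coherent_const TYPE('a) s + (2 * pi) ^ DIM('a \<times> 'a) / coherent_const TYPE('a) (1 / s)))"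
proof -
  let ?k = "\<lambda>Z::'a \<times> 'a. exp (- (c * (norm Z)\<^sup>2))"
  define m where "m = norm (gauss_L2 s :: 'a L2)"
  define m' where "m' = norm (gauss_L2 (1 / s) :: 'a L2)"
  define D :: real where "D = (2 * pi) ^ DIM('a \<times> 'a)"
  define p where "p Z = cmod (cinner_L2 u (coherent s Z))" for Z
  define q where "q Z = cmod (cinner_L2 v (coherent (1 / s) Z))" for Z
  have s': "1 / s > 0" using s by simp
  have m0: "m \<ge> 0" "m' \<ge> 0" by (simp_all add: m_def m'_def)
  have q: "cmod (cinner_L2 (coherent (1 / s) Z) v) = q Z" for Z
    unfolding q_def by (metis cnj_cinner_L2 complex_mod_cnj)
  have form_le: "cmod (coherent_form s S u v Z) \<le> p Z * (norm (blinfun_apply S (coherent s Z)) * m') * q Z" for Z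
    unfolding coherent_form_def norm_mult q p_def[symmetric]
    using cmod_cinner_L2_le[of "blinfun_apply S (coherent s Z)" "coherent (1 / s) Z"]
    by (intro mult_right_mono mult_left_mono) (simp_all add: m'_def p_def q_def)
  have q_le: "q Z \<le> m'" for Z
  proof -
    have "q Z \<le> norm v * m'"
      using cmod_cinner_L2_le[of v "coherent (1 / s) Z"] by (simp add: q_def m'_def)
    also have "\<dots> \<le> 1 * m'" using uv(2) m0 by (intro mult_right_mono)
    finally show ?thesis by simp
  qed
  define A where "A = norm S * m * m'\<^sup>2"
  \<comment> \<open>Each summand is the estimate for one of the two regions; the other one is
    nonnegative there, so a single majorant serves all \<open>Z\<close>.\<close>
  define w where "w Z = M * A * indicator (cball 0 R) Z + \<tau> * m' * (?k Z * (p Z)\<^sup>2 + ?k Z * (q Z)\<^sup>2)" for Z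
  have A0: "A \<ge> 0" by (simp add: A_def m0)
  have k01: "0 \<le> ?k Z" "?k Z \<le> 1" for Z using c by auto
  have w: "cmod (of_real (?k Z) * coherent_form s S u v Z) \<le> w Z" for Z
  proof (cases "norm Z \<le> R")
    case True
    have "cmod (coherent_form s S u v Z) \<le> p Z * (norm (blinfun_apply S (coherent s Z)) * m') * q Z"
      by (rule form_le)
    also have "\<dots> \<le> M * ((norm S * m) * m') * m'"
      using M(2)[OF True] norm_blinfun[of S "coherent s Z"] q_le[of Z] m0 M(1)
      by (intro mult_mono) (auto simp: p_def q_def m_def)
    also have "\<dots> = M * A" by (simp add: A_def power2_eq_square mult_ac)
    finally have "?k Z * cmod (coherent_form s S u v Z) \<le> 1 * (M * A)"
      using k01[of Z] M(1) A0 by (intro mult_mono) auto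
    moreover have "0 \<le> \<tau> * m' * (?k Z * (p Z)\<^sup>2 + ?k Z * (q Z)\<^sup>2)"
      using \<tau>(1) m0 by (intro mult_nonneg_nonneg add_nonneg_nonneg) auto
    ultimately show ?thesis
      using True by (simp add: w_def norm_mult)
  next
    case False
    then have Z: "norm Z > R" by simp
    have "cmod (coherent_form s S u v Z) \<le> p Z * (norm (blinfun_apply S (coherent s Z)) * m') * q Z"
      by (rule form_le)
    also have "\<dots> \<le> p Z * (\<tau> * m') * q Z"
      using \<tau>(2)[OF Z] m0 by (intro mult_right_mono mult_left_mono) (auto simp: p_def q_def)
    also have "\<dots> = \<tau> * m' * (p Z * q Z)" by (simp add: mult_ac)
    also have "\<dots> \<le> \<tau> * m' * ((p Z)\<^sup>2 + (q Z)\<^sup>2)"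
    proof (rule mult_left_mono)
      have "0 \<le> (p Z - q Z)\<^sup>2" "0 \<le> p Z * q Z" by (simp_all add: p_def q_def)
      then show "p Z * q Z \<le> (p Z)\<^sup>2 + (q Z)\<^sup>2" by (simp add: power2_diff)
    qed (use \<tau>(1) m0 in simp)
    finally have "?k Z * cmod (coherent_form s S u v Z) \<le> ?k Z * (\<tau> * m' * ((p Z)\<^sup>2 + (q Z)\<^sup>2))"
      by (rule mult_left_mono) (rule k01)
    then show ?thesis
      using False by (simp add: w_def norm_mult algebra_simps)
  qed
  note bp = coherent_bessel[OF s c, of u, folded p_def] and bq = coherent_bessel[OF s' c, of v, folded q_def]
  have wi: "integrable lborel w"
    unfolding w_def
    by (intro Bochner_Integration.integrable_add integrable_indicator_cball integrable_mult_right bp(1) bq(1))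
  have "cmod (LINT Z|lborel. of_real (?k Z) * coherent_form s S u v Z) \<le> (LINT Z|lborel. w Z)"
  proof (rule Bochner_Integration.integral_norm_bound_integral[OF _ wi w])
    show "integrable lborel (\<lambda>Z. of_real (?k Z) * coherent_form s S u v Z)"
    proof (rule Bochner_Integration.integrable_bound[OF wi])
      have "continuous_on UNIV (\<lambda>Z. of_real (?k Z) * coherent_form s S u v Z)"
        unfolding coherent_form_def by (intro continuous_intros)
      then show "(\<lambda>Z. of_real (?k Z) * coherent_form s S u v Z) \<in> borel_measurable lborel"
        by (simp add: borel_measurable_continuous_onI)
      show "AE Z in lborel. norm (of_real (?k Z) * coherent_form s S u v Z) \<le> norm (w Z)"
        by (rule AE_I2) (use w order_trans[OF _ abs_ge_self] in auto)
    qed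
  qed
  also have "(LINT Z|lborel. w Z) = M * A * measure lborel (cball (0 :: 'a \<times> 'a) R) +
      \<tau> * m' * ((LINT Z|lborel. ?k Z * (p Z)\<^sup>2) + (LINT Z|lborel. ?k Z * (q Z)\<^sup>2))"
  proof -
    have 1: "(LINT Z|lborel. M * A * indicator (cball (0 :: 'a \<times> 'a) R) Z) = M * A * measure lborel (cball (0 :: 'a \<times> 'a) R)"
      by simp
    have 2: "(LINT Z|lborel. \<tau> * m' * (?k Z * (p Z)\<^sup>2 + ?k Z * (q Z)\<^sup>2)) =
      \<tau> * m' * ((LINT Z|lborel. ?k Z * (p Z)\<^sup>2) + (LINT Z|lborel. ?k Z * (q Z)\<^sup>2))"
      by (subst integral_mult_right_zero, subst Bochner_Integration.integral_add[OF bp(1) bq(1)]) (rule refl)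
    show ?thesis
      unfolding w_def
      by (subst Bochner_Integration.integral_add)
        (intro integrable_indicator_cball integrable_mult_right Bochner_Integration.integrable_add bp(1) bq(1)
          | simp only: 1 2)+
  qed
  also have "\<dots> \<le> M * A * measure lborel (cball (0 :: 'a \<times> 'a) R) +
      \<tau> * m' * (D / coherent_const TYPE('a) s + D / coherent_const TYPE('a) (1 / s))"
  proof -
    have "(norm u)\<^sup>2 \<le> 1" "(norm v)\<^sup>2 \<le> 1"
      using uv by (simp_all add: power_le_one)
    then have "(norm u)\<^sup>2 * D \<le> D" "(norm v)\<^sup>2 * D \<le> D"
      by (auto simp: D_def intro!: mult_left_le_one_le)
    then have "coherent_const TYPE('a) s * (LINT Z|lborel. ?k Z * (p Z)\<^sup>2) \<le> D"
      "coherent_const TYPE('a) (1 / s) * (LINT Z|lborel. ?k Z * (q Z)\<^sup>2) \<le> D"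
      using order_trans[OF bp(2)[folded D_def]] order_trans[OF bq(2)[folded D_def]] by blast+
    then have "(LINT Z|lborel. ?k Z * (p Z)\<^sup>2) \<le> D / coherent_const TYPE('a) s"
      "(LINT Z|lborel. ?k Z * (q Z)\<^sup>2) \<le> D / coherent_const TYPE('a) (1 / s)"
      using coherent_const_pos[OF s, where 'a = 'a] coherent_const_pos[OF s', where 'a = 'a]
      by (simp_all only: pos_le_divide_eq mult.commute)
    then show ?thesis
      using \<tau>(1) m0 by (intro add_left_mono mult_left_mono add_mono) simp_all
  qed
  finally show ?thesis
    by (simp only: A_def m_def m'_def D_def mult_ac)
qed

text \<open>For large \<open>s\<close> the rate \<open>(s + 1 / s) / 4\<close> is large. Dilating by
  the inverse of its square root normalises the weight and evaluates \<open>d\<close> at points that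
  shrink to 0, where dominated convergence applies. The right-hand side is \<open>e\<close> times
  the mass of the weight.\<close>

lemma gaussian_average_limit:
  fixes d :: "'e::euclidean_space \<Rightarrow> real"
  assumes d: "continuous_on UNIV d" "\<And>x. 0 \<le> d x" "\<And>x. d x \<le> C" "d 0 = 0" and e: "e > 0"
  obtains s where "s > 0"
    "(LINT X|lborel. exp (- ((s + 1 / s) / 4 * (norm X)\<^sup>2)) * d X) \<le>
      e * sqrt (pi / ((s + 1 / s) / 4)) ^ DIM('e)"
proof -
  define \<kappa> where "\<kappa> n = (real (Suc n) + 1 / real (Suc n)) / 4" for n
  define r where "r n = 1 / sqrt (\<kappa> n)" for n
  have \<kappa>_ge: "\<kappa> n \<ge> real (Suc n) / 4" and \<kappa>: "\<kappa> n > 0" for n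
    by (simp_all add: \<kappa>_def add_pos_pos)
  have r0: "r n > 0" for n using \<kappa> by (simp add: r_def)
  have [measurable]: "d \<in> borel_measurable borel"
    by (rule borel_measurable_continuous_onI[OF d(1)])
  have "r \<longlonglongrightarrow> 0"
  proof -
    have "filterlim (\<lambda>n. real (Suc n) / 4) at_top sequentially"
      by real_asymp
    then have "filterlim \<kappa> at_top sequentially"
      by (rule filterlim_at_top_mono) (intro always_eventually allI \<kappa>_ge)
    then have "filterlim (\<lambda>n. sqrt (\<kappa> n)) at_top sequentially"
      by (rule filterlim_compose[OF sqrt_at_top])
    from tendsto_inverse_0_at_top[OF this] show ?thesis
      by (simp add: r_def[abs_def] inverse_eq_divide)
  qed
  have g: "integrable lborel (\<lambda>x::'e. exp (- (1 * (norm x)\<^sup>2)))"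
    by (rule integrable_gaussian) simp
  have "(\<lambda>n. LINT Y|lborel. exp (- (1 * (norm Y)\<^sup>2)) * d (r n *\<^sub>R Y)) \<longlonglongrightarrow> (LINT Y|(lborel :: 'e measure). (0::real))"
  proof (rule integral_dominated_convergence[where w = "\<lambda>Y. C * exp (- (1 * (norm Y)\<^sup>2))"])
    show "integrable lborel (\<lambda>Y::'e. C * exp (- (1 * (norm Y)\<^sup>2)))"
      by (intro integrable_mult_right g)
    show "AE Y in lborel. (\<lambda>n. exp (- (1 * (norm Y)\<^sup>2)) * d (r n *\<^sub>R Y)) \<longlonglongrightarrow> 0"
    proof (rule AE_I2)
      fix Y :: 'e
      have "(\<lambda>n. r n *\<^sub>R Y) \<longlonglongrightarrow> 0 *\<^sub>R Y"
        by (intro tendsto_intros \<open>r \<longlonglongrightarrow> 0\<close>)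
      then have "(\<lambda>n. d (r n *\<^sub>R Y)) \<longlonglongrightarrow> d 0"
        using continuous_on_tendsto_compose[OF d(1)] by simp
      then show "(\<lambda>n. exp (- (1 * (norm Y)\<^sup>2)) * d (r n *\<^sub>R Y)) \<longlonglongrightarrow> 0"
        using d(4) by (auto intro!: tendsto_mult_right_zero)
    qed
    show "AE Y in lborel. norm (exp (- (1 * (norm Y)\<^sup>2)) * d (r n *\<^sub>R Y)) \<le> C * exp (- (1 * (norm Y)\<^sup>2))" for n
      using d(2,3) by (intro AE_I2) (simp add: abs_mult)
  qed measurable
  then have "(\<lambda>n. LINT Y|lborel. exp (- (1 * (norm Y)\<^sup>2)) * d (r n *\<^sub>R Y)) \<longlonglongrightarrow> 0"
    by simp
  moreover have "e * sqrt pi ^ DIM('e) > 0" using e by simp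
  ultimately have "eventually (\<lambda>n. (LINT Y|lborel. exp (- (1 * (norm Y)\<^sup>2)) * d (r n *\<^sub>R Y)) < e * sqrt pi ^ DIM('e)) sequentially"
    by (rule order_tendstoD(2))
  then obtain n where n: "(LINT Y|lborel. exp (- (1 * (norm Y)\<^sup>2)) * d (r n *\<^sub>R Y)) < e * sqrt pi ^ DIM('e)"
    by (auto simp: eventually_sequentially)
  have "(LINT X|lborel. exp (- (\<kappa> n * (norm X)\<^sup>2)) * d X) =
      r n ^ DIM('e) * (LINT Y|lborel. exp (- (\<kappa> n * (norm (r n *\<^sub>R Y))\<^sup>2)) * d (r n *\<^sub>R Y))"
    using lborel_integral_scaleR[OF r0, of "\<lambda>X. exp (- (\<kappa> n * (norm X)\<^sup>2)) * d X"] by simp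
  also have "(\<lambda>Y. exp (- (\<kappa> n * (norm (r n *\<^sub>R Y))\<^sup>2)) * d (r n *\<^sub>R Y)) =
      (\<lambda>Y::'e. exp (- (1 * (norm Y)\<^sup>2)) * d (r n *\<^sub>R Y))"
  proof
    fix Y :: 'e
    have "\<kappa> n * (norm (r n *\<^sub>R Y))\<^sup>2 = 1 * (norm Y)\<^sup>2"
      using \<kappa>[of n] by (simp add: r_def power_mult_distrib power_divide)
    then show "exp (- (\<kappa> n * (norm (r n *\<^sub>R Y))\<^sup>2)) * d (r n *\<^sub>R Y) = exp (- (1 * (norm Y)\<^sup>2)) * d (r n *\<^sub>R Y)"
      by (simp only:)
  qed
  also have "r n ^ DIM('e) * (LINT Y|lborel. exp (- (1 * (norm Y)\<^sup>2)) * d (r n *\<^sub>R Y)) \<le>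
      r n ^ DIM('e) * (e * sqrt pi ^ DIM('e))"
    using n r0[of n] by (intro mult_left_mono) (simp_all add: less_imp_le)
  also have "\<dots> = e * (r n * sqrt pi) ^ DIM('e)"
    by (simp add: power_mult_distrib)
  also have "r n * sqrt pi = sqrt (pi / \<kappa> n)"
    by (simp add: r_def real_sqrt_divide)
  finally show ?thesis
    by (intro that[of "real (Suc n)"]) (simp_all only: \<kappa>_def of_nat_0_less_iff zero_less_Suc)
qed

text \<open>A quantitative form of compactness: up to \<open>e\<close>, \<open>S u\<close> is
  controlled by the coherent coefficients of \<open>u\<close> on a ball whose radius does not depend
  on \<open>u\<close>. Half of \<open>e\<close> pays for replacing \<open>S\<close> by its Gaussian
  average, the other half for the tail outside the ball.\<close>

lemma norm_le_coherent:
  fixes S :: "'a::euclidean_space L2 \<Rightarrow>\<^sub>L 'a L2"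
  assumes S: "S \<in> norm_continuous_operators"
    and lim: "\<And>u. ((\<lambda>X. norm (blinfun_apply (translate_op X S) u)) \<longlongrightarrow> 0) frechet_filter"
    and e: "e > 0"
  shows "\<exists>s>0. \<exists>R. \<exists>B\<ge>0. \<forall>u M. norm u \<le> 1 \<longrightarrow> M \<ge> 0 \<longrightarrow>
    (\<forall>Z. norm Z \<le> R \<longrightarrow> cmod (cinner_L2 u (coherent s Z)) \<le> M) \<longrightarrow>
    norm (blinfun_apply S u) \<le> B * M + e"
proof -
  have Sb: "S \<in> bounded_operators" and cont: "continuous_on UNIV (\<lambda>X. translate_op X S)"
    using S by (auto simp: norm_continuous_operators_def)
  define d where "d X = norm (translate_op (phase (- X)) S - S)" for X :: "'a \<times> 'a"
  have d_cont: "continuous_on UNIV d"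
    unfolding d_def
    by (intro continuous_intros continuous_on_compose2[OF cont] continuous_on_compose2[OF continuous_on_phase[of UNIV]]) auto
  have d0: "d 0 = 0"
  proof -
    have "translate_op (phase 0) S = S"
      by (rule blinfun_eqI) (simp add: translate_op_phase_apply)
    then show ?thesis by (simp add: d_def)
  qed
  have d_le: "d X \<le> 2 * norm S" for X
    using norm_triangle_ineq4[of "translate_op (phase (- X)) S" S] norm_translate_op_le[of "phase (- X)" S]
    by (simp add: d_def)
  have d_ge: "0 \<le> d X" for X by (simp add: d_def)
  obtain s where s: "s > 0" and avg: "(LINT X|lborel. exp (- ((s + 1 / s) / 4 * (norm X)\<^sup>2)) * d X) \<le>
      e / 2 * sqrt (pi / ((s + 1 / s) / 4)) ^ DIM('a \<times> 'a)"
    using gaussian_average_limit[OF d_cont d_ge d_le d0, of "e / 2"] e by auto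
  have s': "1 / s > 0" using s by simp
  define \<kappa> where "\<kappa> = (s + 1 / s) / 4"
  have \<kappa>: "\<kappa> > 0" using s by (simp add: \<kappa>_def add_pos_pos)
  define I where "I = sqrt (pi / \<kappa>) ^ DIM('a \<times> 'a)"
  have I: "I > 0" using \<kappa> by (simp add: I_def)
  define D :: real where "D = (2 * pi) ^ DIM('a \<times> 'a)"
  have D: "D > 0" by (simp add: D_def)
  define cc where "cc = coherent_const TYPE('a) s * coherent_const TYPE('a) (1 / s)"
  have cc: "cc > 0" using coherent_const_pos[OF s, where 'a = 'a] coherent_const_pos[OF s', where 'a = 'a] by (simp add: cc_def)
  define T where "T = norm (gauss_L2 (1 / s) :: 'a L2) * (D / coherent_const TYPE('a) s + D / coherent_const TYPE('a) (1 / s))"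
  have T: "T \<ge> 0"
    using D coherent_const_pos[OF s, where 'a = 'a] coherent_const_pos[OF s', where 'a = 'a] by (simp add: T_def)
  \<comment> \<open>Makes the final contribution of the tail at most \<open>e / 2\<close>;
    \<open>T + 1\<close> is used because \<open>T\<close> is only known to be nonnegative.\<close>
  define \<tau> where "\<tau> = (e / 2) / ((T + 1) * (cc / (D * I)))"
  have \<tau>: "\<tau> > 0" using e T cc D I by (simp add: \<tau>_def)
  have \<tau>_le: "(cc / (D * I)) * (\<tau> * T) \<le> e / 2"
  proof -
    define y where "y = cc / (D * I)"
    have "y > 0" "T + 1 > 0" using T cc D I by (simp_all add: y_def)
    then have "y * (\<tau> * T) = (e / 2) * (T / (T + 1))"
      unfolding \<tau>_def y_def[symmetric] by (simp add: divide_simps)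
    then have "(cc / (D * I)) * (\<tau> * T) = (e / 2) * (T / (T + 1))"
      by (simp only: y_def)
    also have "\<dots> \<le> (e / 2) * 1"
      using e T by (intro mult_left_mono) simp_all
    finally show ?thesis by simp
  qed
  have "eventually (\<lambda>X. norm (blinfun_apply (translate_op X S) (gauss_L2 s)) < \<tau>) frechet_filter"
    by (rule order_tendstoD(2)[OF lim \<tau>])
  then obtain R where R: "\<And>X. norm X \<ge> R \<Longrightarrow> norm (blinfun_apply (translate_op (phase X) S) (gauss_L2 s)) < \<tau>"
    unfolding eventually_frechet_phase by blast
  \<comment> \<open>For \<open>X = - symplectic_rot Z\<close> the inner Weyl operator
    \<open>W(-X)\<close> sends the Gaussian to \<open>coherent s Z\<close>, and the outer one is
    isometric.\<close>
  have tail: "norm (blinfun_apply S (coherent s Z)) \<le> \<tau>" if "norm Z > R" for Z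
    using R[of "- symplectic_rot Z"] that by (simp add: translate_op_phase_apply coherent_def)
  define A where "A = norm S * norm (gauss_L2 s :: 'a L2) * (norm (gauss_L2 (1 / s) :: 'a L2))\<^sup>2 * measure lborel (cball (0 :: 'a \<times> 'a) R)"
  have A: "A \<ge> 0" by (simp add: A_def)
  show ?thesis
  proof (rule exI[of _ s], rule conjI[OF s], rule exI[of _ R], rule exI[of _ "(cc / (D * I)) * A"],
      intro conjI allI impI)
    show "0 \<le> (cc / (D * I)) * A" using cc D I A by simp
    fix u :: "'a L2" and M
    assume u: "norm u \<le> 1" and M0: "M \<ge> 0"
      and M_le: "\<forall>Z. norm Z \<le> R \<longrightarrow> cmod (cinner_L2 u (coherent s Z)) \<le> M"
    note M = M0 M_le[rule_format]
    \<comment> \<open>\<open>I\<close> is the mass of the weight and \<open>J\<close> the weighted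
      integral of the matrix elements of the translates. So \<open>I * b\<close> differs from
      \<open>J\<close> by at most the integral of the weight times \<open>d\<close>, while
      \<open>J\<close> is bounded through \<open>coherent_form_limit\<close>.\<close>
    have main: "cmod (cinner_L2 (blinfun_apply S u) v) \<le> (cc / (D * I)) * A * M + e" if v: "norm v \<le> 1" for v
    proof -
      define J where "J = (LINT X|lborel. of_real (exp (- (\<kappa> * (norm X)\<^sup>2))) * cinner_L2 (blinfun_apply (translate_op (phase (- X)) S) u) v)"
      have lim: "(\<lambda>n. cmod (of_real cc * (LINT Z|lborel. of_real (exp (- ((1 / Suc n)\<^sup>2 * (norm Z)\<^sup>2))) * coherent_form s S u v Z)))
        \<longlonglongrightarrow> cmod (of_real D * J)"
        unfolding J_def D_def cc_def \<kappa>_def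
        by (intro tendsto_norm coherent_form_limit s Sb)
      have "cmod (of_real D * J) \<le> cc * (M * A + \<tau> * T)"
      proof (rule LIMSEQ_le_const2[OF lim], intro exI allI impI)
        fix n
        have "cmod (LINT Z|lborel. of_real (exp (- ((1 / Suc n)\<^sup>2 * (norm Z)\<^sup>2))) * coherent_form s S u v Z) \<le> M * A + \<tau> * T"
          unfolding A_def T_def D_def
          by (rule coherent_form_integral_le[OF s _ u v M _ tail]) (use \<tau> in simp_all)
        then show "cmod (of_real cc * (LINT Z|lborel. of_real (exp (- ((1 / Suc n)\<^sup>2 * (norm Z)\<^sup>2))) * coherent_form s S u v Z)) \<le> cc * (M * A + \<tau> * T)"
          using cc by (simp add: norm_mult mult_left_mono)
      qed
      then have J: "cmod J \<le> cc / D * (M * A + \<tau> * T)"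
        using D by (simp add: norm_mult field_simps)
      have Gi: "integrable lborel (\<lambda>X::'a \<times> 'a. exp (- (\<kappa> * (norm X)\<^sup>2)))"
        by (rule integrable_gaussian[OF \<kappa>])
      define b where "b = cinner_L2 (blinfun_apply S u) v"
      define a where "a X = cinner_L2 (blinfun_apply (translate_op (phase (- X)) S) u) v" for X
      have a_cont: "continuous_on UNIV a"
      proof -
        have "a X = cinner_L2 (blinfun_apply S (weyl_unitary X u)) (weyl_unitary X v)" for X
          by (simp add: a_def cinner_translate_op)
        then show ?thesis
          by (simp add: continuous_intros)
      qed
      have ab: "cmod (a X - b) \<le> d X" for X
      proof -
        have "a X - b = cinner_L2 (blinfun_apply (translate_op (phase (- X)) S - S) u) v"
          by (simp add: a_def b_def minus_blinfun.rep_eq cinner_L2_diff_left)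
        also have "cmod \<dots> \<le> norm (blinfun_apply (translate_op (phase (- X)) S - S) u) * norm v"
          by (rule cmod_cinner_L2_le)
        also have "\<dots> \<le> (d X * norm u) * norm v"
          unfolding d_def by (intro mult_right_mono norm_blinfun) simp
        also have "\<dots> \<le> (d X * 1) * 1"
          using u v d_ge[of X] by (intro mult_mono) simp_all
        finally show ?thesis by simp
      qed
      have di: "integrable lborel (\<lambda>X. exp (- (\<kappa> * (norm X)\<^sup>2)) * d X)"
      proof (rule Bochner_Integration.integrable_bound)
        show "integrable lborel (\<lambda>X::'a\<times>'a. 2 * norm S * exp (- (\<kappa> * (norm X)\<^sup>2)))"
          by (intro integrable_mult_right Gi)
        have "continuous_on UNIV (\<lambda>X. exp (- (\<kappa> * (norm X)\<^sup>2)) * d X)"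
          by (intro continuous_intros d_cont)
        then show "(\<lambda>X. exp (- (\<kappa> * (norm X)\<^sup>2)) * d X) \<in> borel_measurable lborel"
          by (simp add: borel_measurable_continuous_onI)
        show "AE X in lborel. norm (exp (- (\<kappa> * (norm X)\<^sup>2)) * d X) \<le> norm (2 * norm S * exp (- (\<kappa> * (norm X)\<^sup>2)))"
          using d_le d_ge by (intro AE_I2) (simp add: abs_mult mult.commute)
      qed
      have abi: "integrable lborel (\<lambda>X. of_real (exp (- (\<kappa> * (norm X)\<^sup>2))) * (a X - b))"
      proof (rule Bochner_Integration.integrable_bound[OF di])
        have "continuous_on UNIV (\<lambda>X. of_real (exp (- (\<kappa> * (norm X)\<^sup>2))) * (a X - b))"
          by (intro continuous_intros a_cont)
        then show "(\<lambda>X. of_real (exp (- (\<kappa> * (norm X)\<^sup>2))) * (a X - b)) \<in> borel_measurable lborel"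
          by (simp add: borel_measurable_continuous_onI)
        show "AE X in lborel. norm (of_real (exp (- (\<kappa> * (norm X)\<^sup>2))) * (a X - b)) \<le> norm (exp (- (\<kappa> * (norm X)\<^sup>2)) * d X)"
          using ab d_ge by (intro AE_I2) (simp add: norm_mult abs_mult)
      qed
      have sum_J: "(LINT X|lborel. of_real (exp (- (\<kappa> * (norm (X :: 'a \<times> 'a))\<^sup>2))) * b) + (LINT X|lborel. of_real (exp (- (\<kappa> * (norm X)\<^sup>2))) * (a X - b)) = J"
      proof -
        have "integrable lborel (\<lambda>X::'a\<times>'a. complex_of_real (exp (- (\<kappa> * (norm X)\<^sup>2))) * b)"
          by (intro integrable_mult_left) (simp add: Gi)
        from Bochner_Integration.integral_add[OF this abi, symmetric] show ?thesis
          by (simp add: J_def a_def algebra_simps)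
      qed
      have Ib: "(LINT X|lborel. of_real (exp (- (\<kappa> * (norm (X :: 'a \<times> 'a))\<^sup>2))) * b) = of_real I * b"
        using integral_gaussian[OF \<kappa>, where 'e = "'a \<times> 'a"]
        unfolding integral_mult_left_zero integral_complex_of_real by (simp add: I_def)
      have "of_real I * b = J - (LINT X|lborel. of_real (exp (- (\<kappa> * (norm X)\<^sup>2))) * (a X - b))"
        using sum_J unfolding Ib eq_diff_eq .
      then have "cmod (of_real I * b) \<le> cmod J + cmod (LINT X|lborel. of_real (exp (- (\<kappa> * (norm X)\<^sup>2))) * (a X - b))"
        by (simp only: norm_triangle_ineq4)
      then have "I * cmod b \<le> cmod J + cmod (LINT X|lborel. of_real (exp (- (\<kappa> * (norm X)\<^sup>2))) * (a X - b))"
        unfolding norm_mult norm_of_real abs_of_pos[OF I] .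
      also have "cmod (LINT X|lborel. of_real (exp (- (\<kappa> * (norm X)\<^sup>2))) * (a X - b)) \<le>
          (LINT X|lborel. exp (- (\<kappa> * (norm X)\<^sup>2)) * d X)"
        by (rule Bochner_Integration.integral_norm_bound_integral[OF abi di])
          (simp add: norm_mult ab)
      also have "\<dots> \<le> e / 2 * I"
        using avg by (simp add: \<kappa>_def I_def)
      also have "cmod J \<le> cc / D * (M * A + \<tau> * T)" by (rule J)
      finally have "I * cmod b \<le> cc / D * (M * A + \<tau> * T) + e / 2 * I" by simp
      then have "cmod b \<le> (cc / D * (M * A + \<tau> * T) + e / 2 * I) / I"
        using I by (simp add: pos_le_divide_eq mult.commute)
      also have "\<dots> = (cc / (D * I)) * A * M + (cc / (D * I)) * (\<tau> * T) + e / 2"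
        using I D by (simp add: field_simps)
      also have "\<dots> \<le> (cc / (D * I)) * A * M + e / 2 + e / 2"
        by (intro add_mono order_refl \<tau>_le)
      finally show ?thesis
        by (simp add: b_def)
    qed
    show "norm (blinfun_apply S u) \<le> (cc / (D * I)) * A * M + e"
    proof (cases "blinfun_apply S u = 0")
      case True
      have "0 \<le> (cc / (D * I)) * A * M"
        using cc D I A M(1) by simp
      then show ?thesis using True e by simp
    next
      case False
      let ?w = "blinfun_apply S u"
      have "cinner_L2 ?w (?w /\<^sub>R norm ?w) = of_real (norm ?w)"
        using False by (simp add: bounded_bilinear.scaleR_right[OF bounded_bilinear_cinner_L2] cinner_L2_self
            scaleR_conv_of_real power2_eq_square)
      then show ?thesis
        using main[of "?w /\<^sub>R norm ?w"] False by simp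
    qed
  qed
qed

text \<open>By \<open>norm_le_coherent\<close>, points of the unit ball have close images once their
  coefficients against all \<open>coherent s Z\<close> with \<open>norm Z \<le> R\<close> are close.
  These states form a compact set, so finitely many functionals suffice for
  \<open>compact_closure_imageI\<close>.\<close>

lemma compact_if_translate_op_tendsto_0:
  fixes S :: "'a::euclidean_space L2 \<Rightarrow>\<^sub>L 'a L2"
  assumes S: "S \<in> norm_continuous_operators"
    and lim: "\<And>u. ((\<lambda>X. norm (blinfun_apply (translate_op X S) u)) \<longlongrightarrow> 0) frechet_filter"
  shows "S \<in> compact_operators"
proof -
  have "compact (closure (blinfun_apply S ` cball 0 1))"
  proof (rule compact_closure_imageI)
    fix e :: real assume e: "e > 0"
    then have e8: "e / 8 > 0" by simp
    obtain s R B where s: "s > 0" and B: "B \<ge> 0"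
      and bound: "\<And>u M. norm u \<le> 1 \<Longrightarrow> M \<ge> 0 \<Longrightarrow> (\<And>Z. norm Z \<le> R \<Longrightarrow> cmod (cinner_L2 u (coherent s Z)) \<le> M) \<Longrightarrow>
        norm (blinfun_apply S u) \<le> B * M + e / 8"
      using norm_le_coherent[OF S lim e8] by blast
    \<comment> \<open>The coefficients of \<open>w\<close> below are at most
      \<open>2 * \<delta>\<close>. Then \<open>B * (2 * \<delta>) \<le> e / 4\<close>, and with the
      error \<open>e / 8\<close> the sum stays below \<open>e / 2\<close>.\<close>
    define \<delta> where "\<delta> = e / (8 * (B + 1))"
    have \<delta>: "\<delta> > 0" using e B by (simp add: \<delta>_def)
    have "compact (coherent s ` cball 0 R)"
      by (intro compact_continuous_image continuous_intros compact_cball)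
    then obtain T :: "'a L2 set" where T: "finite T" "coherent s ` cball 0 R \<subseteq> (\<Union>t\<in>T. ball t \<delta>)"
      using \<delta> unfolding compact_eq_totally_bounded by blast
    have "compact (closure ((\<lambda>u. cinner_L2 u t) ` cball 0 1))" for t :: "'a L2"
    proof (rule compact_closure_subset[OF compact_cball])
      show "(\<lambda>u. cinner_L2 u t) ` cball 0 1 \<subseteq> cball 0 (norm t)"
      proof safe
        fix u :: "'a L2" assume "u \<in> cball 0 1"
        then show "cinner_L2 u t \<in> cball 0 (norm t)"
          using cmod_cinner_L2_le[of u t] mult_right_mono[of "norm u" 1 "norm t"] by simp
      qed
    qed
    moreover have "dist (blinfun_apply S x) (blinfun_apply S y) < e"
      if xy: "x \<in> cball 0 1" "y \<in> cball 0 1" and near: "\<forall>t\<in>T. dist (cinner_L2 x t) (cinner_L2 y t) < \<delta>" for x y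
    proof -
      \<comment> \<open>The difference is halved to lie in the unit ball, where \<open>bound\<close>
        applies.\<close>
      define w where "w = (1 / 2) *\<^sub>R (x - y)"
      have w: "norm w \<le> 1"
        using xy norm_triangle_ineq4[of x y] by (simp add: w_def)
      have "cmod (cinner_L2 w (coherent s Z)) \<le> 2 * \<delta>" if Z: "norm Z \<le> R" for Z
      proof -
        have "coherent s Z \<in> coherent s ` cball 0 R"
          using Z by (intro imageI) simp
        then obtain t where t: "t \<in> T" "norm (coherent s Z - t) < \<delta>"
          using T(2) by (metis (no_types, lifting) UN_iff dist_norm mem_ball norm_minus_commute subset_iff)
        have "cinner_L2 w (coherent s Z) = cinner_L2 w t + cinner_L2 w (coherent s Z - t)"
          by (simp add: cinner_L2_diff_right)
        then have "cmod (cinner_L2 w (coherent s Z)) \<le> cmod (cinner_L2 w t) + cmod (cinner_L2 w (coherent s Z - t))"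
          by (metis norm_triangle_ineq)
        also have "cmod (cinner_L2 w (coherent s Z - t)) \<le> 1 * \<delta>"
          by (rule order_trans[OF cmod_cinner_L2_le]) (use w t(2) in \<open>intro mult_mono, simp_all\<close>)
        also have "cmod (cinner_L2 w t) = dist (cinner_L2 x t) (cinner_L2 y t) / 2"
          by (simp add: w_def bounded_bilinear.scaleR_left[OF bounded_bilinear_cinner_L2] cinner_L2_diff_left dist_norm)
        also have "\<dots> \<le> \<delta>" using near t(1) \<delta> by fastforce
        finally show ?thesis by simp
      qed
      then have "norm (blinfun_apply S w) \<le> B * (2 * \<delta>) + e / 8"
        using \<delta> by (intro bound w) auto
      also have "B * (2 * \<delta>) \<le> e / 4"
        using e B by (simp add: \<delta>_def field_simps)
      finally have "norm (blinfun_apply S w) < e / 2" using e by simp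
      moreover have "norm (blinfun_apply S w) = dist (blinfun_apply S x) (blinfun_apply S y) / 2"
        by (simp add: w_def blinfun.scaleR_right blinfun.diff_right dist_norm)
      ultimately show ?thesis by simp
    qed
    ultimately show "\<exists>I h. \<exists>\<delta>>0. finite (I :: 'a L2 set) \<and>
      (\<forall>i\<in>I. compact (closure (h i ` cball 0 1 :: complex set))) \<and>
      (\<forall>x\<in>cball 0 1. \<forall>y\<in>cball 0 1. (\<forall>i\<in>I. dist (h i x) (h i y) < \<delta>) \<longrightarrow>
        dist (blinfun_apply S x) (blinfun_apply S y) < e)"
      using T(1) \<delta> by (intro exI[of _ T] exI[of _ "\<lambda>t u. cinner_L2 u t"] exI[of _ \<delta>] conjI) auto
  qed
  then show ?thesis
    using S by (simp add: compact_operators_def norm_continuous_operators_def)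
qed

theorem proposition1p2:
  fixes S :: "'a::euclidean_space L2 \<Rightarrow>\<^sub>L 'a L2"
  assumes "S \<in> norm_continuous_operators"
  shows "(\<forall>\<tau> \<in> {star_strong_topology, strict_topology compact_operators}.
            (S \<in> compact_operators \<longleftrightarrow>
               limitin \<tau> (\<lambda>X. translate_op X S) 0 frechet_filter) \<and>
            (S \<in> compact_operators \<longleftrightarrow>
               (\<forall>\<X> \<in> frechet_ultrafilters. limitin \<tau> (\<lambda>X. translate_op X S) 0 \<X>))) \<and>
         (\<forall>\<F> \<in> insert frechet_filter frechet_ultrafilters.
            limitin star_strong_topology (\<lambda>X. translate_op X S) 0 \<F> \<longleftrightarrow>
            limitin (strict_topology compact_operators) (\<lambda>X. translate_op X S) 0 \<F>)"
proof -
  have S: "S \<in> bounded_operators"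
    using assms by (simp add: norm_continuous_operators_def)
  have star_strict: "limitin star_strong_topology (\<lambda>X. translate_op X S) 0 \<F> \<longleftrightarrow>
      limitin (strict_topology compact_operators) (\<lambda>X. translate_op X S) 0 \<F>" for \<F>
    by (rule limitin_star_strong_iff_strict[OF translate_op_bounded_operators[OF S] norm_translate_op_le])
  have ultra: "(\<forall>\<X> \<in> frechet_ultrafilters. limitin \<tau> (\<lambda>X. translate_op X S) 0 \<X>) \<longleftrightarrow>
      limitin \<tau> (\<lambda>X. translate_op X S) 0 frechet_filter" for \<tau>
    unfolding frechet_ultrafilters_def
    using limitin_iff_ultrafilters[OF frechet_filter_phase_neq_bot, of \<tau> "\<lambda>X. translate_op X S" 0] by blast
  have compact: "S \<in> compact_operators \<longleftrightarrow> limitin star_strong_topology (\<lambda>X. translate_op X S) 0 frechet_filter"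
  proof
    assume "limitin star_strong_topology (\<lambda>X. translate_op X S) 0 frechet_filter"
    then show "S \<in> compact_operators"
      unfolding limitin_star_strong_iff[OF translate_op_bounded_operators[OF S]]
      by (intro compact_if_translate_op_tendsto_0[OF assms]) blast
  qed (rule limitin_translate_op_compact)
  show ?thesis
    by (simp add: ultra compact star_strict)
qed

end
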